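(* Let $\alpha\in(0,1)$ be a given significance level. Consider the asymptotics $p,T\to\infty$ and assume that the change-point location $\tau\in\{1,\dots,T-1\}$ satisfies $\min(\tau/T,\,1-\tau/T)\ge h_*>0$ for a fixed $h_*$. Let the minimal change-point energy $\mathcal R_{p,\tau}>0$ of the alternative (i.e. the lower bound imposed on $\mathcal E(\tau,\Theta_1,\Theta_2)=q(\tau/T)\|\Theta_1-\Theta_2\|_2$) satisfy (a) $\lim_{p,T\to\infty}\mathcal R_{p,\tau}\,(T/p)^{1/2}=0$ if $p\lesssim\sqrt T$; (b) $\lim_{p,T\to\infty}\mathcal R_{p,\tau}\,T^{1/4}=0$ if $p\gtrsim\sqrt T$. Then the type II error of any $\alpha$-level test $\psi_\alpha$ satisfies $$\liminf_{p,T\to\infty}\beta(\psi_\alpha,\mathcal R_{p,\tau})\ge1-\alpha;$$ that is, no $\alpha$-level test can detect changes of energy $\mathcal R_{p,\tau}=o\bigl(\sqrt{p/T}\wedge T^{-1/4}\bigr)$.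
   Context: $\|\cdot\|_2$ is the Frobenius norm, $\|\cdot\|_{\mathrm{op}}$ the operator norm, $q(s)=\sqrt{s(1-s)}$ for $s\in[0,1]$, $a\wedge b=\min(a,b)$. $X\lesssim Y$ (resp. $X\gtrsim Y$) means $X\le CY$ (resp. $X\ge CY$) for some absolute constant $C>0$. For $\gamma\in(0,1)$, $\mathcal M_p(R,\gamma)=\{M\in\mathbb R^{p\times p}:\operatorname{rank}(M)\le R,\ \|M\|_{\mathrm{op}}\le\gamma\}$. Model. One observes $\mathfrak X=(X_0,\dots,X_T)$, a piecewise stationary centered Gaussian $p$-dimensional process: $X_{t+1}=\Theta^tX_t+Z_{t+1}$, $t=0,\dots,T-1$, with $Z_t$ i.i.d. $\mathcal N_p(0,\Sigma_Z)$, $\Sigma_Z$ positive definite, and $\Theta^t=\Theta_1\mathbf 1_{\{0\le t\le\tau\}}+\Theta_2\mathbf 1_{\{\tau+1\le t\le T\}}$, where $X_0\sim\mathcal N_p(0,\Sigma_1)$ is independent of the innovations and $\Sigma_1$ is the unique positive definite solution of $\Sigma_1=\Theta_1\Sigma_1\Theta_1^{\top}+\Sigma_Z$. $\mathrm P^{\tau}_{\Theta_1,\Theta_2}$ is the law of $\mathfrak X$ (written $\mathrm P_{\Theta_1,\Theta_2}$ when $\Theta_1=\Theta_2$). Testing problem. $\mathcal V_{p,0}=\{(\Theta_1,\Theta_2)\in\mathcal M_p(R,\gamma)^2:\Theta_1=\Theta_2\}$ (null hypothesis) and $\mathcal V_{p,\tau}(r)=\{(\Theta_1,\Theta_2)\in\mathcal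 M_p(R,\gamma)^2:\ q(\tau/T)\|\Theta_1-\Theta_2\|_2\ge r\}$ (alternative). A test is a measurable map $\psi:\mathfrak X\mapsto\{0,1\}$. It is of level $\alpha$ if $\sup_{(\Theta_1,\Theta_2)\in\mathcal V_{p,0}}\mathrm P_{\Theta_1,\Theta_2}\{\psi(\mathfrak X)=1\}\le\alpha$. Its type II error is $\beta(\psi,r)=\sup_{(\Theta_1,\Theta_2)\in\mathcal V_{p,\tau}(r)}\mathrm P^{\tau}_{\Theta_1,\Theta_2}\{\psi(\mathfrak X)=0\}$. *)

theory Defs
  imports "HOL-Probability.Probability" "Jordan_Normal_Form.DL_Rank"
begin

text \<open>The dimension \<open>p\<close> tends to infinity, so it has to be a term and not a type. Parameter
  matrices are elements of \<open>carrier_mat p p\<close>; random vectors are extensional functions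
  on \<open>{..<p}\<close>, so that they live in the product measurable space.\<close>

definition frob_norm :: "real mat \<Rightarrow> real" where
  "frob_norm M = sqrt (\<Sum>i<dim_row M. \<Sum>j<dim_col M. (M $$ (i, j))\<^sup>2)"

definition eucl_norm :: "real vec \<Rightarrow> real" where
  "eucl_norm v = sqrt (\<Sum>i<dim_vec v. (v $ i)\<^sup>2)"

definition op_norm :: "real mat \<Rightarrow> real" where
  "op_norm M = (SUP v \<in> {v \<in> carrier_vec (dim_col M). eucl_norm v \<le> 1}. eucl_norm (M *\<^sub>v v))"

definition pos_def_mat :: "nat \<Rightarrow> real mat \<Rightarrow> bool" where
  "pos_def_mat p S \<longleftrightarrow> S \<in> carrier_mat p p \<and> transpose_mat S = S \<and>
     (\<forall>v \<in> carrier_vec p. v \<noteq> 0\<^sub>v p \<longrightarrow> scalar_prod v (S *\<^sub>v v) > 0)"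

definition param_mats :: "nat \<Rightarrow> nat \<Rightarrow> real \<Rightarrow> real mat set" where
  "param_mats p R \<gamma> = {M \<in> carrier_mat p p. vec_space.rank p M \<le> R \<and> op_norm M \<le> \<gamma>}"

definition vec_measurable :: "nat \<Rightarrow> (nat \<Rightarrow> real) measure" where
  "vec_measurable p = (\<Pi>\<^sub>M i\<in>{..<p}. borel)"

definition apply_mat :: "nat \<Rightarrow> real mat \<Rightarrow> (nat \<Rightarrow> real) \<Rightarrow> nat \<Rightarrow> real" where
  "apply_mat p A x = (\<lambda>i\<in>{..<p}. \<Sum>j<p. A $$ (i, j) * x j)"

text \<open>A positive definite matrix has exactly one positive definite square root, so the
  choice below is only formal.\<close>

definition sqrt_mat :: "nat \<Rightarrow> real mat \<Rightarrow> real mat" where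
  "sqrt_mat p S = (SOME B. pos_def_mat p B \<and> B * B = S)"

text \<open>For positive definite \<open>S\<close>, the centered Gaussian law with covariance \<open>S\<close>, as the law of
  \<open>S\<^sup>1\<^sup>/\<^sup>2 \<xi>\<close> where \<open>\<xi>\<close> has independent standard normal coordinates.\<close>

definition std_gaussian :: "nat \<Rightarrow> (nat \<Rightarrow> real) measure" where
  "std_gaussian p = (\<Pi>\<^sub>M i\<in>{..<p}. density lborel std_normal_density)"

definition gaussian :: "nat \<Rightarrow> real mat \<Rightarrow> (nat \<Rightarrow> real) measure" where
  "gaussian p S = distr (std_gaussian p) (vec_measurable p) (apply_mat p (sqrt_mat p S))"

definition stationary_cov :: "nat \<Rightarrow> real mat \<Rightarrow> real mat \<Rightarrow> real mat" where
  "stationary_cov p \<Theta> \<Sigma>Z = (THE S. pos_def_mat p S \<and> S = \<Theta> * S * transpose_mat \<Theta> + \<Sigma>Z)"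

definition transition :: "nat \<Rightarrow> real mat \<Rightarrow> real mat \<Rightarrow> nat \<Rightarrow> real mat" where
  "transition \<tau> \<Theta>1 \<Theta>2 t = (if t \<le> \<tau> then \<Theta>1 else \<Theta>2)"

primrec trajectory ::
  "nat \<Rightarrow> (nat \<Rightarrow> real mat) \<Rightarrow> (nat \<Rightarrow> real) \<Rightarrow> (nat \<Rightarrow> nat \<Rightarrow> real) \<Rightarrow> nat \<Rightarrow> nat \<Rightarrow> real"
where
  "trajectory p \<Theta> x z 0 = x"
| "trajectory p \<Theta> x z (Suc t) =
     (\<lambda>i\<in>{..<p}. apply_mat p (\<Theta> t) (trajectory p \<Theta> x z t) i + z (Suc t) i)"

definition path_space :: "nat \<Rightarrow> nat \<Rightarrow> (nat \<Rightarrow> nat \<Rightarrow> real) measure" where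
  "path_space p T = (\<Pi>\<^sub>M t\<in>{..T}. vec_measurable p)"

definition var_law ::
  "nat \<Rightarrow> nat \<Rightarrow> real mat \<Rightarrow> nat \<Rightarrow> real mat \<Rightarrow> real mat \<Rightarrow> (nat \<Rightarrow> nat \<Rightarrow> real) measure"
where
  "var_law p T \<Sigma>Z \<tau> \<Theta>1 \<Theta>2 =
     distr (gaussian p (stationary_cov p \<Theta>1 \<Sigma>Z) \<Otimes>\<^sub>M (\<Pi>\<^sub>M t\<in>{1..T}. gaussian p \<Sigma>Z))
       (path_space p T)
       (\<lambda>(x, z). \<lambda>t\<in>{..T}. trajectory p (transition \<tau> \<Theta>1 \<Theta>2) x z t)"

definition q_weight :: "real \<Rightarrow> real" where
  "q_weight s = sqrt (s * (1 - s))"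

definition energy :: "nat \<Rightarrow> nat \<Rightarrow> real mat \<Rightarrow> real mat \<Rightarrow> real" where
  "energy T \<tau> \<Theta>1 \<Theta>2 = q_weight (real \<tau> / real T) * frob_norm (\<Theta>1 - \<Theta>2)"

definition null_params :: "nat \<Rightarrow> nat \<Rightarrow> real \<Rightarrow> (real mat \<times> real mat) set" where
  "null_params p R \<gamma> = {(\<Theta>1, \<Theta>2) \<in> param_mats p R \<gamma> \<times> param_mats p R \<gamma>. \<Theta>1 = \<Theta>2}"

definition alt_params ::
  "nat \<Rightarrow> nat \<Rightarrow> real \<Rightarrow> nat \<Rightarrow> nat \<Rightarrow> real \<Rightarrow> (real mat \<times> real mat) set"
where
  "alt_params p R \<gamma> T \<tau> r =
     {(\<Theta>1, \<Theta>2) \<in> param_mats p R \<gamma> \<times> param_mats p R \<gamma>. energy T \<tau> \<Theta>1 \<Theta>2 \<ge> r}"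

definition is_test :: "nat \<Rightarrow> nat \<Rightarrow> ((nat \<Rightarrow> nat \<Rightarrow> real) \<Rightarrow> nat) \<Rightarrow> bool" where
  "is_test p T \<psi> \<longleftrightarrow> \<psi> \<in> path_space p T \<rightarrow>\<^sub>M count_space {0, 1}"

text \<open>Under the null parameters the law does not depend on \<open>\<tau>\<close>. Suprema are taken in
  \<open>ennreal\<close>, so that a supremum over an empty parameter set is 0.\<close>

definition type_I_error ::
  "nat \<Rightarrow> nat \<Rightarrow> nat \<Rightarrow> real \<Rightarrow> real mat \<Rightarrow> nat \<Rightarrow> ((nat \<Rightarrow> nat \<Rightarrow> real) \<Rightarrow> nat) \<Rightarrow> ennreal"
where
  "type_I_error p T R \<gamma> \<Sigma>Z \<tau> \<psi> =
     (SUP (\<Theta>1, \<Theta>2) \<in> null_params p R \<gamma>.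
        emeasure (var_law p T \<Sigma>Z \<tau> \<Theta>1 \<Theta>2) {x \<in> space (path_space p T). \<psi> x = 1})"

definition type_II_error ::
  "nat \<Rightarrow> nat \<Rightarrow> nat \<Rightarrow> real \<Rightarrow> real mat \<Rightarrow> nat \<Rightarrow> ((nat \<Rightarrow> nat \<Rightarrow> real) \<Rightarrow> nat) \<Rightarrow> real \<Rightarrow> ennreal"
where
  "type_II_error p T R \<gamma> \<Sigma>Z \<tau> \<psi> r =
     (SUP (\<Theta>1, \<Theta>2) \<in> alt_params p R \<gamma> T \<tau> r.
        emeasure (var_law p T \<Sigma>Z \<tau> \<Theta>1 \<Theta>2) {x \<in> space (path_space p T). \<psi> x = 0})"

definition level_test ::
  "nat \<Rightarrow> nat \<Rightarrow> nat \<Rightarrow> real \<Rightarrow> real mat \<Rightarrow> nat \<Rightarrow> real \<Rightarrow> ((nat \<Rightarrow> nat \<Rightarrow> real) \<Rightarrow> nat) \<Rightarrow> bool"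
where
  "level_test p T R \<gamma> \<Sigma>Z \<tau> \<alpha> \<psi> \<longleftrightarrow>
     is_test p T \<psi> \<and> type_I_error p T R \<gamma> \<Sigma>Z \<tau> \<psi> \<le> ennreal \<alpha>"

text \<open>The distributions above are pushforwards along measurable maps, hence genuine
  probability measures.\<close>

lemma measurable_apply_mat:
  assumes "\<And>j. j < p \<Longrightarrow> (\<lambda>w. f w j) \<in> borel_measurable M"
  shows "(\<lambda>w. apply_mat p A (f w)) \<in> M \<rightarrow>\<^sub>M vec_measurable p"
  unfolding vec_measurable_def apply_mat_def
  by (intro measurable_restrict borel_measurable_sum borel_measurable_times) (auto simp: assms)

lemma sets_std_gaussian: "sets (std_gaussian p) = sets (vec_measurable p)"
  unfolding std_gaussian_def vec_measurable_def by (intro sets_PiM_cong) auto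

lemma measurable_vec_component: "j < p \<Longrightarrow> (\<lambda>x. x j) \<in> borel_measurable (vec_measurable p)"
  unfolding vec_measurable_def by (rule measurable_component_singleton) simp

lemma prob_space_std_gaussian: "prob_space (std_gaussian p)"
  unfolding std_gaussian_def by (intro prob_space_PiM prob_space_normal_density) simp

lemma prob_space_gaussian: "prob_space (gaussian p S)"
proof -
  interpret prob_space "std_gaussian p" by (rule prob_space_std_gaussian)
  have "apply_mat p (sqrt_mat p S) \<in> std_gaussian p \<rightarrow>\<^sub>M vec_measurable p"
    by (rule measurable_apply_mat)
      (simp add: measurable_cong_sets[OF sets_std_gaussian refl] measurable_vec_component)
  then show ?thesis unfolding gaussian_def by (rule prob_space_distr)
qed

lemma measurable_trajectory:
  assumes "t \<le> T"
  shows "(\<lambda>(x, z). trajectory p \<Theta> x z t)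
     \<in> vec_measurable p \<Otimes>\<^sub>M (\<Pi>\<^sub>M t\<in>{1..T}. vec_measurable p) \<rightarrow>\<^sub>M vec_measurable p"
  using assms
proof (induction t)
  case 0
  then show ?case by (simp add: case_prod_unfold)
next
  case (Suc t)
  let ?M = "vec_measurable p \<Otimes>\<^sub>M (\<Pi>\<^sub>M t\<in>{1..T}. vec_measurable p)"
  have IH: "(\<lambda>w. trajectory p \<Theta> (fst w) (snd w) t) \<in> ?M \<rightarrow>\<^sub>M vec_measurable p"
    using Suc by (simp add: case_prod_unfold)
  have A: "(\<lambda>w. apply_mat p (\<Theta> t) (trajectory p \<Theta> (fst w) (snd w) t)) \<in> ?M \<rightarrow>\<^sub>M vec_measurable p"
    by (intro measurable_apply_mat measurable_compose[OF IH] measurable_vec_component)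
  have Z: "(\<lambda>w. snd w (Suc t)) \<in> ?M \<rightarrow>\<^sub>M vec_measurable p"
    by (rule measurable_compose[OF measurable_snd], rule measurable_component_singleton)
      (use Suc.prems in auto)
  have "(\<lambda>w. \<lambda>i\<in>{..<p}. apply_mat p (\<Theta> t) (trajectory p \<Theta> (fst w) (snd w) t) i + snd w (Suc t) i)
      \<in> ?M \<rightarrow>\<^sub>M (\<Pi>\<^sub>M i\<in>{..<p}. borel)"
    by (intro measurable_restrict borel_measurable_add measurable_compose[OF A]
        measurable_compose[OF Z] measurable_vec_component) auto
  then show ?case
    unfolding case_prod_unfold trajectory.simps vec_measurable_def[symmetric] .
qed

lemma prob_space_var_law: "prob_space (var_law p T \<Sigma>Z \<tau> \<Theta>1 \<Theta>2)"
proof -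
  let ?N = "\<Pi>\<^sub>M t\<in>{1..T}. gaussian p \<Sigma>Z"
  let ?M = "gaussian p (stationary_cov p \<Theta>1 \<Sigma>Z) \<Otimes>\<^sub>M ?N"
  have N: "prob_space ?N" by (intro prob_space_PiM prob_space_gaussian)
  interpret pair_prob_space "gaussian p (stationary_cov p \<Theta>1 \<Sigma>Z)" ?N
    using N prob_space_gaussian
    by (simp add: pair_prob_space_def pair_sigma_finite_def prob_space_imp_sigma_finite)
  have G: "sets (gaussian p S) = sets (vec_measurable p)" for S by (simp add: gaussian_def)
  have S: "sets ?M = sets (vec_measurable p \<Otimes>\<^sub>M (\<Pi>\<^sub>M t\<in>{1..T}. vec_measurable p))"
    by (intro sets_pair_measure_cong sets_PiM_cong G refl)
  have "(\<lambda>w. \<lambda>t\<in>{..T}. trajectory p (transition \<tau> \<Theta>1 \<Theta>2) (fst w) (snd w) t)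
      \<in> ?M \<rightarrow>\<^sub>M path_space p T"
    unfolding path_space_def measurable_cong_sets[OF S refl]
    by (intro measurable_restrict measurable_trajectory[unfolded case_prod_unfold]) auto
  then have "(\<lambda>(x, z). \<lambda>t\<in>{..T}. trajectory p (transition \<tau> \<Theta>1 \<Theta>2) x z t) \<in> ?M \<rightarrow>\<^sub>M path_space p T"
    by (simp add: case_prod_unfold)
  then show ?thesis unfolding var_law_def by (rule P.prob_space_distr)
qed

end

theory Submission
  imports Defs
begin

text \<open>The null hypothesis is reduced to \<open>\<Theta> = 0\<close> and the alternative to a uniform mixture of the
  rank-one matrices \<open>\<epsilon> u v\<^sup>T\<close>, where \<open>u\<close> and \<open>v\<close> are random sign combinations of the
  eigenvectors of \<open>\<Sigma>\<^sub>Z\<close> that belong to the upper and to the lower half of the spectrum. After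
  whitening, the likelihood ratios are given by a discrete Girsanov formula. As \<open>u\<close> and \<open>v\<close> are
  orthogonal, the second moment of the mixture factorises over time, and with \<open>N \<le> T\<close> steps after
  the change and \<open>m = p div 2\<close> it is at most
  \<open>exp (128 N \<epsilon>\<^sup>4) / sqrt (1 - (N \<epsilon>\<^sup>2 / m)\<^sup>2)\<close>. This tends to 1 because \<open>r = o(sqrt (p / T))\<close> and
  \<open>r = o(T powr (-1/4))\<close>, so the mixture cannot be told apart from the null hypothesis.\<close>

section \<open>Gaussian integrals\<close>

text \<open>With drift 0 the observations are i.i.d., so whitening turns the null law into pure
  noise. Against a single alternative the second moment contains a term of order N \<epsilon>^2,
  which would only exclude energies of order o(T^(-1/2)). For two independent draws of the signs the
  normalised overlap of the left vectors and that of the right vectors are each of order m^(-1/2),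
  so this term drops to N \<epsilon>^2 / m: here sqrt (p / T) originates. The other rate comes from
  the randomness of the state itself. In each step the exponential moment of a bilinear Gaussian
  form may exceed the exponential of its mean by a factor exp (O(\<epsilon>^4)), which averaging
  over signs does not remove.

  The obstacle to factorisation is that the state after the change feels the drift. It disappears
  because the product of two likelihood ratios reads the state only in the right directions, while
  the drifts move it only in the left ones.\<close>

abbreviation std_normal :: "real measure" where
  "std_normal \<equiv> density lborel std_normal_density"

definition dotp :: "nat \<Rightarrow> (nat \<Rightarrow> real) \<Rightarrow> (nat \<Rightarrow> real) \<Rightarrow> real" where
  "dotp p x y = (\<Sum>i<p. x i * y i)"

lemma dotp_commute: "dotp p x y = dotp p y x"
  by (simp add: dotp_def mult.commute)

lemma dotp_self_nonneg: "0 \<le> dotp p x x"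
  unfolding dotp_def by (intro sum_nonneg) simp

lemma measurable_dotp_vec:
  assumes "M = vec_measurable p \<or> M = std_gaussian p"
  shows "dotp p b \<in> borel_measurable M"
proof -
  have "dotp p b \<in> borel_measurable (vec_measurable p)"
    unfolding dotp_def
    by (intro borel_measurable_sum borel_measurable_times measurable_vec_component) auto
  then show ?thesis
    using assms by (auto simp: measurable_cong_sets[OF sets_std_gaussian refl])
qed

lemmas measurable_dotp [measurable] =
  measurable_dotp_vec[OF disjI1[OF refl]] measurable_dotp_vec[OF disjI2[OF refl]]

lemma prob_space_std_normal: "prob_space std_normal"
  by (rule prob_space_normal_density) simp

lemma product_sigma_finite_std_normal: "product_sigma_finite (\<lambda>_. std_normal)"
  by (simp add: product_sigma_finite_def prob_space_imp_sigma_finite prob_space_std_normal)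

text \<open>The Cameron-Martin formula on the line: after a translation of Lebesgue measure by
  \<open>h\<close> the exponential weight turns the translated density back into the standard one.
  Working in \<open>ennreal\<close> avoids integrability conditions on \<open>f\<close>.\<close>

lemma nn_integral_std_normal_shift:
  assumes [measurable]: "f \<in> borel_measurable borel"
  shows "(\<integral>\<^sup>+z. f (z + h) \<partial>std_normal) = (\<integral>\<^sup>+z. f z * ennreal (exp (h * z - h\<^sup>2 / 2)) \<partial>std_normal)"
proof -
  have e: "std_normal_density (h + x) * exp (h * (h + x) - h\<^sup>2 / 2) = std_normal_density x" for x
    unfolding std_normal_density_def
    by (simp add: exp_add[symmetric] mult_exp_exp field_simps power2_eq_square)
  have "(\<integral>\<^sup>+z. f z * ennreal (exp (h * z - h\<^sup>2 / 2)) \<partial>std_normal) =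
      (\<integral>\<^sup>+x. ennreal (std_normal_density x) * (f x * ennreal (exp (h * x - h\<^sup>2 / 2))) \<partial>lborel)"
    by (simp add: nn_integral_density)
  also have "\<dots> = (\<integral>\<^sup>+x. ennreal (std_normal_density (h + x)) *
      (f (h + x) * ennreal (exp (h * (h + x) - h\<^sup>2 / 2))) \<partial>lborel)"
    by (subst nn_integral_real_affine[where c = 1 and t = h]) auto
  also have "\<dots> = (\<integral>\<^sup>+x. ennreal (std_normal_density x) * f (x + h) \<partial>lborel)"
  proof (intro nn_integral_cong)
    fix x
    have "ennreal (std_normal_density (h + x)) * (f (h + x) * ennreal (exp (h * (h + x) - h\<^sup>2 / 2))) =
        ennreal (std_normal_density (h + x) * exp (h * (h + x) - h\<^sup>2 / 2)) * f (x + h)"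
      by (simp add: ennreal_mult' ac_simps)
    then show "ennreal (std_normal_density (h + x)) * (f (h + x) * ennreal (exp (h * (h + x) - h\<^sup>2 / 2))) =
        ennreal (std_normal_density x) * f (x + h)"
      by (simp only: e)
  qed
  also have "\<dots> = (\<integral>\<^sup>+z. f (z + h) \<partial>std_normal)"
    by (simp add: nn_integral_density)
  finally show ?thesis by simp
qed

lemma nn_integral_std_gaussian_Suc:
  assumes "f \<in> borel_measurable (vec_measurable (Suc p))"
  shows "(\<integral>\<^sup>+z. f z \<partial>std_gaussian (Suc p)) =
    (\<integral>\<^sup>+x. \<integral>\<^sup>+y. f (x(p := y)) \<partial>std_normal \<partial>std_gaussian p)"
proof -
  interpret product_sigma_finite "\<lambda>_::nat. std_normal" by (rule product_sigma_finite_std_normal)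
  have "f \<in> borel_measurable (Pi\<^sub>M (insert p {..<p}) (\<lambda>_. std_normal))"
    using assms
    by (simp add: measurable_cong_sets[OF sets_std_gaussian[symmetric] refl] std_gaussian_def lessThan_Suc)
  from product_nn_integral_insert[OF _ _ this] show ?thesis
    by (simp add: std_gaussian_def lessThan_Suc)
qed

lemma measurable_fun_upd_std_gaussian:
  "(\<lambda>(x, y). x(p := y)) \<in> std_gaussian p \<Otimes>\<^sub>M std_normal \<rightarrow>\<^sub>M vec_measurable (Suc p)"
proof -
  have "(\<lambda>(x, y). x(p := y)) \<in> (Pi\<^sub>M {..<p} (\<lambda>_. std_normal)) \<Otimes>\<^sub>M std_normal
      \<rightarrow>\<^sub>M (Pi\<^sub>M (insert p {..<p}) (\<lambda>_. std_normal))"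
    by (rule measurable_add_dim)
  then show ?thesis
    unfolding measurable_cong_sets[OF refl sets_std_gaussian[symmetric]] std_gaussian_def
    by (simp add: lessThan_Suc)
qed

text \<open>Cameron-Martin in dimension \<open>p\<close>, one coordinate at a time: \<open>g\<close>
  integrates out the last coordinate together with its weight, and the induction hypothesis shifts
  the others. The restriction to \<open>{..<p}\<close> keeps the shifted point in the extensional
  product space.\<close>

lemma nn_integral_std_gaussian_shift:
  assumes "f \<in> borel_measurable (vec_measurable p)"
  shows "(\<integral>\<^sup>+z. f (\<lambda>i\<in>{..<p}. z i + h i) \<partial>std_gaussian p) =
    (\<integral>\<^sup>+z. f z * ennreal (exp (dotp p h z - dotp p h h / 2)) \<partial>std_gaussian p)"
  using assms
proof (induction p arbitrary: f)
  case 0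
  show ?case
    by (simp add: std_gaussian_def PiM_empty dotp_def nn_integral_count_space_finite restrict_def)
next
  case (Suc p)
  note Suc.prems[measurable] measurable_fun_upd_std_gaussian[measurable]
  interpret sigma_finite_measure std_normal
    using prob_space_std_normal by (rule prob_space_imp_sigma_finite)
  define g where "g x = (\<integral>\<^sup>+y. f (x(p := y)) * ennreal (exp (h p * y - (h p)\<^sup>2 / 2)) \<partial>std_normal)" for x
  have f2 [measurable]: "(\<lambda>w. f ((fst w)(p := snd w))) \<in> borel_measurable (std_gaussian p \<Otimes>\<^sub>M std_normal)"
    using measurable_compose[OF measurable_fun_upd_std_gaussian Suc.prems]
    by (simp add: case_prod_unfold)
  have g [measurable]: "g \<in> borel_measurable (vec_measurable p)"
    unfolding g_def measurable_cong_sets[OF sets_std_gaussian[symmetric] refl]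
    by (rule borel_measurable_nn_integral) (use f2 in \<open>simp add: case_prod_unfold\<close>)
  have fy: "(\<lambda>y. f (x(p := y))) \<in> borel_measurable borel" if "x \<in> space (vec_measurable p)" for x
  proof -
    have "(\<lambda>y. (x, y)) \<in> borel \<rightarrow>\<^sub>M std_gaussian p \<Otimes>\<^sub>M std_normal"
      using that measurable_Pair1'[of x "std_gaussian p" std_normal]
      by (simp add: sets_eq_imp_space_eq[OF sets_std_gaussian] cong: measurable_cong_sets)
    from measurable_compose[OF this f2] show ?thesis by simp
  qed
  have restr: "(\<lambda>i\<in>{..<Suc p}. (x(p := y)) i + h i) = (\<lambda>i\<in>{..<p}. x i + h i)(p := y + h p)" for x y
    by (auto simp: fun_eq_iff restrict_def)
  have sh: "(\<lambda>z. \<lambda>i\<in>{..<Suc p}. z i + h i) \<in> vec_measurable (Suc p) \<rightarrow>\<^sub>M vec_measurable (Suc p)"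
    unfolding vec_measurable_def
    by (intro measurable_restrict borel_measurable_add measurable_component_singleton) auto
  have "(\<integral>\<^sup>+z. f (\<lambda>i\<in>{..<Suc p}. z i + h i) \<partial>std_gaussian (Suc p)) =
      (\<integral>\<^sup>+x. \<integral>\<^sup>+y. f ((\<lambda>i\<in>{..<p}. x i + h i)(p := y + h p)) \<partial>std_normal \<partial>std_gaussian p)"
    by (subst nn_integral_std_gaussian_Suc)
      (use measurable_compose[OF sh Suc.prems] in \<open>simp_all only: restr\<close>)
  also have "\<dots> = (\<integral>\<^sup>+x. g (\<lambda>i\<in>{..<p}. x i + h i) \<partial>std_gaussian p)"
    unfolding g_def
    by (intro nn_integral_cong nn_integral_std_normal_shift fy)
      (simp add: vec_measurable_def space_PiM)
  also have "\<dots> = (\<integral>\<^sup>+x. g x * ennreal (exp (dotp p h x - dotp p h h / 2)) \<partial>std_gaussian p)"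
    by (rule Suc.IH) (rule g)
  also have "\<dots> = (\<integral>\<^sup>+x. \<integral>\<^sup>+y. f (x(p := y)) *
      ennreal (exp (dotp (Suc p) h (x(p := y)) - dotp (Suc p) h h / 2)) \<partial>std_normal \<partial>std_gaussian p)"
  proof (intro nn_integral_cong)
    fix x assume "x \<in> space (std_gaussian p)"
    then have x: "x \<in> space (vec_measurable p)"
      by (simp add: sets_eq_imp_space_eq[OF sets_std_gaussian])
    have e: "exp (dotp (Suc p) h (x(p := y)) - dotp (Suc p) h h / 2) =
        exp (h p * y - (h p)\<^sup>2 / 2) * exp (dotp p h x - dotp p h h / 2)" for y
      by (simp add: dotp_def mult_exp_exp power2_eq_square add_divide_distrib)
    show "g x * ennreal (exp (dotp p h x - dotp p h h / 2)) =
        (\<integral>\<^sup>+y. f (x(p := y)) * ennreal (exp (dotp (Suc p) h (x(p := y)) - dotp (Suc p) h h / 2)) \<partial>std_normal)"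
      unfolding e g_def
      by (subst nn_integral_multc[symmetric]) (use fy[OF x] in \<open>auto simp: ennreal_mult' mult.assoc\<close>)
  qed
  also have "\<dots> = (\<integral>\<^sup>+z. f z * ennreal (exp (dotp (Suc p) h z - dotp (Suc p) h h / 2)) \<partial>std_gaussian (Suc p))"
    by (subst nn_integral_std_gaussian_Suc) auto
  finally show ?case .
qed

text \<open>The shift formula for the constant 1 says that the Cameron-Martin weight has integral 1;
  the constant part of its exponent is then moved to the other side.\<close>

lemma nn_integral_std_gaussian_exp:
  "(\<integral>\<^sup>+z. ennreal (exp (dotp p h z)) \<partial>std_gaussian p) = ennreal (exp (dotp p h h / 2))"
proof -
  interpret prob_space "std_gaussian p" by (rule prob_space_std_gaussian)
  have "1 = (\<integral>\<^sup>+z. ennreal (exp (dotp p h z - dotp p h h / 2)) \<partial>std_gaussian p)"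
    using nn_integral_std_gaussian_shift[of "\<lambda>_. 1" p h] by (simp add: emeasure_space_1)
  then have "ennreal (exp (dotp p h h / 2)) =
      ennreal (exp (dotp p h h / 2)) * (\<integral>\<^sup>+z. ennreal (exp (dotp p h z - dotp p h h / 2)) \<partial>std_gaussian p)"
    by simp
  also have "\<dots> = (\<integral>\<^sup>+z. ennreal (exp (dotp p h z)) \<partial>std_gaussian p)"
    by (subst nn_integral_cmult[symmetric])
      (auto simp: ennreal_mult'[symmetric] mult_exp_exp intro!: nn_integral_cong)
  finally show ?thesis by simp
qed

lemma nn_integral_std_normal_exp:
  "(\<integral>\<^sup>+z. ennreal (exp (h * z)) \<partial>std_normal) = ennreal (exp (h\<^sup>2 / 2))"
proof -
  interpret prob_space std_normal by (rule prob_space_std_normal)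
  have "1 = (\<integral>\<^sup>+z. ennreal (exp (h * z - h\<^sup>2 / 2)) \<partial>std_normal)"
    using nn_integral_std_normal_shift[of "\<lambda>_. 1" h] emeasure_space_1 by simp
  then have "ennreal (exp (h\<^sup>2 / 2)) =
      ennreal (exp (h\<^sup>2 / 2)) * (\<integral>\<^sup>+z. ennreal (exp (h * z - h\<^sup>2 / 2)) \<partial>std_normal)"
    by simp
  also have "\<dots> = (\<integral>\<^sup>+z. ennreal (exp (h * z)) \<partial>std_normal)"
    by (subst nn_integral_cmult[symmetric])
      (auto simp: ennreal_mult'[symmetric] mult_exp_exp intro!: nn_integral_cong)
  finally show ?thesis by simp
qed

text \<open>Up to the factor \<open>s\<close>, the integrand times the normal density is the centred
  normal density with variance 1 / (1 - 2 c).\<close>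

lemma nn_integral_std_normal_exp_square:
  assumes "c < 1 / 2"
  shows "(\<integral>\<^sup>+x. ennreal (exp (c * x\<^sup>2)) \<partial>std_normal) = ennreal (1 / sqrt (1 - 2 * c))"
proof -
  define s where "s = 1 / sqrt (1 - 2 * c)"
  have s: "s > 0" "s\<^sup>2 = 1 / (1 - 2 * c)" using assms by (auto simp: s_def power_divide)
  interpret N: prob_space "density lborel (normal_density 0 s)"
    by (rule prob_space_normal_density) (rule s)
  have 1: "(\<integral>\<^sup>+x. ennreal (normal_density 0 s x) \<partial>lborel) = 1"
    using N.emeasure_space_1 by (simp add: emeasure_density)
  have eq: "std_normal_density x * exp (c * x\<^sup>2) = s * normal_density 0 s x" for x
  proof -
    have "sqrt (2 * pi * s\<^sup>2) = sqrt (2 * pi) * s"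
      using s(1) by (simp add: real_sqrt_mult)
    moreover have "- (x - 0)\<^sup>2 / (2 * s\<^sup>2) = - x\<^sup>2 / 2 + c * x\<^sup>2"
    proof -
      have "1 / s\<^sup>2 = 1 - 2 * c" using s(2) by simp
      then have "- (x - 0)\<^sup>2 / (2 * s\<^sup>2) = - x\<^sup>2 * (1 - 2 * c) / 2"
        by (metis (no_types, lifting) diff_zero divide_divide_eq_left divide_inverse
            mult.commute mult.left_commute mult_1 minus_mult_left)
      then show ?thesis by (simp add: algebra_simps diff_divide_distrib add_divide_distrib)
    qed
    ultimately show ?thesis
      using s(1) by (simp add: normal_density_def mult_exp_exp)
  qed
  have "(\<integral>\<^sup>+x. ennreal (exp (c * x\<^sup>2)) \<partial>std_normal) =
      (\<integral>\<^sup>+x. ennreal (std_normal_density x) * ennreal (exp (c * x\<^sup>2)) \<partial>lborel)"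
    by (simp add: nn_integral_density)
  also have "\<dots> = (\<integral>\<^sup>+x. ennreal s * ennreal (normal_density 0 s x) \<partial>lborel)"
    by (intro nn_integral_cong)
      (use s(1) in \<open>simp add: ennreal_mult'[symmetric] eq\<close>)
  also have "\<dots> = ennreal s"
    by (subst nn_integral_cmult) (auto simp: 1)
  finally show ?thesis by (simp add: s_def)
qed

text \<open>Hubbard--Stratonovich: the square in the exponent is linearised by averaging over an
  independent standard normal variable.\<close>

lemma nn_integral_std_gaussian_exp_square:
  assumes c: "0 \<le> c" and cb: "2 * c * dotp p b b < 1"
  shows "(\<integral>\<^sup>+z. ennreal (exp (c * (dotp p b z)\<^sup>2)) \<partial>std_gaussian p) =
    ennreal (1 / sqrt (1 - 2 * c * dotp p b b))"
proof -
  interpret pair_sigma_finite std_normal "std_gaussian p"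
    using prob_space_std_normal prob_space_std_gaussian
    by (simp add: pair_sigma_finite_def prob_space_imp_sigma_finite)
  \<comment> \<open>With r^2 = 2 c, the average of exp (r u y) over a standard normal y is exp (c
    u^2). After Fubini the inner integral is a moment generating function in z, which leaves a
    one-dimensional square exponential in y.\<close>
  define r where "r = sqrt (2 * c)"
  have r: "r\<^sup>2 = 2 * c" using c by (simp add: r_def)
  have sc: "dotp p (\<lambda>i. r * y * b i) z = r * dotp p b z * y" for y z
    by (simp add: dotp_def sum_distrib_left sum_distrib_right ac_simps)
  have sc2: "dotp p (\<lambda>i. r * y * b i) (\<lambda>i. r * y * b i) / 2 = c * dotp p b b * y\<^sup>2" for y
  proof -
    have "dotp p (\<lambda>i. r * y * b i) (\<lambda>i. r * y * b i) = r\<^sup>2 * y\<^sup>2 * dotp p b b"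
      by (simp add: dotp_def sum_distrib_left power2_eq_square ac_simps)
    then show ?thesis by (simp add: r)
  qed
  have "(\<integral>\<^sup>+z. ennreal (exp (c * (dotp p b z)\<^sup>2)) \<partial>std_gaussian p) =
      (\<integral>\<^sup>+z. \<integral>\<^sup>+y. ennreal (exp (r * dotp p b z * y)) \<partial>std_normal \<partial>std_gaussian p)"
    by (simp add: nn_integral_std_normal_exp power_mult_distrib r)
  also have "\<dots> = (\<integral>\<^sup>+y. \<integral>\<^sup>+z. ennreal (exp (r * dotp p b z * y)) \<partial>std_gaussian p \<partial>std_normal)"
    by (subst Fubini') auto
  also have "\<dots> = (\<integral>\<^sup>+y. ennreal (exp ((c * dotp p b b) * y\<^sup>2)) \<partial>std_normal)"
    unfolding sc[symmetric] by (simp add: nn_integral_std_gaussian_exp sc2)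
  also have "\<dots> = ennreal (1 / sqrt (1 - 2 * c * dotp p b b))"
    by (subst nn_integral_std_normal_exp_square) (use cb in \<open>auto simp: mult.assoc\<close>)
  finally show ?thesis .
qed

lemma (in prob_space) has_bochner_integral_one: "has_bochner_integral M (\<lambda>_. 1 :: real) 1"
  by (simp add: has_bochner_integral_iff prob_space)

lemma std_normal_moments:
  "has_bochner_integral std_normal (\<lambda>x. x) 0"
  "has_bochner_integral std_normal (\<lambda>x. x\<^sup>2) 1"
  using std_normal_moment_odd[of 0] std_normal_moment_even[of 1]
  by (auto simp: has_bochner_integral_iff integrable_density integral_density)

text \<open>The product of the two coordinates is written as a product over all coordinates with
  factors x^2, x or 1, so that the product formula treats the diagonal and the off-diagonal case at
  once.\<close>

lemma std_gaussian_second_moment: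
  assumes "i < p" "j < p"
  shows "has_bochner_integral (std_gaussian p) (\<lambda>z. z i * z j) (if i = j then 1 else 0)"
proof -
  interpret product_sigma_finite "\<lambda>_::nat. std_normal" by (rule product_sigma_finite_std_normal)
  interpret N: prob_space std_normal by (rule prob_space_std_normal)
  define f :: "nat \<Rightarrow> real \<Rightarrow> real" where
    "f k x = (if k = i then x else 1) * (if k = j then x else 1)" for k x
  have int: "has_bochner_integral std_normal (f k) 
      (if k = i \<and> k = j then 1 else if k = i \<or> k = j then 0 else 1)" for k
  proof -
    have "has_bochner_integral std_normal (\<lambda>_. 1 :: real) 1"
      by (rule N.has_bochner_integral_one)
    moreover have "f k = (if k = i \<and> k = j then (\<lambda>x. x\<^sup>2) else if k = i \<or> k = j then (\<lambda>x. x) else (\<lambda>_. 1))"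
      by (auto simp: f_def fun_eq_iff power2_eq_square)
    ultimately show ?thesis using std_normal_moments by (auto simp only: if_True if_False split: if_split)
  qed
  have eq: "(\<Prod>k<p. f k (z k)) = z i * z j" for z
    unfolding f_def prod.distrib using assms by simp
  have "(\<Prod>k<p. (if k = i \<and> k = j then 1 else if k = i \<or> k = j then 0 else 1)) = (if i = j then 1 else 0 :: real)"
    using assms by (auto intro!: prod.neutral)
  moreover have "(\<integral>z. (\<Prod>k<p. f k (z k)) \<partial>std_gaussian p) =
      (\<Prod>k<p. (if k = i \<and> k = j then 1 else if k = i \<or> k = j then 0 else 1))"
    unfolding std_gaussian_def
    by (subst product_integral_prod)
      (use int in \<open>auto simp: has_bochner_integral_iff intro!: prod.cong\<close>)
  moreover have "integrable (std_gaussian p) (\<lambda>z. \<Prod>k<p. f k (z k))"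
    unfolding std_gaussian_def
    by (rule product_integrable_prod) (use int in \<open>auto simp: has_bochner_integral_iff\<close>)
  ultimately show ?thesis by (simp add: has_bochner_integral_iff eq)
qed

lemma std_gaussian_covariance:
  "has_bochner_integral (std_gaussian p) (\<lambda>z. dotp p b z * dotp p b' z) (dotp p b b')"
proof -
  have "has_bochner_integral (std_gaussian p)
      (\<lambda>z. \<Sum>i<p. \<Sum>j<p. (b i * b' j) * (z i * z j)) (\<Sum>i<p. \<Sum>j<p. (b i * b' j) * (if i = j then 1 else 0))"
    by (intro has_bochner_integral_sum has_bochner_integral_mult_right std_gaussian_second_moment) auto
  moreover have "dotp p b z * dotp p b' z = (\<Sum>i<p. \<Sum>j<p. (b i * b' j) * (z i * z j))" for z
    unfolding dotp_def sum_product by (simp add: ac_simps)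
  moreover have "(\<Sum>i<p. \<Sum>j<p. (b i * b' j) * (if i = j then 1 else 0)) = dotp p b b'"
    by (simp add: dotp_def if_distrib sum.delta' cong: if_cong)
  ultimately show ?thesis by simp
qed

text \<open>Taylor with Lagrange remainder. The linear term is kept exactly because its mean carries
  the overlap that the signs will average out.\<close>

lemma exp_le_quadratic: "exp x \<le> 1 + x + x\<^sup>2 * exp \<bar>x\<bar> / (2::real)"
proof -
  obtain t where t: "\<bar>t\<bar> \<le> \<bar>x\<bar>" "exp x = (\<Sum>m<2. (x ^ m) / fact m) + (exp t / fact 2) * x ^ 2"
    using Maclaurin_exp_le[of x 2] by blast
  have "exp t * x\<^sup>2 \<le> exp \<bar>x\<bar> * x\<^sup>2" using t(1) by (intro mult_right_mono) auto
  then show ?thesis using t(2) by (simp add: numeral_2_eq_2 lessThan_Suc ac_simps)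
qed

text \<open>This is exp t \<ge> t^2 / 2 at t = y / 8, which is where 128 = 2 * 8^2 comes
  from.\<close>

lemma square_le_exp: "0 \<le> (y::real) \<Longrightarrow> y\<^sup>2 \<le> 128 * exp (y / 8)"
  using exp_lower_Taylor_quadratic[of "y / 8"] by (simp add: power_divide)

text \<open>The first-order term is the exact mean, and only an error of order (\<theta> \<mu>)^2 is
  estimated; over N steps it becomes the term N \<epsilon>^4. The constant is the 128 of
  \<open>square_le_exp\<close>, halved by the Taylor remainder and doubled by the mean of the
  majorant.\<close>

lemma nn_integral_std_gaussian_exp_bilinear:
  assumes mu: "0 < \<mu>" and b: "dotp p b b \<le> \<mu>" "dotp p b' b' \<le> \<mu>" and th: "\<bar>\<theta>\<bar> * \<mu> \<le> 1 / 8"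
  shows "(\<integral>\<^sup>+z. ennreal (exp (\<theta> * (dotp p b z * dotp p b' z))) \<partial>std_gaussian p)
    \<le> ennreal (exp (\<theta> * dotp p b b' + 128 * (\<theta> * \<mu>)\<^sup>2))"
proof -
  let ?\<gamma> = "std_gaussian p"
  interpret prob_space ?\<gamma> by (rule prob_space_std_gaussian)
  let ?x = "\<lambda>z. dotp p b z * dotp p b' z"
  \<comment> \<open>A square-exponential majorant for each factor X = \<open>dotp p b z\<close>,
    namely exp (X^2 / (4 \<mu>)). The factor 2 is the square that the arithmetic-geometric mean
    inequality produces from exp (X^2 / (8 \<mu>)). As X has variance at most \<mu>, the exponent is
    at most half the critical one, and the mean is at most 2.\<close>
  let ?e = "\<lambda>b z. exp (1 / (8 * \<mu>) * 2 * (dotp p b z)\<^sup>2)"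
  have e2: "has_bochner_integral ?\<gamma> (?e b) (integral\<^sup>L ?\<gamma> (?e b)) \<and> integral\<^sup>L ?\<gamma> (?e b) \<le> 2"
    if b: "dotp p b b \<le> \<mu>" for b
  proof -
    have c: "2 * (1 / (8 * \<mu>) * 2) * dotp p b b \<le> 1 / 2" using b mu by (simp add: field_simps)
    have "1 / sqrt (1 - 2 * (1 / (8 * \<mu>) * 2) * dotp p b b) \<le> 1 / sqrt (1 / 4)"
      using c by (intro divide_left_mono real_sqrt_le_mono mult_pos_pos real_sqrt_gt_zero) linarith+
    then have le: "1 / sqrt (1 - 2 * (1 / (8 * \<mu>) * 2) * dotp p b b) \<le> 2"
      by (simp add: real_sqrt_divide)
    have i: "(\<integral>\<^sup>+z. ennreal (?e b z) \<partial>?\<gamma>) = ennreal (1 / sqrt (1 - 2 * (1 / (8 * \<mu>) * 2) * dotp p b b))"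
      by (rule nn_integral_std_gaussian_exp_square) (use c mu in auto)
    have "has_bochner_integral ?\<gamma> (?e b) (1 / sqrt (1 - 2 * (1 / (8 * \<mu>) * 2) * dotp p b b))"
      by (rule has_bochner_integral_nn_integral) (use i c in auto)
    with le show ?thesis by (simp add: has_bochner_integral_iff)
  qed
  let ?g = "\<lambda>z. 1 + \<theta> * ?x z + 64 * (\<theta> * \<mu>)\<^sup>2 * ((?e b z + ?e b' z) / 2)"
  have pt: "exp (\<theta> * ?x z) \<le> ?g z" for z
  proof -
    \<comment> \<open>In these units the exponent is at most y / 8 in absolute value. The remainder
      and the quadratic factor thus cost exp (y / 8) each, and exp (y / 4) is split between the two
      Gaussian factors.\<close>
    define y where "y = \<bar>?x z\<bar> / \<mu>"
    have y: "0 \<le> y" using mu by (simp add: y_def)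
    have ax: "\<bar>\<theta> * ?x z\<bar> = \<bar>\<theta>\<bar> * \<mu> * y" using mu by (simp add: y_def abs_mult)
    have x2: "(\<theta> * ?x z)\<^sup>2 = (\<theta> * \<mu>)\<^sup>2 * y\<^sup>2"
      using mu by (simp add: y_def power_mult_distrib power_divide)
    have "\<bar>\<theta> * ?x z\<bar> \<le> y / 8" unfolding ax using th y mult_right_mono by fastforce
    then have "y\<^sup>2 * exp \<bar>\<theta> * ?x z\<bar> \<le> (128 * exp (y / 8)) * exp (y / 8)"
      by (intro mult_mono square_le_exp y) auto
    also have "\<dots> = 128 * exp (y / 4)" by (simp add: mult_exp_exp)
    also have "y / 4 \<le> 1 / (8 * \<mu>) * ((dotp p b z)\<^sup>2 + (dotp p b' z)\<^sup>2)"
    proof -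
      have "2 * \<bar>?x z\<bar> \<le> (dotp p b z)\<^sup>2 + (dotp p b' z)\<^sup>2"
        using sum_squares_bound[of "\<bar>dotp p b z\<bar>" "\<bar>dotp p b' z\<bar>"] by (simp add: abs_mult)
      then show ?thesis using mu by (simp add: y_def field_simps)
    qed
    then have "exp (y / 4) \<le> exp (1 / (8 * \<mu>) * (dotp p b z)\<^sup>2) * exp (1 / (8 * \<mu>) * (dotp p b' z)\<^sup>2)"
      by (simp add: mult_exp_exp distrib_left)
    also have "\<dots> \<le> (?e b z + ?e b' z) / 2"
    proof -
      have sq: "(exp a)\<^sup>2 = exp (a * 2)" for a :: real by (simp add: power2_eq_square mult_exp_exp)
      show ?thesis
        using sum_squares_bound[of "exp (1 / (8 * \<mu>) * (dotp p b z)\<^sup>2)" "exp (1 / (8 * \<mu>) * (dotp p b' z)\<^sup>2)"]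
        by (simp add: sq ac_simps)
    qed
    finally have "y\<^sup>2 * exp \<bar>\<theta> * ?x z\<bar> \<le> 128 * ((?e b z + ?e b' z) / 2)" by simp
    then have "(\<theta> * \<mu>)\<^sup>2 * (y\<^sup>2 * exp \<bar>\<theta> * ?x z\<bar>) \<le> (\<theta> * \<mu>)\<^sup>2 * (128 * ((?e b z + ?e b' z) / 2))"
      by (rule mult_left_mono) simp
    then show ?thesis
      using exp_le_quadratic[of "\<theta> * ?x z"] unfolding x2 mult.assoc by linarith
  qed
  have g: "has_bochner_integral ?\<gamma> ?g (1 + \<theta> * dotp p b b' +
      64 * (\<theta> * \<mu>)\<^sup>2 * ((integral\<^sup>L ?\<gamma> (?e b) + integral\<^sup>L ?\<gamma> (?e b')) / 2))"
  proof -
    have "has_bochner_integral ?\<gamma> (\<lambda>_. 1 :: real) 1"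
      by (rule has_bochner_integral_one)
    moreover have "has_bochner_integral ?\<gamma> (\<lambda>z. \<theta> * ?x z) (\<theta> * dotp p b b')"
      by (intro has_bochner_integral_mult_right std_gaussian_covariance)
    moreover have "has_bochner_integral ?\<gamma> (\<lambda>z. 64 * (\<theta> * \<mu>)\<^sup>2 * ((?e b z + ?e b' z) / 2))
        (64 * (\<theta> * \<mu>)\<^sup>2 * ((integral\<^sup>L ?\<gamma> (?e b) + integral\<^sup>L ?\<gamma> (?e b')) / 2))"
      using e2[OF b(1)] e2[OF b(2)] by (simp add: has_bochner_integral_iff)
    ultimately show ?thesis by (intro has_bochner_integral_add)
  qed
  have "(\<integral>\<^sup>+z. ennreal (exp (\<theta> * ?x z)) \<partial>?\<gamma>) \<le> (\<integral>\<^sup>+z. ennreal (?g z) \<partial>?\<gamma>)"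
    by (intro nn_integral_mono ennreal_leI pt)
  also have "\<dots> = ennreal (integral\<^sup>L ?\<gamma> ?g)"
  proof (rule nn_integral_eq_integral)
    show "integrable ?\<gamma> ?g" using g[unfolded has_bochner_integral_iff] by (rule conjunct1)
    show "AE z in ?\<gamma>. 0 \<le> ?g z" by (rule AE_I2) (rule order_trans[OF exp_ge_zero pt])
  qed
  also have "integral\<^sup>L ?\<gamma> ?g \<le> 1 + (\<theta> * dotp p b b' + 128 * (\<theta> * \<mu>)\<^sup>2)"
  proof -
    have "(\<theta> * \<mu>)\<^sup>2 * ((integral\<^sup>L ?\<gamma> (?e b) + integral\<^sup>L ?\<gamma> (?e b')) / 2) \<le> (\<theta> * \<mu>)\<^sup>2 * 2"
      using e2[OF b(1)] e2[OF b(2)] by (intro mult_left_mono) auto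
    then show ?thesis using g[unfolded has_bochner_integral_iff, THEN conjunct2] unfolding mult.assoc by linarith
  qed
  also have "\<dots> \<le> exp (\<theta> * dotp p b b' + 128 * (\<theta> * \<mu>)\<^sup>2)" by (rule exp_ge_add_one_self)
  finally show ?thesis by (simp add: ennreal_leI)
qed

section \<open>The Girsanov formula\<close>

text \<open>Index 0 holds the whitened initial state, the indices from 1 on hold the whitened
  innovations. All of them can share one law because the drift before the change is 0.\<close>

definition noise :: "nat \<Rightarrow> nat \<Rightarrow> (nat \<Rightarrow> nat \<Rightarrow> real) measure" where
  "noise p T = (\<Pi>\<^sub>M t\<in>{..T}. std_gaussian p)"

lemma sets_noise: "sets (noise p T) = sets (path_space p T)"
  unfolding noise_def path_space_def by (intro sets_PiM_cong sets_std_gaussian refl)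

lemma space_noise: "space (noise p T) = space (path_space p T)"
  by (rule sets_eq_imp_space_eq[OF sets_noise])

lemma prob_space_noise: "prob_space (noise p T)"
  unfolding noise_def by (intro prob_space_PiM prob_space_std_gaussian)

lemma product_sigma_finite_std_gaussian: "product_sigma_finite (\<lambda>_. std_gaussian p)"
  by (simp add: product_sigma_finite_def prob_space_imp_sigma_finite prob_space_std_gaussian)

lemma measurable_path_component:
  "t \<le> T \<Longrightarrow> (\<lambda>w. w t) \<in> path_space p T \<rightarrow>\<^sub>M vec_measurable p"
  unfolding path_space_def by (rule measurable_component_singleton) simp

lemma nn_integral_noise_Suc:
  assumes "f \<in> borel_measurable (path_space p (Suc T))"
  shows "(\<integral>\<^sup>+w. f w \<partial>noise p (Suc T)) =
    (\<integral>\<^sup>+x. \<integral>\<^sup>+y. f (x(Suc T := y)) \<partial>std_gaussian p \<partial>noise p T)"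
proof -
  interpret product_sigma_finite "\<lambda>_::nat. std_gaussian p" by (rule product_sigma_finite_std_gaussian)
  have "f \<in> borel_measurable (Pi\<^sub>M (insert (Suc T) {..T}) (\<lambda>_. std_gaussian p))"
    using assms
    by (simp add: measurable_cong_sets[OF sets_noise[symmetric] refl] noise_def atMost_Suc)
  from product_nn_integral_insert[OF _ _ this] show ?thesis
    by (simp add: noise_def atMost_Suc)
qed

lemma measurable_fun_upd_noise:
  "(\<lambda>(x, y). x(Suc T := y)) \<in> path_space p T \<Otimes>\<^sub>M vec_measurable p \<rightarrow>\<^sub>M path_space p (Suc T)"
proof -
  have "(\<lambda>(x, y). x(Suc T := y)) \<in> (Pi\<^sub>M {..T} (\<lambda>_. vec_measurable p)) \<Otimes>\<^sub>M vec_measurable p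
      \<rightarrow>\<^sub>M (Pi\<^sub>M (insert (Suc T) {..T}) (\<lambda>_. vec_measurable p))"
    by (rule measurable_add_dim)
  then show ?thesis by (simp add: path_space_def atMost_Suc)
qed

lemma trajectory_cong:
  "(\<And>s. 0 < s \<Longrightarrow> s \<le> t \<Longrightarrow> z s = z' s) \<Longrightarrow> trajectory p H x z t = trajectory p H x z' t"
  by (induction t) auto

text \<open>The path of the autoregression as a function of one noise path, whose component 0 serves
  as initial state.\<close>

definition shifted :: "nat \<Rightarrow> nat \<Rightarrow> (nat \<Rightarrow> real mat) \<Rightarrow> (nat \<Rightarrow> nat \<Rightarrow> real) \<Rightarrow> nat \<Rightarrow> nat \<Rightarrow> real" where
  "shifted p T H w = (\<lambda>t\<in>{..T}. trajectory p H (w 0) w t)"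

text \<open>The discrete Girsanov exponent: the Cameron-Martin exponents of the successive steps,
  added up. It is the logarithm of the density of the law of \<open>shifted p T H\<close> with
  respect to \<open>noise p T\<close>.\<close>

definition log_lr :: "nat \<Rightarrow> nat \<Rightarrow> (nat \<Rightarrow> real mat) \<Rightarrow> (nat \<Rightarrow> nat \<Rightarrow> real) \<Rightarrow> real" where
  "log_lr p T H w = (\<Sum>t<T. dotp p (apply_mat p (H t) (w t)) (w (Suc t)) -
     dotp p (apply_mat p (H t) (w t)) (apply_mat p (H t) (w t)) / 2)"

lemma measurable_dotp_comp:
  assumes "f \<in> M \<rightarrow>\<^sub>M vec_measurable p" "g \<in> M \<rightarrow>\<^sub>M vec_measurable p"
  shows "(\<lambda>w. dotp p (f w) (g w)) \<in> borel_measurable M"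
  unfolding dotp_def
  by (intro borel_measurable_sum borel_measurable_times measurable_compose[OF assms(1)]
      measurable_compose[OF assms(2)] measurable_vec_component) auto

lemma measurable_apply_mat_comp:
  assumes "f \<in> M \<rightarrow>\<^sub>M vec_measurable p"
  shows "(\<lambda>w. apply_mat p A (f w)) \<in> M \<rightarrow>\<^sub>M vec_measurable p"
  by (intro measurable_apply_mat measurable_compose[OF assms] measurable_vec_component)

lemma measurable_shifted: "shifted p T H \<in> path_space p T \<rightarrow>\<^sub>M path_space p T"
proof -
  have "(\<lambda>w. trajectory p H (w 0) w t) \<in> path_space p T \<rightarrow>\<^sub>M vec_measurable p" if "t \<le> T" for t
    using that
  proof (induction t)
    case (Suc t)
    then have IH: "(\<lambda>w. trajectory p H (w 0) w t) \<in> path_space p T \<rightarrow>\<^sub>M vec_measurable p" by simp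
    have "(\<lambda>w. \<lambda>i\<in>{..<p}. apply_mat p (H t) (trajectory p H (w 0) w t) i + w (Suc t) i)
        \<in> path_space p T \<rightarrow>\<^sub>M (\<Pi>\<^sub>M i\<in>{..<p}. borel)"
      by (intro measurable_restrict borel_measurable_add
          measurable_compose[OF measurable_apply_mat_comp[OF IH] measurable_vec_component]
          measurable_compose[OF measurable_path_component[OF Suc.prems] measurable_vec_component]) auto
    then show ?case unfolding trajectory.simps vec_measurable_def[symmetric] .
  qed (simp add: measurable_path_component)
  then have "shifted p T H \<in> path_space p T \<rightarrow>\<^sub>M (\<Pi>\<^sub>M t\<in>{..T}. vec_measurable p)"
    unfolding shifted_def[abs_def] by (intro measurable_restrict) auto
  then show ?thesis unfolding path_space_def[symmetric] .
qed

lemma measurable_log_lr [measurable]: "log_lr p T H \<in> borel_measurable (path_space p T)"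
  unfolding log_lr_def[abs_def]
  by (intro borel_measurable_sum borel_measurable_diff borel_measurable_divide borel_measurable_const
      measurable_dotp_comp measurable_apply_mat_comp measurable_path_component) auto

text \<open>Conditionally on the past, the last step is a Gaussian shift by a fixed vector.\<close>

lemma nn_integral_shifted:
  assumes "f \<in> borel_measurable (path_space p T)"
  shows "(\<integral>\<^sup>+w. f (shifted p T H w) \<partial>noise p T) =
    (\<integral>\<^sup>+w. f w * ennreal (exp (log_lr p T H w)) \<partial>noise p T)"
  using assms
proof (induction T arbitrary: f)
  case 0
  have "shifted p 0 H w = w" if "w \<in> space (noise p 0)" for w
    using that by (auto simp: shifted_def noise_def space_PiM PiE_def extensional_def fun_eq_iff)
  then show ?case by (auto simp: log_lr_def intro!: nn_integral_cong)
next
  case (Suc T)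
  note Suc.prems[measurable] measurable_fun_upd_noise[measurable] measurable_dotp_comp[measurable (raw)]
    measurable_apply_mat_comp[measurable (raw)]
  let ?M = "path_space p T \<Otimes>\<^sub>M vec_measurable p"
  let ?h = "\<lambda>x. apply_mat p (H T) (x T)"
  interpret sigma_finite_measure "std_gaussian p"
    using prob_space_std_gaussian by (rule prob_space_imp_sigma_finite)
  define e where "e x y = exp (dotp p (?h x) y - dotp p (?h x) (?h x) / 2)" for x y
  \<comment> \<open>Integrating out the last innovation together with its weight leaves a functional
    of the path up to time T, to which the induction hypothesis applies.\<close>
  define g where "g x = (\<integral>\<^sup>+y. f (x(Suc T := y)) * ennreal (e x y) \<partial>std_gaussian p)" for x
  have hM: "(\<lambda>w. ?h (fst w)) \<in> ?M \<rightarrow>\<^sub>M vec_measurable p"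
    by (intro measurable_apply_mat_comp measurable_compose[OF measurable_fst measurable_path_component]) simp
  have f2: "(\<lambda>w. f ((fst w)(Suc T := snd w))) \<in> borel_measurable ?M"
    using measurable_compose[OF measurable_fun_upd_noise Suc.prems] by (simp add: case_prod_unfold)
  have e2: "(\<lambda>w. e (fst w) (snd w)) \<in> borel_measurable ?M"
    unfolding e_def
    by (intro borel_measurable_exp[THEN measurable_compose[rotated]] borel_measurable_diff
        borel_measurable_divide borel_measurable_const measurable_dotp_comp hM measurable_snd)
  have sM: "sets ?M = sets (path_space p T \<Otimes>\<^sub>M std_gaussian p)"
    by (intro sets_pair_measure_cong sets_std_gaussian[symmetric] refl)
  have g: "g \<in> borel_measurable (path_space p T)"
    unfolding g_def
  proof (rule borel_measurable_nn_integral)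
    have "(\<lambda>w. f ((fst w)(Suc T := snd w)) * ennreal (e (fst w) (snd w))) \<in> borel_measurable ?M"
      using f2 e2 by (intro borel_measurable_times_ennreal measurable_compose[OF e2 measurable_ennreal])
    then show "(\<lambda>(x, y). f (x(Suc T := y)) * ennreal (e x y)) \<in> borel_measurable (path_space p T \<Otimes>\<^sub>M std_gaussian p)"
      by (simp add: case_prod_unfold measurable_cong_sets[OF sM refl])
  qed
  have fy: "(\<lambda>y. f (x(Suc T := y))) \<in> borel_measurable (vec_measurable p)"
    and ey: "(\<lambda>y. e x y) \<in> borel_measurable (vec_measurable p)"
    if "x \<in> space (path_space p T)" for x
    using measurable_compose[OF measurable_Pair1'[OF that] f2] measurable_compose[OF measurable_Pair1'[OF that] e2]
    by simp_all
  \<comment> \<open>The recursion up to time T does not read the new innovation y, so the last state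
    is y shifted by a vector that depends on x alone.\<close>
  have sh: "shifted p (Suc T) H (x(Suc T := y)) =
      (shifted p T H x)(Suc T := \<lambda>i\<in>{..<p}. y i + ?h (shifted p T H x) i)" for x y
  proof
    fix t
    have "trajectory p H ((x(Suc T := y)) 0) (x(Suc T := y)) s = trajectory p H (x 0) x s" if "s \<le> T" for s
      using that by (simp, intro trajectory_cong) auto
    then show "shifted p (Suc T) H (x(Suc T := y)) t =
        ((shifted p T H x)(Suc T := \<lambda>i\<in>{..<p}. y i + ?h (shifted p T H x) i)) t"
      by (auto simp: shifted_def le_Suc_eq add.commute)
  qed
  have "(\<integral>\<^sup>+w. f (shifted p (Suc T) H w) \<partial>noise p (Suc T)) =
      (\<integral>\<^sup>+x. \<integral>\<^sup>+y. f ((shifted p T H x)(Suc T := \<lambda>i\<in>{..<p}. y i + ?h (shifted p T H x) i))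
        \<partial>std_gaussian p \<partial>noise p T)"
    using measurable_compose[OF measurable_shifted Suc.prems]
    by (subst nn_integral_noise_Suc) (simp_all only: sh)
  also have "\<dots> = (\<integral>\<^sup>+x. g (shifted p T H x) \<partial>noise p T)"
  proof (intro nn_integral_cong)
    fix x assume "x \<in> space (noise p T)"
    then have "shifted p T H x \<in> space (path_space p T)"
      using measurable_space[OF measurable_shifted] by (simp add: space_noise)
    from nn_integral_std_gaussian_shift[OF fy[OF this], of "?h (shifted p T H x)"]
    show "(\<integral>\<^sup>+y. f ((shifted p T H x)(Suc T := \<lambda>i\<in>{..<p}. y i + ?h (shifted p T H x) i)) \<partial>std_gaussian p)
        = g (shifted p T H x)"
      by (simp add: g_def e_def)
  qed
  also have "\<dots> = (\<integral>\<^sup>+x. g x * ennreal (exp (log_lr p T H x)) \<partial>noise p T)"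
    by (rule Suc.IH) (rule g)
  also have "\<dots> = (\<integral>\<^sup>+x. \<integral>\<^sup>+y. f (x(Suc T := y)) * ennreal (exp (log_lr p (Suc T) H (x(Suc T := y))))
      \<partial>std_gaussian p \<partial>noise p T)"
  proof (intro nn_integral_cong)
    fix x assume "x \<in> space (noise p T)"
    then have x: "x \<in> space (path_space p T)" by (simp add: space_noise)
    have l: "log_lr p (Suc T) H (x(Suc T := y)) =
        (dotp p (?h x) y - dotp p (?h x) (?h x) / 2) + log_lr p T H x" for y
      by (simp add: log_lr_def)
    have "g x * ennreal (exp (log_lr p T H x)) =
        (\<integral>\<^sup>+y. f (x(Suc T := y)) * ennreal (e x y) * ennreal (exp (log_lr p T H x)) \<partial>std_gaussian p)"
      unfolding g_def
      using fy[OF x] ey[OF x]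
      by (subst nn_integral_multc[symmetric]) (auto simp: measurable_cong_sets[OF sets_std_gaussian refl])
    then show "g x * ennreal (exp (log_lr p T H x)) =
        (\<integral>\<^sup>+y. f (x(Suc T := y)) * ennreal (exp (log_lr p (Suc T) H (x(Suc T := y)))) \<partial>std_gaussian p)"
      unfolding l e_def exp_add by (simp add: ennreal_mult' mult.assoc)
  qed
  also have "\<dots> = (\<integral>\<^sup>+w. f w * ennreal (exp (log_lr p (Suc T) H w)) \<partial>noise p (Suc T))"
    by (subst nn_integral_noise_Suc) auto
  finally show ?case .
qed

section \<open>Rank-one drifts after the change and products of their likelihood ratios\<close>

definition outer :: "nat \<Rightarrow> (nat \<Rightarrow> real) \<Rightarrow> (nat \<Rightarrow> real) \<Rightarrow> real mat" where
  "outer p a b = mat p p (\<lambda>(i, j). a i * b j)"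

lemma apply_mat_outer: "i < p \<Longrightarrow> apply_mat p (outer p a b) x i = a i * dotp p b x"
  by (simp add: apply_mat_def outer_def dotp_def sum_distrib_left mult.assoc)

lemma apply_mat_add:
  "A \<in> carrier_mat p p \<Longrightarrow> B \<in> carrier_mat p p \<Longrightarrow> i < p \<Longrightarrow>
    apply_mat p (A + B) x i = apply_mat p A x i + apply_mat p B x i"
  by (simp add: apply_mat_def distrib_right sum.distrib)

lemma dotp_apply_outer:
  "dotp p (apply_mat p (outer p a b) x) y = dotp p b x * dotp p a y"
  unfolding dotp_def[of p "apply_mat p (outer p a b) x"] dotp_def[of p a]
  by (simp add: apply_mat_outer sum_distrib_left ac_simps)

lemma outer_carrier: "outer p a b \<in> carrier_mat p p"
  by (simp add: outer_def)

lemma apply_mat_zero: "i < p \<Longrightarrow> apply_mat p (0\<^sub>m p p) x i = 0"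
  by (simp add: apply_mat_def)

text \<open>A step with zero drift contributes nothing. \<open>transition\<close> switches strictly
  above \<tau> and the last transition has index T - 1, which leaves the open interval as the set of
  informative steps.\<close>

lemma log_lr_transition:
  "log_lr p T (transition \<tau> (0\<^sub>m p p) K) w =
    (\<Sum>t\<in>{\<tau><..<T}. dotp p (apply_mat p K (w t)) (w (Suc t)) -
      dotp p (apply_mat p K (w t)) (apply_mat p K (w t)) / 2)"
proof -
  have z: "dotp p (apply_mat p (0\<^sub>m p p) x) y = 0" for x y
    by (simp add: dotp_def apply_mat_zero)
  show ?thesis
    unfolding log_lr_def
    by (rule sum.mono_neutral_cong_right) (auto simp: transition_def z)
qed

lemma nn_integral_noise_prod:
  assumes "g \<in> borel_measurable (vec_measurable p)" "J \<subseteq> {..T}"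
  shows "(\<integral>\<^sup>+w. (\<Prod>t\<in>J. g (w t)) \<partial>noise p T) = (\<integral>\<^sup>+z. g z \<partial>std_gaussian p) ^ card J"
proof -
  interpret product_sigma_finite "\<lambda>_::nat. std_gaussian p" by (rule product_sigma_finite_std_gaussian)
  interpret prob_space "std_gaussian p" by (rule prob_space_std_gaussian)
  let ?g = "\<lambda>t z. if t \<in> J then g z else 1"
  have J: "{..T} \<inter> J = J" "finite J" using assms(2) finite_subset by auto
  have "(\<Prod>t\<in>J. g (w t)) = (\<Prod>t\<in>{..T}. ?g t (w t))" for w
    by (simp add: prod.If_cases J)
  then have "(\<integral>\<^sup>+w. (\<Prod>t\<in>J. g (w t)) \<partial>noise p T) = (\<Prod>t\<in>{..T}. \<integral>\<^sup>+z. ?g t z \<partial>std_gaussian p)"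
    unfolding noise_def using assms(1)
    by (subst product_nn_integral_prod[symmetric]) (auto simp: measurable_cong_sets[OF sets_std_gaussian refl])
  also have "\<dots> = (\<Prod>t\<in>{..T}. if t \<in> J then \<integral>\<^sup>+z. g z \<partial>std_gaussian p else 1)"
    by (intro prod.cong) (auto simp: emeasure_space_1)
  also have "\<dots> = (\<integral>\<^sup>+z. g z \<partial>std_gaussian p) ^ card J"
    by (simp add: prod.If_cases J)
  finally show ?thesis .
qed

text \<open>The product of two likelihood ratios is the likelihood ratio of the sum of the drifts times
  the exponential of an interaction term, which does not see the drift because \<open>b\<close> and \<open>b'\<close> are
  orthogonal to \<open>a\<close> and \<open>a'\<close>.\<close>

lemma nn_integral_lr_product:
  fixes p T \<tau> :: nat and a a' b b' :: "nat \<Rightarrow> real"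
  assumes orth: "dotp p b a = 0" "dotp p b a' = 0" "dotp p b' a = 0" "dotp p b' a' = 0"
  defines "L \<equiv> \<lambda>a b w. exp (log_lr p T (transition \<tau> (0\<^sub>m p p) (outer p a b)) w)"
  shows "(\<integral>\<^sup>+w. ennreal (L a b w * L a' b' w) \<partial>noise p T) =
    (\<integral>\<^sup>+z. ennreal (exp (dotp p a a' * (dotp p b z * dotp p b' z))) \<partial>std_gaussian p) ^ card {\<tau><..<T}"
proof -
  define K where "K = outer p a b + outer p a' b'"
  let ?H = "transition \<tau> (0\<^sub>m p p) K"
  let ?g = "\<lambda>z. ennreal (exp (dotp p a a' * (dotp p b z * dotp p b' z)))"
  let ?f = "\<lambda>w. \<Prod>t\<in>{\<tau><..<T}. ?g (w t)"
  have Ki: "i < p \<Longrightarrow> apply_mat p K x i = a i * dotp p b x + a' i * dotp p b' x" for x i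
    by (simp add: K_def apply_mat_add[OF outer_carrier outer_carrier] apply_mat_outer)
  have dK: "dotp p (apply_mat p K x) y = dotp p b x * dotp p a y + dotp p b' x * dotp p a' y" for x y
  proof -
    have "dotp p (apply_mat p K x) y = (\<Sum>i<p. (a i * dotp p b x + a' i * dotp p b' x) * y i)"
      by (simp add: dotp_def[of p "apply_mat p K x"] Ki)
    also have "\<dots> = dotp p b x * dotp p a y + dotp p b' x * dotp p a' y"
      by (simp add: dotp_def[of p a] dotp_def[of p a'] sum_distrib_left sum.distrib algebra_simps)
    finally show ?thesis .
  qed
  have dO: "dotp p y (apply_mat p (outer p c d) x) = dotp p d x * dotp p c y" for x y c d
    by (subst dotp_commute) (rule dotp_apply_outer)
  have dK': "dotp p y (apply_mat p K x) = dotp p b x * dotp p a y + dotp p b' x * dotp p a' y" for x y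
    by (subst dotp_commute) (rule dK)
  \<comment> \<open>Polarisation: the squared length of the summed drift at x exceeds the sum of the
    two squared lengths by 2 (a . a') (b . x) (b' . x), and half of this is the interaction
    term.\<close>
  have LL: "L a b w * L a' b' w =
      (\<Prod>t\<in>{\<tau><..<T}. exp (dotp p a a' * (dotp p b (w t) * dotp p b' (w t)))) * exp (log_lr p T ?H w)" for w
    unfolding L_def exp_sum[symmetric, OF finite_greaterThanLessThan] log_lr_transition
      exp_add[symmetric] sum.distrib[symmetric] exp_inj_iff
    by (intro sum.cong refl)
      (simp add: dotp_apply_outer dO dK dK' dotp_commute[of p a' a] algebra_simps add_divide_distrib diff_divide_distrib)
  have g: "?g \<in> borel_measurable (vec_measurable p)" by measurable
  have f: "?f \<in> borel_measurable (path_space p T)"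
    by (intro borel_measurable_prod_ennreal measurable_compose[OF measurable_path_component g]) auto
  \<comment> \<open>Every drift lies in the span of \<open>a\<close> and \<open>a'\<close>. In a
    direction orthogonal to both, the state is therefore just the current innovation, or the initial
    state at time 0.\<close>
  have inv: "dotp p c (trajectory p ?H x z t) = dotp p c (if t = 0 then x else z t)"
    if "dotp p c a = 0" "dotp p c a' = 0" for c x z t
  proof (cases t)
    case (Suc s)
    have "dotp p c (trajectory p ?H x z t) = dotp p c (apply_mat p (?H s) (trajectory p ?H x z s)) + dotp p c (z t)"
      unfolding dotp_def Suc by (simp add: sum.distrib distrib_left)
    also have "dotp p c (apply_mat p (?H s) (trajectory p ?H x z s)) = 0"
    proof (cases "s \<le> \<tau>")
      case True
      then show ?thesis by (simp add: transition_def dotp_def apply_mat_zero)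
    next
      case False
      then show ?thesis using that by (simp add: transition_def dK' dotp_commute[of p _ c])
    qed
    finally show ?thesis using \<open>t = Suc s\<close>[THEN arg_cong, of "\<lambda>t. t \<noteq> 0"] by simp
  qed simp
  have "(\<integral>\<^sup>+w. ennreal (L a b w * L a' b' w) \<partial>noise p T) =
      (\<integral>\<^sup>+w. ?f w * ennreal (exp (log_lr p T ?H w)) \<partial>noise p T)"
    unfolding LL by (simp add: ennreal_mult prod_nonneg prod_ennreal)
  \<comment> \<open>Girsanov read backwards trades the remaining likelihood ratio for a shifted
    path. The interaction term takes the same value on the shifted and on the unshifted path, and on
    the latter the times are independent.\<close>
  also have "\<dots> = (\<integral>\<^sup>+w. ?f (shifted p T ?H w) \<partial>noise p T)"
    by (rule nn_integral_shifted[OF f, symmetric])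
  also have "\<dots> = (\<integral>\<^sup>+w. ?f w \<partial>noise p T)"
    using orth by (intro nn_integral_cong prod.cong refl) (auto simp: shifted_def inv)
  also have "\<dots> = (\<integral>\<^sup>+z. ?g z \<partial>std_gaussian p) ^ card {\<tau><..<T}"
    by (rule nn_integral_noise_prod[OF g]) auto
  finally show ?thesis .
qed

section \<open>Spectral theorem and whitening\<close>

text \<open>The counterpart of \<open>apply_mat\<close> without the restriction to
  \<open>{..<p}\<close>: linearity becomes an equality of functions and can be used for
  rewriting.\<close>

definition app :: "nat \<Rightarrow> (nat \<Rightarrow> nat \<Rightarrow> real) \<Rightarrow> (nat \<Rightarrow> real) \<Rightarrow> nat \<Rightarrow> real" where
  "app p S x i = (\<Sum>j<p. S i j * x j)"

lemma dotp_add: "dotp p x (\<lambda>i. y i + z i) = dotp p x y + dotp p x z"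
  and dotp_diff: "dotp p x (\<lambda>i. y i - z i) = dotp p x y - dotp p x z"
  and dotp_scale: "dotp p x (\<lambda>i. c * y i) = c * dotp p x y"
  and dotp_add_left: "dotp p (\<lambda>i. y i + z i) x = dotp p y x + dotp p z x"
  and dotp_scale_left: "dotp p (\<lambda>i. c * y i) x = c * dotp p y x"
  by (simp_all add: dotp_def sum.distrib sum_subtractf sum_distrib_left algebra_simps)

lemma app_add: "app p S (\<lambda>i. y i + z i) = (\<lambda>i. app p S y i + app p S z i)"
  and app_scale: "app p S (\<lambda>i. c * y i) = (\<lambda>i. c * app p S y i)"
  by (simp_all add: app_def fun_eq_iff sum.distrib sum_distrib_left algebra_simps)

lemma dotp_cong: "(\<And>i. i < p \<Longrightarrow> x i = x' i) \<Longrightarrow> (\<And>i. i < p \<Longrightarrow> y i = y' i) \<Longrightarrow> dotp p x y = dotp p x' y'"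
  by (simp add: dotp_def)

lemma app_cong: "(\<And>i. i < p \<Longrightarrow> x i = y i) \<Longrightarrow> app p S x = app p S y"
  by (simp add: app_def fun_eq_iff)

lemma dotp_app_symmetric:
  assumes "\<And>i j. i < p \<Longrightarrow> j < p \<Longrightarrow> S i j = S j i"
  shows "dotp p x (app p S y) = dotp p (app p S x) y"
  unfolding dotp_def app_def sum_distrib_left sum_distrib_right
  by (subst sum.swap) (use assms in \<open>auto intro!: sum.cong\<close>)

lemma dotp_self_eq_0: "dotp p x x = 0 \<Longrightarrow> i < p \<Longrightarrow> x i = 0"
  unfolding dotp_def by (subst (asm) sum_nonneg_eq_0_iff) auto

text \<open>The vectors are made the first \<open>k\<close> rows of a square matrix whose other rows
  are 0. Since k < p, the last row is 0, so the matrix is singular and has a kernel vector.\<close>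

lemma exists_orthogonal_vector:
  assumes "k < p"
  obtains x where "dotp p x x > 0" "\<And>i. i < k \<Longrightarrow> dotp p (q i) x = 0"
proof -
  define A where "A = mat p p (\<lambda>(i, j). if i < k then q i j else 0 :: real)"
  have A: "A \<in> carrier_mat p p" by (simp add: A_def)
  let ?v = "unit_vec p (p - 1) :: real Matrix.vec"
  have "transpose_mat A *\<^sub>v ?v = 0\<^sub>v p"
    using assms by (intro eq_vecI) (auto simp: A_def scalar_prod_def)
  moreover have "?v \<noteq> 0\<^sub>v p" using assms unit_vec_nonzero[of p "p - 1"] by simp
  ultimately have "\<exists>v. v \<in> carrier_vec p \<and> v \<noteq> 0\<^sub>v p \<and> transpose_mat A *\<^sub>v v = 0\<^sub>v p"
    using unit_vec_carrier by blast
  then have "Determinant.det A = 0"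
    using det_0_iff_vec_prod_zero_field[of "transpose_mat A" p] A det_transpose[OF A] by simp
  then obtain v where v: "v \<in> carrier_vec p" "v \<noteq> 0\<^sub>v p" "A *\<^sub>v v = 0\<^sub>v p"
    using det_0_iff_vec_prod_zero_field[OF A] by blast
  have "dotp p (q i) (vec_index v) = 0" if "i < k" for i
  proof -
    have "vec_index (A *\<^sub>v v) i = 0" using v(3) that assms by simp
    then show ?thesis
      using that assms v(1) by (simp add: A_def scalar_prod_def dotp_def atLeast0LessThan)
  qed
  moreover have "dotp p (vec_index v) (vec_index v) > 0"
  proof (rule ccontr)
    assume "\<not> ?thesis"
    then have "dotp p (vec_index v) (vec_index v) = 0" using dotp_self_nonneg[of p "vec_index v"] by simp
    then have "v = 0\<^sub>v p" using v(1) dotp_self_eq_0 by (intro eq_vecI) auto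
    with v(2) show False by simp
  qed
  ultimately show thesis using that by blast
qed

text \<open>The first-order condition at a maximum in algebraic form: for t = a / c with c > b the
  linear term would win unless a = 0.\<close>

lemma linear_dominated_by_quadratic:
  fixes a b :: real
  assumes "\<And>t. a * t \<le> b * t\<^sup>2"
  shows "a = 0"
proof (rule ccontr)
  assume a: "a \<noteq> 0"
  define c where "c = \<bar>b\<bar> + 1"
  have c: "c > 0" "b < c" by (auto simp: c_def)
  have "a * (a / c) \<le> b * (a / c)\<^sup>2" by (rule assms)
  then have "a\<^sup>2 * c \<le> b * a\<^sup>2" using c by (simp add: field_simps power2_eq_square)
  moreover have "b * a\<^sup>2 < c * a\<^sup>2" using a c by simp
  ultimately show False by (simp add: mult.commute)
qed

text \<open>Vectors are functions on all of \<open>nat\<close>, so compactness of the sphere is that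
  of a product of intervals. The coordinates from \<open>p\<close> on are pinned to 0 by
  \<open>I\<close>; accordingly \<open>u\<close> not only normalises a vector but also cuts it off
  at \<open>p\<close>.\<close>

lemma quadratic_form_attains_max:
  assumes "k < p"
  obtains x where "dotp p x x = 1" "\<And>i. i < k \<Longrightarrow> dotp p (q i) x = 0"
    "\<And>y. (\<And>i. i < k \<Longrightarrow> dotp p (q i) y = 0) \<Longrightarrow>
      dotp p y (app p S y) \<le> dotp p x (app p S x) * dotp p y y"
proof -
  define I where "I i = (if i < p then {-1..1} else {0::real})" for i
  define K where "K = PiE UNIV I \<inter> ({x. dotp p x x = 1} \<inter> (\<Inter>i\<in>{..<k}. {x. dotp p (q i) x = 0}))"
  have cont [continuous_intros]: "continuous_on A (\<lambda>x. x i)" for i and A :: "(nat \<Rightarrow> real) set"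
    by (rule continuous_on_product_then_coordinatewise) (rule continuous_on_id)
  have "compactin (product_topology (\<lambda>_. euclidean) UNIV) (PiE UNIV I)"
    unfolding compactin_PiE by (auto simp: compactin_euclidean_iff I_def)
  then have "compact (PiE UNIV I)"
    by (simp add: euclidean_product_topology compactin_euclidean_iff)
  moreover have "closed {x. dotp p x x = 1}"
    unfolding dotp_def by (intro closed_Collect_eq continuous_intros)
  moreover have "closed {x. dotp p (q i) x = 0}" for i
    unfolding dotp_def by (intro closed_Collect_eq continuous_intros)
  ultimately have "compact K"
    unfolding K_def by (intro compact_Int_closed closed_Int closed_INT) auto
  define u where "u y i = (if i < p then y i / sqrt (dotp p y y) else 0)" for y i
  have uK: "u y \<in> K" if "dotp p y y > 0" "\<And>i. i < k \<Longrightarrow> dotp p (q i) y = 0" for y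
  proof -
    have s: "dotp p (u y) (u y) = 1"
    proof -
      have "dotp p (u y) (u y) = (\<Sum>i<p. y i * y i / dotp p y y)"
        using that(1) by (auto simp: dotp_def u_def real_sqrt_mult_self intro!: sum.cong)
      also have "\<dots> = dotp p y y / dotp p y y"
        by (simp only: dotp_def sum_divide_distrib)
      finally show ?thesis using that(1) by simp
    qed
    have "u y i \<in> I i" for i
    proof (cases "i < p")
      case True
      have "(u y i)\<^sup>2 \<le> dotp p (u y) (u y)"
        unfolding dotp_def power2_eq_square using True by (intro member_le_sum) auto
      with s have "\<bar>u y i\<bar> \<le> 1" by (simp add: abs_square_le_1)
      then show ?thesis using True by (auto simp: I_def abs_le_iff)
    qed (simp add: I_def u_def)
    moreover have "dotp p (q i) (u y) = 0" if "i < k" for i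
    proof -
      have "dotp p (q i) (u y) = dotp p (q i) y / sqrt (dotp p y y)"
        by (auto simp: dotp_def u_def sum_divide_distrib intro!: sum.cong)
      then show ?thesis using \<open>i < k \<Longrightarrow> dotp p (q i) y = 0\<close> that by simp
    qed
    ultimately show ?thesis using s by (auto simp: K_def PiE_iff)
  qed
  obtain z where "dotp p z z > 0" "\<And>i. i < k \<Longrightarrow> dotp p (q i) z = 0"
    using exists_orthogonal_vector[OF assms] by blast
  then have "K \<noteq> {}" using uK by blast
  moreover have "continuous_on K (\<lambda>x. dotp p x (app p S x))"
    unfolding dotp_def app_def by (intro continuous_intros)
  ultimately obtain x where x: "x \<in> K" "\<And>y. y \<in> K \<Longrightarrow> dotp p y (app p S y) \<le> dotp p x (app p S x)"
    using continuous_attains_sup[OF \<open>compact K\<close>] by blast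
  show thesis
  proof
    show "dotp p x x = 1" "\<And>i. i < k \<Longrightarrow> dotp p (q i) x = 0" using x(1) by (auto simp: K_def)
    fix y assume y: "\<And>i. i < k \<Longrightarrow> dotp p (q i) y = 0"
    show "dotp p y (app p S y) \<le> dotp p x (app p S x) * dotp p y y"
    proof (cases "dotp p y y > 0")
      case True
      define s where "s = sqrt (dotp p y y)"
      have s: "s > 0" "s * s = dotp p y y" using True by (auto simp: s_def)
      have ys: "i < p \<Longrightarrow> y i = s * u y i" for i using s by (simp add: u_def s_def)
      have "dotp p y (app p S y) = dotp p (\<lambda>i. s * u y i) (app p S (\<lambda>i. s * u y i))"
        using ys app_cong[of p y "\<lambda>i. s * u y i" S] by (intro dotp_cong) auto
      also have "\<dots> = dotp p y y * dotp p (u y) (app p S (u y))"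
        by (simp add: app_scale dotp_scale dotp_scale_left s(2)[symmetric])
      also have "\<dots> \<le> dotp p y y * dotp p x (app p S x)"
        using True y by (intro mult_left_mono x(2) uK) auto
      finally show ?thesis by (simp add: mult.commute)
    next
      case False
      then have "dotp p y y = 0" using dotp_self_nonneg[of p y] by simp
      then have "\<And>i. i < p \<Longrightarrow> y i = 0" by (rule dotp_self_eq_0)
      then have "dotp p y (app p S y) = 0" by (simp add: dotp_def)
      with \<open>dotp p y y = 0\<close> show ?thesis by simp
    qed
  qed
qed

text \<open>The maximiser x of the constrained quadratic form is an eigenvector. The residual r = S
  x - L x is again orthogonal to the earlier eigenvectors, so x + t r is admissible for every t.
  Comparing the values gives a linear term 2 |r|^2 t below a quadratic one, which forces r =
  0.\<close>

lemma spectral_step: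
  assumes sym: "\<And>i j. i < p \<Longrightarrow> j < p \<Longrightarrow> S i j = S j i"
    and k: "k < p"
    and eig: "\<And>i a. i < k \<Longrightarrow> a < p \<Longrightarrow> app p S (q i) a = l i * q i a"
  obtains x L where "dotp p x x = 1" "\<And>i. i < k \<Longrightarrow> dotp p (q i) x = 0"
    "\<And>a. a < p \<Longrightarrow> app p S x a = L * x a"
    "\<And>y. (\<And>i. i < k \<Longrightarrow> dotp p (q i) y = 0) \<Longrightarrow> dotp p y (app p S y) \<le> L * dotp p y y"
proof -
  obtain x where x: "dotp p x x = 1" "\<And>i. i < k \<Longrightarrow> dotp p (q i) x = 0"
    "\<And>y. (\<And>i. i < k \<Longrightarrow> dotp p (q i) y = 0) \<Longrightarrow>
      dotp p y (app p S y) \<le> dotp p x (app p S x) * dotp p y y"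
    using quadratic_form_attains_max[OF k] by blast
  define L where "L = dotp p x (app p S x)"
  define r where "r i = app p S x i - L * x i" for i
  have r_orth: "dotp p (q i) r = 0" if "i < k" for i
  proof -
    have "dotp p (q i) (app p S x) = dotp p (app p S (q i)) x"
      by (rule dotp_app_symmetric) (rule sym)
    also have "\<dots> = dotp p (\<lambda>a. l i * q i a) x" using eig[OF that] by (intro dotp_cong) auto
    also have "\<dots> = 0" using x(2)[OF that] by (simp add: dotp_scale_left)
    finally show ?thesis using x(2)[OF that] by (simp add: r_def[abs_def] dotp_diff dotp_scale)
  qed
  have "2 * dotp p r r * t \<le> (L * dotp p r r - dotp p r (app p S r)) * t\<^sup>2" for t
  proof -
    have sw: "dotp p r (app p S x) = dotp p x (app p S r)"
      using dotp_app_symmetric[OF sym, where x = r and y = x] by (simp add: dotp_commute)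
    have rr: "dotp p r r = dotp p x (app p S r) - L * dotp p r x"
      using sw by (subst (2) r_def[abs_def]) (simp add: dotp_diff dotp_scale)
    have "dotp p (\<lambda>i. x i + t * r i) (app p S (\<lambda>i. x i + t * r i)) \<le>
        L * dotp p (\<lambda>i. x i + t * r i) (\<lambda>i. x i + t * r i)"
      unfolding L_def using x(2) r_orth by (intro x(3)) (simp add: dotp_add dotp_scale)
    then have "L + 2 * t * dotp p x (app p S r) + t\<^sup>2 * dotp p r (app p S r) \<le>
        L * (1 + 2 * t * dotp p r x + t\<^sup>2 * dotp p r r)"
      unfolding app_add app_scale dotp_add dotp_scale dotp_add_left dotp_scale_left
      by (simp add: L_def[symmetric] x(1) sw dotp_commute[of p x r] power2_eq_square algebra_simps)
    then show ?thesis unfolding rr by (simp add: algebra_simps)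
  qed
  from linear_dominated_by_quadratic[OF this] have "dotp p r r = 0" by simp
  then have "app p S x a = L * x a" if "a < p" for a
    using dotp_self_eq_0[OF _ that] by (fastforce simp: r_def)
  with x show thesis by (intro that[of x L]) (auto simp: L_def)
qed

text \<open>The induction carries along the maximality of each eigenvalue on the complement of the
  earlier eigenvectors. This yields the decreasing order at the end: a later eigenvector is a
  competitor in every earlier maximisation.\<close>

lemma spectral_theorem:
  assumes sym: "\<And>i j. i < p \<Longrightarrow> j < p \<Longrightarrow> S i j = S j i"
  obtains q l where "\<And>i j. i < p \<Longrightarrow> j < p \<Longrightarrow> dotp p (q i) (q j) = (if i = j then 1 else 0)"
    "\<And>i a. i < p \<Longrightarrow> a < p \<Longrightarrow> app p S (q i) a = l i * q i a"
    "\<And>i j. i \<le> j \<Longrightarrow> j < p \<Longrightarrow> l j \<le> l i"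
proof -
  have "\<exists>q l. (\<forall>i<k. \<forall>j<k. dotp p (q i) (q j) = (if i = j then 1 else 0)) \<and>
      (\<forall>i<k. \<forall>a<p. app p S (q i) a = l i * q i a) \<and>
      (\<forall>i<k. \<forall>y. (\<forall>j<i. dotp p (q j) y = 0) \<longrightarrow> dotp p y (app p S y) \<le> l i * dotp p y y)"
    if "k \<le> p" for k
    using that
  proof (induction k)
    case (Suc k)
    then obtain q l where q: "\<forall>i<k. \<forall>j<k. dotp p (q i) (q j) = (if i = j then 1 else 0)"
      "\<forall>i<k. \<forall>a<p. app p S (q i) a = l i * q i a"
      "\<forall>i<k. \<forall>y. (\<forall>j<i. dotp p (q j) y = 0) \<longrightarrow> dotp p y (app p S y) \<le> l i * dotp p y y"
      by auto
    have kp: "k < p" and eig: "\<And>i a. i < k \<Longrightarrow> a < p \<Longrightarrow> app p S (q i) a = l i * q i a"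
      using Suc.prems q(2) by auto
    obtain x L where x: "dotp p x x = 1" "\<And>i. i < k \<Longrightarrow> dotp p (q i) x = 0"
      "\<And>a. a < p \<Longrightarrow> app p S x a = L * x a"
      "\<And>y. (\<And>i. i < k \<Longrightarrow> dotp p (q i) y = 0) \<Longrightarrow> dotp p y (app p S y) \<le> L * dotp p y y"
      by (rule spectral_step[where p = p and S = S and k = k and q = q and l = l])
        (assumption | rule sym kp eig | blast)+
    have xq: "dotp p x (q i) = 0" if "i < k" for i
      using x(2)[OF that] by (subst dotp_commute)
    show ?case
    proof (intro exI[of _ "q(k := x)"] exI[of _ "l(k := L)"] conjI allI impI)
      fix i j assume "i < Suc k" "j < Suc k"
      then show "dotp p ((q(k := x)) i) ((q(k := x)) j) = (if i = j then 1 else 0)"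
        using q(1) x(1) x(2) xq by (auto simp: less_Suc_eq)
    next
      fix i a assume "i < Suc k" "a < p"
      then show "app p S ((q(k := x)) i) a = (l(k := L)) i * (q(k := x)) i a"
        using q(2) x(3) by (auto simp: less_Suc_eq)
    next
      fix i y assume "i < Suc k" and y: "\<forall>j<i. dotp p ((q(k := x)) j) y = 0"
      then consider "i < k" "\<forall>j<i. dotp p (q j) y = 0" | "i = k" "\<forall>j<k. dotp p (q j) y = 0"
        by (fastforce simp: less_Suc_eq)
      then show "dotp p y (app p S y) \<le> (l(k := L)) i * dotp p y y"
        using q(3) x(4) by cases auto
    qed
  qed simp
  from this[OF order_refl] obtain q l where q: "\<forall>i<p. \<forall>j<p. dotp p (q i) (q j) = (if i = j then 1 else 0)"
    "\<forall>i<p. \<forall>a<p. app p S (q i) a = l i * q i a"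
    "\<forall>i<p. \<forall>y. (\<forall>j<i. dotp p (q j) y = 0) \<longrightarrow> dotp p y (app p S y) \<le> l i * dotp p y y"
    by auto
  have "l j \<le> l i" if "i \<le> j" "j < p" for i j
  proof -
    have "dotp p (q j) (app p S (q j)) = dotp p (q j) (\<lambda>a. l j * q j a)"
      using q(2) that(2) by (intro dotp_cong) auto
    then have "dotp p (q j) (app p S (q j)) = l j" using q(1) that(2) by (simp add: dotp_scale)
    moreover have "dotp p (q j) (app p S (q j)) \<le> l i * dotp p (q j) (q j)"
    proof -
      have "\<forall>k<i. dotp p (q k) (q j) = 0" using q(1) that by auto
      then show ?thesis using q(3) that by (meson le_less_trans)
    qed
    ultimately show ?thesis using q(1) that by simp
  qed
  with q show thesis by (intro that[of q l]) auto
qed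

section \<open>Positive definite matrices and their square roots\<close>

lemma pos_def_mat_dotp:
  assumes "pos_def_mat p \<Sigma>" and "i < p" "x i \<noteq> 0"
  shows "0 < dotp p x (app p (\<lambda>i j. \<Sigma> $$ (i, j)) x)"
proof -
  let ?v = "Matrix.vec p x"
  have S: "\<Sigma> \<in> carrier_mat p p" using assms(1) by (simp add: pos_def_mat_def)
  have "?v \<noteq> 0\<^sub>v p" using assms(2,3) by (metis index_vec index_zero_vec(1))
  then have "0 < scalar_prod ?v (\<Sigma> *\<^sub>v ?v)"
    using assms(1) by (auto simp: pos_def_mat_def)
  also have "scalar_prod ?v (\<Sigma> *\<^sub>v ?v) = dotp p x (app p (\<lambda>i j. \<Sigma> $$ (i, j)) x)"
    using S by (auto simp: scalar_prod_def dotp_def app_def atLeast0LessThan intro!: sum.cong)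
  finally show ?thesis .
qed

lemma pos_def_eigenvalue_pos:
  assumes "pos_def_mat p \<Sigma>" "dotp p x x = 1"
    and eig: "\<And>a. a < p \<Longrightarrow> app p (\<lambda>i j. \<Sigma> $$ (i, j)) x a = l * x a"
  shows "0 < l"
proof -
  have "\<exists>a<p. x a \<noteq> 0"
    by (rule ccontr) (use assms(2) in \<open>auto simp: dotp_def\<close>)
  then obtain a where "a < p" "x a \<noteq> 0" by blast
  then have "0 < dotp p x (app p (\<lambda>i j. \<Sigma> $$ (i, j)) x)"
    by (rule pos_def_mat_dotp[OF assms(1)])
  also have "\<dots> = dotp p x (\<lambda>a. l * x a)" using eig by (intro dotp_cong) auto
  finally show ?thesis using assms(2) by (simp add: dotp_scale)
qed

lemma pos_def_matI:
  assumes "S \<in> carrier_mat p p" "\<And>i j. i < p \<Longrightarrow> j < p \<Longrightarrow> S $$ (i, j) = S $$ (j, i)"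
    and "\<And>x i. i < p \<Longrightarrow> x i \<noteq> 0 \<Longrightarrow> 0 < dotp p x (app p (\<lambda>i j. S $$ (i, j)) x)"
  shows "pos_def_mat p S"
  unfolding pos_def_mat_def
proof (intro conjI ballI impI)
  show "S \<in> carrier_mat p p" by fact
  show "transpose_mat S = S" using assms(1,2) by (intro eq_matI) auto
  fix v :: "real Matrix.vec" assume v: "v \<in> carrier_vec p" "v \<noteq> 0\<^sub>v p"
  then obtain i where i: "i < p" "vec_index v i \<noteq> 0"
    by (metis carrier_vecD eq_vecI index_zero_vec)
  have "scalar_prod v (S *\<^sub>v v) = dotp p (vec_index v) (app p (\<lambda>i j. S $$ (i, j)) (vec_index v))"
    using assms(1) v(1) by (auto simp: scalar_prod_def dotp_def app_def atLeast0LessThan intro!: sum.cong)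
  then show "0 < scalar_prod v (S *\<^sub>v v)" using assms(3)[of i "vec_index v"] i by simp
qed

lemma pos_def_mat_symD:
  "pos_def_mat p S \<Longrightarrow> i < p \<Longrightarrow> j < p \<Longrightarrow> S $$ (i, j) = S $$ (j, i)"
  unfolding pos_def_mat_def by (metis carrier_matD index_transpose_mat(1))

text \<open>Orthonormal rows of a square matrix give orthonormal columns, because a right inverse is
  also a left inverse.\<close>

lemma orthonormal_complete:
  assumes "\<And>i j. i < p \<Longrightarrow> j < p \<Longrightarrow> dotp p (q i) (q j) = (if i = j then 1 else 0)"
    and "a < p" "c < p"
  shows "(\<Sum>k<p. q k a * q k c) = (if a = c then 1 else 0)"
proof -
  define Q where "Q = mat p p (\<lambda>(i, j). q i j)"
  have Q: "Q \<in> carrier_mat p p" by (simp add: Q_def)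
  have "Q * transpose_mat Q = 1\<^sub>m p"
    using assms(1) by (intro eq_matI) (auto simp: Q_def scalar_prod_def dotp_def atLeast0LessThan)
  then have "transpose_mat Q * Q = 1\<^sub>m p"
    by (intro mat_mult_left_right_inverse[OF Q]) (use Q in auto)
  then have "(transpose_mat Q * Q) $$ (a, c) = (1\<^sub>m p) $$ (a, c)" by simp
  then show ?thesis
    using assms(2,3) by (simp add: Q_def scalar_prod_def atLeast0LessThan)
qed

lemma sum_mult_mat_index:
  assumes "A \<in> carrier_mat p p" "B \<in> carrier_mat p p" "i < p" "j < p"
  shows "(A * B) $$ (i, j) = (\<Sum>k<p. A $$ (i, k) * B $$ (k, j))"
  using assms by (simp add: scalar_prod_def atLeast0LessThan)

text \<open>\<open>sqrt_mat\<close> is a choice, so its properties become available only with a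
  witness: the sum of sqrt (l k) times the projection onto q k.\<close>

lemma sqrt_mat_exists:
  assumes "pos_def_mat p \<Sigma>"
  shows "\<exists>B. pos_def_mat p B \<and> B * B = \<Sigma>"
proof -
  let ?S = "\<lambda>i j. \<Sigma> $$ (i, j)"
  have S: "\<Sigma> \<in> carrier_mat p p" using assms by (simp add: pos_def_mat_def)
  obtain q l where on: "\<And>i j. i < p \<Longrightarrow> j < p \<Longrightarrow> dotp p (q i) (q j) = (if i = j then 1 else 0)"
    and eig: "\<And>i a. i < p \<Longrightarrow> a < p \<Longrightarrow> app p ?S (q i) a = l i * q i a"
    by (rule spectral_theorem[of p ?S]) (assumption | rule pos_def_mat_symD[OF assms] | blast)+
  note comp = orthonormal_complete[OF on]
  have l: "l i > 0" if "i < p" for i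
    using on eig that by (intro pos_def_eigenvalue_pos[OF assms, of "q i"]) auto
  define B where "B = mat p p (\<lambda>(a, c). \<Sum>k<p. sqrt (l k) * q k a * q k c)"
  have B: "B \<in> carrier_mat p p" by (simp add: B_def)
  have "pos_def_mat p B"
  proof (rule pos_def_matI[OF B])
    show "B $$ (i, j) = B $$ (j, i)" if "i < p" "j < p" for i j
      using that by (simp add: B_def ac_simps)
    fix x i assume i: "i < p" "(x i :: real) \<noteq> 0"
    have eq: "dotp p x (app p (\<lambda>i j. B $$ (i, j)) x) = (\<Sum>k<p. sqrt (l k) * (dotp p (q k) x)\<^sup>2)"
    proof -
      have "dotp p x (app p (\<lambda>i j. B $$ (i, j)) x) =
          (\<Sum>a<p. \<Sum>c<p. \<Sum>k<p. sqrt (l k) * (q k a * x a) * (q k c * x c))"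
        by (simp add: dotp_def app_def B_def sum_distrib_left sum_distrib_right ac_simps)
      also have "\<dots> = (\<Sum>k<p. \<Sum>a<p. \<Sum>c<p. sqrt (l k) * (q k a * x a) * (q k c * x c))"
        by (subst sum.swap[of _ "{..<p}" "{..<p}"]) (subst sum.swap, simp)
      moreover have "(dotp p (q k) x)\<^sup>2 = (\<Sum>a<p. \<Sum>c<p. (q k a * x a) * (q k c * x c))" for k
        by (simp only: dotp_def power2_eq_square sum_product)
      ultimately show ?thesis by (simp add: sum_distrib_left mult.assoc)
    qed
    have "\<exists>k<p. dotp p (q k) x \<noteq> 0"
    proof (rule ccontr)
      assume "\<not> ?thesis"
      then have z: "dotp p (q k) x = 0" if "k < p" for k using that by auto
      have "0 = (\<Sum>k<p. q k i * dotp p (q k) x)" using z by simp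
      also have "\<dots> = (\<Sum>c<p. (\<Sum>k<p. q k i * q k c) * x c)"
        unfolding dotp_def sum_distrib_left sum_distrib_right by (subst sum.swap) (simp add: ac_simps)
      also have "\<dots> = x i"
        using comp i(1) by (simp add: if_distrib[of "\<lambda>y. y * _"] cong: if_cong)
      finally show False using i(2) by simp
    qed
    then obtain k where k: "k < p" "dotp p (q k) x \<noteq> 0" by blast
    have "0 < sqrt (l k) * (dotp p (q k) x)\<^sup>2" using k l by simp
    also have "\<dots> \<le> (\<Sum>k<p. sqrt (l k) * (dotp p (q k) x)\<^sup>2)"
      using k(1) l by (intro member_le_sum) (auto simp: less_imp_le)
    finally show "0 < dotp p x (app p (\<lambda>i j. B $$ (i, j)) x)" by (simp add: eq)
  qed
  moreover have "B * B = \<Sigma>"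
  proof (rule eq_matI)
    fix a c assume "a < dim_row \<Sigma>" "c < dim_col \<Sigma>"
    then have ac: "a < p" "c < p" using S by auto
    have "(B * B) $$ (a, c) = (\<Sum>d<p. (\<Sum>k<p. sqrt (l k) * q k a * q k d) * (\<Sum>k<p. sqrt (l k) * q k d * q k c))"
      unfolding sum_mult_mat_index[OF B B ac] using ac by (simp add: B_def)
    also have "\<dots> = (\<Sum>d<p. \<Sum>k<p. \<Sum>k'<p. sqrt (l k) * sqrt (l k') * q k a * q k' c * (q k d * q k' d))"
      by (simp add: sum_product ac_simps)
    also have "\<dots> = (\<Sum>k<p. \<Sum>k'<p. \<Sum>d<p. sqrt (l k) * sqrt (l k') * q k a * q k' c * (q k d * q k' d))"
      by (subst sum.swap) (rule sum.cong[OF refl], rule sum.swap)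
    also have "\<dots> = (\<Sum>k<p. \<Sum>k'<p. sqrt (l k) * sqrt (l k') * q k a * q k' c * (if k = k' then 1 else 0))"
    proof (intro sum.cong refl)
      fix k k' assume "k \<in> {..<p}" "k' \<in> {..<p}"
      then have "(\<Sum>d<p. q k d * q k' d) = (if k = k' then 1 else 0)"
        using on unfolding dotp_def by simp
      then show "(\<Sum>d<p. sqrt (l k) * sqrt (l k') * q k a * q k' c * (q k d * q k' d)) =
          sqrt (l k) * sqrt (l k') * q k a * q k' c * (if k = k' then 1 else 0)"
        by (simp only: sum_distrib_left[symmetric])
    qed
    also have "\<dots> = (\<Sum>k<p. (l k * q k a) * q k c)"
      using l by (simp add: if_distrib sum.delta' less_imp_le cong: if_cong)
    also have "\<dots> = (\<Sum>k<p. app p ?S (q k) a * q k c)" using eig ac by simp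
    also have "\<dots> = (\<Sum>d<p. ?S a d * (\<Sum>k<p. q k d * q k c))"
      unfolding app_def sum_distrib_left sum_distrib_right by (subst sum.swap) (simp add: ac_simps)
    also have "\<dots> = ?S a c" by (simp add: comp ac if_distrib cong: if_cong)
    finally show "(B * B) $$ (a, c) = \<Sigma> $$ (a, c)" .
  qed (use S B in auto)
  ultimately show ?thesis by blast
qed

lemma sqrt_mat_props:
  assumes "pos_def_mat p \<Sigma>"
  shows "pos_def_mat p (sqrt_mat p \<Sigma>)" "sqrt_mat p \<Sigma> * sqrt_mat p \<Sigma> = \<Sigma>"
  using someI_ex[OF sqrt_mat_exists[OF assms]] unfolding sqrt_mat_def by auto

text \<open>The square root enters through its symmetry and its square alone. The vectors
  \<open>e i\<close> are the normalised images of the eigenvectors \<open>q i\<close> under it: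
  applying it once more gives B (e i) = sqrt (l i) q i, and symmetry makes the \<open>e i\<close>
  orthonormal. Whitened coordinates refer to \<open>e\<close>, observed ones to
  \<open>q\<close>.\<close>

lemma whitening_frame:
  fixes p :: nat and \<Sigma> :: "real mat"
  defines "B \<equiv> app p (\<lambda>i j. sqrt_mat p \<Sigma> $$ (i, j))"
  assumes "pos_def_mat p \<Sigma>"
  obtains q e l where "\<And>i j. i < p \<Longrightarrow> j < p \<Longrightarrow> dotp p (q i) (q j) = (if i = j then 1 else 0)"
    "\<And>i j. i < p \<Longrightarrow> j < p \<Longrightarrow> dotp p (e i) (e j) = (if i = j then 1 else 0)"
    "\<And>i. i < p \<Longrightarrow> 0 < l i" "\<And>i j. i \<le> j \<Longrightarrow> j < p \<Longrightarrow> l j \<le> l i"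
    "\<And>i a. i < p \<Longrightarrow> a < p \<Longrightarrow> B (e i) a = sqrt (l i) * q i a"
    "\<And>i x. i < p \<Longrightarrow> dotp p (q i) (B x) = sqrt (l i) * dotp p (e i) x"
proof -
  let ?S = "\<lambda>i j. \<Sigma> $$ (i, j)"
  let ?B = "\<lambda>i j. sqrt_mat p \<Sigma> $$ (i, j)"
  obtain q l where on: "\<And>i j. i < p \<Longrightarrow> j < p \<Longrightarrow> dotp p (q i) (q j) = (if i = j then 1 else 0)"
    and eig: "\<And>i a. i < p \<Longrightarrow> a < p \<Longrightarrow> app p ?S (q i) a = l i * q i a"
    and sorted: "\<And>i j. i \<le> j \<Longrightarrow> j < p \<Longrightarrow> l j \<le> l i"
    by (rule spectral_theorem[of p ?S]) (assumption | rule pos_def_mat_symD[OF assms(2)] | blast)+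
  have l: "l i > 0" if "i < p" for i
    using on eig that by (intro pos_def_eigenvalue_pos[OF assms(2), of "q i"]) auto
  note sq = sqrt_mat_props[OF assms(2)]
  have Bc: "sqrt_mat p \<Sigma> \<in> carrier_mat p p" using sq(1) by (simp add: pos_def_mat_def)
  have Bsym: "dotp p x (B y) = dotp p (B x) y" for x y
    unfolding B_def by (rule dotp_app_symmetric) (rule pos_def_mat_symD[OF sq(1)])
  have BB: "B (B x) a = app p ?S x a" if "a < p" for x a
  proof -
    have "B (B x) a = (\<Sum>c<p. (\<Sum>d<p. ?B a d * ?B d c) * x c)"
      unfolding B_def app_def sum_distrib_left sum_distrib_right by (subst sum.swap) (simp add: ac_simps)
    also have "\<dots> = app p ?S x a"
      unfolding app_def using that sum_mult_mat_index[OF Bc Bc, of a] sq(2) by simp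
    finally show ?thesis .
  qed
  define e where "e i a = (1 / sqrt (l i)) * B (q i) a" for i a
  have Be: "B (e i) a = sqrt (l i) * q i a" if "i < p" "a < p" for i a
  proof -
    have "B (e i) a = (1 / sqrt (l i)) * B (B (q i)) a"
      unfolding e_def[abs_def] B_def app_scale ..
    also have "\<dots> = (1 / sqrt (l i)) * (l i * q i a)" using BB eig that by simp
    also have "\<dots> = (l i / sqrt (l i)) * q i a" by simp
    also have "\<dots> = sqrt (l i) * q i a" using l[OF that(1)] by (simp only: real_div_sqrt less_imp_le)
    finally show ?thesis .
  qed
  have qB: "dotp p (q i) (B x) = sqrt (l i) * dotp p (e i) x" if "i < p" for i x
    unfolding Bsym e_def[abs_def] dotp_scale_left using l[OF that] by simp
  have "dotp p (e i) (e j) = (if i = j then 1 else 0)" if "i < p" "j < p" for i j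
  proof -
    have "sqrt (l i) * dotp p (e i) (e j) = dotp p (q i) (B (e j))" using qB that by simp
    also have "\<dots> = dotp p (q i) (\<lambda>a. sqrt (l j) * q j a)" using Be that by (intro dotp_cong) auto
    also have "\<dots> = sqrt (l i) * (if i = j then 1 else 0)" using on that by (simp add: dotp_scale)
    finally show ?thesis using l[OF that(1)] by auto
  qed
  with on l sorted Be qB show thesis by (intro that[of q e l]) auto
qed

section \<open>Averages over sign vectors\<close>

definition signs :: "nat \<Rightarrow> (nat \<Rightarrow> real) set" where
  "signs m = PiE {..<m} (\<lambda>_. {-1, 1})"

lemma finite_signs: "finite (signs m)"
  unfolding signs_def by (intro finite_PiE) auto

lemma card_signs: "card (signs m) = 2 ^ m"
  unfolding signs_def by (subst card_PiE) (auto simp: numeral_2_eq_2)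

lemma signs_square: "s \<in> signs m \<Longrightarrow> i < m \<Longrightarrow> (s i)\<^sup>2 = 1"
  unfolding signs_def by (auto simp: PiE_iff dest!: bspec[of _ _ i])

text \<open>Two monotonicity arguments: x^2 / 2 - ln (cosh x) has derivative x - tanh x, which in
  turn has derivative (tanh x)^2.\<close>

lemma cosh_le_exp_square: "cosh x \<le> exp (x\<^sup>2 / 2)" for x :: real
proof -
  have *: "cosh x \<le> exp (x\<^sup>2 / 2)" if x: "0 \<le> x" for x :: real
  proof -
    have tanh_le: "tanh y \<le> y" if "0 \<le> y" for y :: real
    proof -
      have "0 - tanh 0 \<le> y - tanh y"
      proof (rule DERIV_nonneg_imp_nondecreasing[OF that])
        fix z :: real
        have "((\<lambda>z. z - tanh z) has_real_derivative (tanh z)\<^sup>2) (at z)"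
          by (auto intro!: derivative_eq_intros)
        then show "\<exists>d. ((\<lambda>z. z - tanh z) has_real_derivative d) (at z) \<and> 0 \<le> d" by fastforce
      qed
      then show ?thesis by simp
    qed
    have "0\<^sup>2 / 2 - ln (cosh 0) \<le> x\<^sup>2 / 2 - ln (cosh x)"
    proof (rule DERIV_nonneg_imp_nondecreasing[OF x])
      fix z :: real assume z: "0 \<le> z"
      have "((\<lambda>z. z\<^sup>2 / 2 - ln (cosh z)) has_real_derivative (z - tanh z)) (at z)"
        by (auto intro!: derivative_eq_intros simp: tanh_def)
      then show "\<exists>d. ((\<lambda>z. z\<^sup>2 / 2 - ln (cosh z)) has_real_derivative d) (at z) \<and> 0 \<le> d"
        using tanh_le[OF z] by (intro exI[of _ "z - tanh z"]) auto
    qed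
    then have "ln (cosh x) \<le> x\<^sup>2 / 2" by simp
    then show ?thesis by (metis cosh_real_pos exp_le_cancel_iff exp_ln)
  qed
  show ?thesis
  proof (cases "0 \<le> x")
    case False
    then show ?thesis using *[of "- x"] by simp
  qed (rule *)
qed

text \<open>Random signs are sub-Gaussian: the sum factorises over the coordinates into values 2
  cosh (x i).\<close>

lemma sum_signs_exp_le:
  assumes "\<And>i. i < m \<Longrightarrow> \<bar>x i\<bar> \<le> y"
  shows "(\<Sum>s\<in>signs m. exp (\<Sum>i<m. x i * s i)) \<le> 2 ^ m * exp (real m * y\<^sup>2 / 2)"
proof -
  have "(\<Sum>s\<in>signs m. exp (\<Sum>i<m. x i * s i)) = (\<Sum>s\<in>PiE {..<m} (\<lambda>_. {-1, 1}). \<Prod>i<m. exp (x i * s i))"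
    by (simp add: signs_def exp_sum)
  also have "\<dots> = (\<Prod>i<m. \<Sum>e\<in>{-1, 1}. exp (x i * e))"
    by (rule prod_sum_PiE[symmetric]) auto
  also have "\<dots> = (\<Prod>i<m. 2 * cosh (x i))"
    by (intro prod.cong refl) (simp add: cosh_def)
  also have "\<dots> \<le> (\<Prod>i<m. 2 * exp (y\<^sup>2 / 2))"
  proof (intro prod_mono conjI mult_left_mono)
    fix i assume "i \<in> {..<m}"
    then have "(x i)\<^sup>2 \<le> y\<^sup>2" using assms[of i] by (simp add: abs_le_square_iff[symmetric])
    then show "cosh (x i) \<le> exp (y\<^sup>2 / 2)"
      by (intro order_trans[OF cosh_le_exp_square]) simp
  qed (auto simp: cosh_real_nonneg)
  also have "\<dots> = 2 ^ m * exp (real m * y\<^sup>2 / 2)"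
    by (simp add: power_mult_distrib exp_of_nat_mult[symmetric])
  finally show ?thesis .
qed

text \<open>The Gaussian linearisation again, now for signs: an auxiliary normal variable y turns
  the square into a linear form, the signs are summed by the sub-Gaussian bound, and a square
  exponential of y remains.\<close>

lemma sum_signs_exp_square_le:
  assumes "\<And>i. i < m \<Longrightarrow> \<bar>d i\<bar> \<le> 1" and t: "0 \<le> t" "2 * t * real m < 1"
  shows "(\<Sum>w\<in>signs m. exp (t * (\<Sum>i<m. d i * w i)\<^sup>2)) \<le> 2 ^ m / sqrt (1 - 2 * t * real m)"
proof -
  define r where "r = sqrt (2 * t)"
  have r: "0 \<le> r" "r\<^sup>2 = 2 * t" using t by (auto simp: r_def)
  let ?B = "\<lambda>w. \<Sum>i<m. d i * w i"
  have sq: "exp (t * (?B w)\<^sup>2) = exp ((r * ?B w)\<^sup>2 / 2)" for w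
    by (simp add: power_mult_distrib r)
  have "ennreal (\<Sum>w\<in>signs m. exp (t * (?B w)\<^sup>2)) =
      (\<Sum>w\<in>signs m. \<integral>\<^sup>+y. ennreal (exp (r * ?B w * y)) \<partial>std_normal)"
    unfolding nn_integral_std_normal_exp sq by (simp add: sum_ennreal)
  also have "\<dots> = (\<integral>\<^sup>+y. ennreal (\<Sum>w\<in>signs m. exp (r * ?B w * y)) \<partial>std_normal)"
    by (subst nn_integral_sum[symmetric]) (auto simp: sum_ennreal)
  also have "\<dots> \<le> (\<integral>\<^sup>+y. ennreal (2 ^ m) * ennreal (exp ((t * real m) * y\<^sup>2)) \<partial>std_normal)"
  proof (rule nn_integral_mono)
    fix y
    have "(\<Sum>w\<in>signs m. exp (r * ?B w * y)) = (\<Sum>w\<in>signs m. exp (\<Sum>i<m. (r * y * d i) * w i))"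
      by (simp add: sum_distrib_left sum_distrib_right ac_simps)
    also have "\<dots> \<le> 2 ^ m * exp (real m * (r * \<bar>y\<bar>)\<^sup>2 / 2)"
    proof (rule sum_signs_exp_le)
      fix i assume "i < m"
      then have "r * \<bar>y\<bar> * \<bar>d i\<bar> \<le> r * \<bar>y\<bar> * 1" using assms(1) r(1) by (intro mult_left_mono) auto
      then show "\<bar>r * y * d i\<bar> \<le> r * \<bar>y\<bar>" using r(1) by (simp add: abs_mult)
    qed
    also have "real m * (r * \<bar>y\<bar>)\<^sup>2 / 2 = (t * real m) * y\<^sup>2"
      by (simp add: power_mult_distrib r)
    finally show "ennreal (\<Sum>w\<in>signs m. exp (r * ?B w * y)) \<le> ennreal (2 ^ m) * ennreal (exp ((t * real m) * y\<^sup>2))"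
      by (simp add: ennreal_mult'[symmetric] ennreal_leI)
  qed
  also have "\<dots> = ennreal (2 ^ m) * ennreal (1 / sqrt (1 - 2 * (t * real m)))"
    using t(2) by (subst nn_integral_cmult) (auto simp: nn_integral_std_normal_exp_square)
  also have "\<dots> = ennreal (2 ^ m / sqrt (1 - 2 * t * real m))"
    by (simp add: ennreal_mult'[symmetric] mult.assoc)
  finally show ?thesis
    using t(2) by (subst (asm) ennreal_le_iff) auto
qed

text \<open>For fixed \<open>w\<close> the exponent is linear in \<open>s\<close>. Summing over
  \<open>s\<close> first leaves the square of the form in \<open>w\<close>, with coefficient t = k^2
  m / 2, so that 2 t m = (k m)^2.\<close>

lemma sum_signs_exp_bilinear_le:
  assumes c: "\<And>i. i < m \<Longrightarrow> \<bar>c i\<bar> \<le> 1" and d: "\<And>i. i < m \<Longrightarrow> \<bar>d i\<bar> \<le> 1"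
    and k: "(k * real m)\<^sup>2 < 1"
  shows "(\<Sum>s\<in>signs m. \<Sum>w\<in>signs m. exp (k * ((\<Sum>i<m. c i * s i) * (\<Sum>i<m. d i * w i))))
    \<le> 4 ^ m / sqrt (1 - (k * real m)\<^sup>2)"
proof -
  let ?B = "\<lambda>w. \<Sum>i<m. d i * w i"
  define t where "t = k\<^sup>2 * real m / 2"
  have t: "0 \<le> t" "2 * t * real m = (k * real m)\<^sup>2"
    by (auto simp: t_def power2_eq_square)
  have "(\<Sum>s\<in>signs m. \<Sum>w\<in>signs m. exp (k * ((\<Sum>i<m. c i * s i) * ?B w))) =
      (\<Sum>w\<in>signs m. \<Sum>s\<in>signs m. exp (\<Sum>i<m. (k * ?B w * c i) * s i))"
    by (subst sum.swap) (simp add: sum_distrib_left sum_distrib_right ac_simps)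
  also have "\<dots> \<le> (\<Sum>w\<in>signs m. 2 ^ m * exp (real m * \<bar>k * ?B w\<bar>\<^sup>2 / 2))"
  proof (intro sum_mono sum_signs_exp_le)
    fix w i assume "i < m"
    then have "\<bar>k * ?B w\<bar> * \<bar>c i\<bar> \<le> \<bar>k * ?B w\<bar> * 1" using c by (intro mult_left_mono) auto
    then show "\<bar>k * ?B w * c i\<bar> \<le> \<bar>k * ?B w\<bar>" by (simp add: abs_mult)
  qed
  also have "\<dots> = 2 ^ m * (\<Sum>w\<in>signs m. exp (t * (?B w)\<^sup>2))"
  proof -
    have "real m * \<bar>k * ?B w\<bar>\<^sup>2 / 2 = t * (?B w)\<^sup>2" for w
      by (simp add: t_def power_mult_distrib)
    then show ?thesis by (simp only: sum_distrib_left[symmetric])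
  qed
  also have "\<dots> \<le> 2 ^ m * (2 ^ m / sqrt (1 - 2 * t * real m))"
    using d t k by (intro mult_left_mono sum_signs_exp_square_le) auto
  also have "\<dots> = 4 ^ m / sqrt (1 - (k * real m)\<^sup>2)"
    by (simp add: t(2) power_mult_distrib[symmetric])
  finally show ?thesis .
qed

text \<open>Multiplying by a fixed sign vector only changes the signs of the coefficients.\<close>

lemma sum_sign_pairs_exp_bilinear_le:
  assumes c: "\<And>i. i < m \<Longrightarrow> \<bar>c i\<bar> \<le> 1" and d: "\<And>i. i < m \<Longrightarrow> \<bar>d i\<bar> \<le> 1"
    and k: "(k * real m)\<^sup>2 < 1"
  shows "(\<Sum>(s', w')\<in>signs m \<times> signs m. \<Sum>(s, w)\<in>signs m \<times> signs m.
      exp (k * ((\<Sum>i<m. c i * s' i * s i) * (\<Sum>i<m. d i * w' i * w i))))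
    \<le> (real (card (signs m \<times> signs m)))\<^sup>2 / sqrt (1 - (k * real m)\<^sup>2)"
proof -
  have sg: "\<bar>s i\<bar> = 1" if "s \<in> signs m" "i < m" for s i
    using signs_square[OF that] by (metis abs_1 abs_square_eq_1)
  have "(\<Sum>(s', w')\<in>signs m \<times> signs m. \<Sum>(s, w)\<in>signs m \<times> signs m.
      exp (k * ((\<Sum>i<m. c i * s' i * s i) * (\<Sum>i<m. d i * w' i * w i))))
    \<le> (\<Sum>(s', w')\<in>signs m \<times> signs m. 4 ^ m / sqrt (1 - (k * real m)\<^sup>2))"
  proof (rule sum_mono, clarify)
    fix s' w' assume s'w': "s' \<in> signs m" "w' \<in> signs m"
    have "(\<Sum>s\<in>signs m. \<Sum>w\<in>signs m.
        exp (k * ((\<Sum>i<m. (c i * s' i) * s i) * (\<Sum>i<m. (d i * w' i) * w i))))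
      \<le> 4 ^ m / sqrt (1 - (k * real m)\<^sup>2)"
      using c d k s'w' by (intro sum_signs_exp_bilinear_le) (auto simp: abs_mult sg)
    then show "(\<Sum>(s, w)\<in>signs m \<times> signs m.
        exp (k * ((\<Sum>i<m. c i * s' i * s i) * (\<Sum>i<m. d i * w' i * w i))))
      \<le> 4 ^ m / sqrt (1 - (k * real m)\<^sup>2)"
      by (simp add: sum.cartesian_product)
  qed
  also have "\<dots> = (real (card (signs m \<times> signs m)))\<^sup>2 / sqrt (1 - (k * real m)\<^sup>2)"
    by (simp add: card_cartesian_product card_signs power2_eq_square power_mult_distrib[symmetric])
  finally show ?thesis .
qed

section \<open>The law of the observations\<close>

text \<open>Hence without drift the initial state has the same law as an innovation.\<close>

lemma stationary_cov_zero:
  assumes "pos_def_mat p \<Sigma>"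
  shows "stationary_cov p (0\<^sub>m p p) \<Sigma> = \<Sigma>"
proof -
  have "0\<^sub>m p p * S * transpose_mat (0\<^sub>m p p) + \<Sigma> = \<Sigma>" if "S \<in> carrier_mat p p" for S
    using that assms by (simp add: pos_def_mat_def)
  then show ?thesis
    unfolding stationary_cov_def using assms
    by (intro the_equality) (auto simp: pos_def_mat_def)
qed

text \<open>Undoes the whitening at every time. It is written with \<open>compose\<close> to match
  the law of images of product measures under coordinatewise maps.\<close>

definition coloured :: "nat \<Rightarrow> nat \<Rightarrow> real mat \<Rightarrow> (nat \<Rightarrow> nat \<Rightarrow> real) \<Rightarrow> nat \<Rightarrow> nat \<Rightarrow> real" where
  "coloured p T \<Sigma> = compose {..T} (apply_mat p (sqrt_mat p \<Sigma>))"

lemma sets_gaussian: "sets (gaussian p S) = sets (vec_measurable p)"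
  by (simp add: gaussian_def)

lemma measurable_coloured: "coloured p T \<Sigma> \<in> path_space p T \<rightarrow>\<^sub>M path_space p T"
proof -
  have "(\<lambda>w. \<lambda>t\<in>{..T}. apply_mat p (sqrt_mat p \<Sigma>) (w t))
      \<in> path_space p T \<rightarrow>\<^sub>M (\<Pi>\<^sub>M t\<in>{..T}. vec_measurable p)"
    by (intro measurable_restrict measurable_apply_mat_comp measurable_path_component) auto
  then show ?thesis
    unfolding coloured_def[abs_def] compose_def path_space_def[symmetric] .
qed

lemma distr_noise_coloured:
  "distr (noise p T) (path_space p T) (coloured p T \<Sigma>) = (\<Pi>\<^sub>M t\<in>{..T}. gaussian p \<Sigma>)"
proof -
  let ?f = "apply_mat p (sqrt_mat p \<Sigma>)"
  have f: "?f \<in> std_gaussian p \<rightarrow>\<^sub>M gaussian p \<Sigma>"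
    unfolding measurable_cong_sets[OF sets_std_gaussian sets_gaussian]
    by (intro measurable_apply_mat measurable_vec_component)
  have "distr (noise p T) (\<Pi>\<^sub>M t\<in>{..T}. gaussian p \<Sigma>) (compose {..T} ?f) =
      (\<Pi>\<^sub>M t\<in>{..T}. distr (std_gaussian p) (gaussian p \<Sigma>) ?f)"
    unfolding noise_def
    by (rule distr_PiM_finite_prob_space') (auto intro: f prob_space_std_gaussian prob_space_gaussian)
  also have "distr (std_gaussian p) (gaussian p \<Sigma>) ?f = gaussian p \<Sigma>"
    unfolding gaussian_def by (rule distr_cong) auto
  also have "distr (noise p T) (\<Pi>\<^sub>M t\<in>{..T}. gaussian p \<Sigma>) (compose {..T} ?f) =
      distr (noise p T) (path_space p T) (coloured p T \<Sigma>)"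
    unfolding coloured_def path_space_def
    by (intro distr_cong sets_PiM_cong sets_gaussian refl)
  finally show ?thesis .
qed

text \<open>The whitened drift H is the conjugate of \<Theta> by the square root B of \<Sigma>.
  Stating this as B H = \<Theta> B on vectors keeps inverse matrices out; the recursion then
  commutes with B.\<close>

lemma trajectory_coloured:
  assumes comm: "\<And>t x i. i < p \<Longrightarrow>
      apply_mat p (sqrt_mat p \<Sigma>) (apply_mat p (H t) x) i = apply_mat p (\<Theta> t) (apply_mat p (sqrt_mat p \<Sigma>) x) i"
    and "t \<le> T"
  shows "trajectory p \<Theta> (coloured p T \<Sigma> w 0) (coloured p T \<Sigma> w) t =
    apply_mat p (sqrt_mat p \<Sigma>) (trajectory p H (w 0) w t)"
  using assms(2)
proof (induction t)
  case 0
  show ?case by (simp add: coloured_def compose_def)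
next
  case (Suc t)
  let ?B = "sqrt_mat p \<Sigma>"
  have cw: "coloured p T \<Sigma> w (Suc t) = apply_mat p ?B (w (Suc t))"
    using Suc.prems by (simp add: coloured_def compose_def)
  have IH: "trajectory p \<Theta> (coloured p T \<Sigma> w 0) (coloured p T \<Sigma> w) t = apply_mat p ?B (trajectory p H (w 0) w t)"
    using Suc by simp
  have lin: "apply_mat p ?B (\<lambda>i\<in>{..<p}. y i + z i) i = apply_mat p ?B y i + apply_mat p ?B z i"
    if "i < p" for y z i
    using that by (simp add: apply_mat_def sum.distrib distrib_left)
  show ?case
  proof
    fix i
    show "trajectory p \<Theta> (coloured p T \<Sigma> w 0) (coloured p T \<Sigma> w) (Suc t) i =
        apply_mat p ?B (trajectory p H (w 0) w (Suc t)) i"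
    proof (cases "i < p")
      case True
      have "apply_mat p ?B (trajectory p H (w 0) w (Suc t)) i =
          apply_mat p ?B (apply_mat p (H t) (trajectory p H (w 0) w t)) i + apply_mat p ?B (w (Suc t)) i"
        unfolding trajectory.simps using True by (rule lin)
      also have "\<dots> = trajectory p \<Theta> (coloured p T \<Sigma> w 0) (coloured p T \<Sigma> w) (Suc t) i"
        unfolding trajectory.simps IH cw using True comm by simp
      finally show ?thesis ..
    next
      case False
      then show ?thesis by (simp add: apply_mat_def[of p ?B])
    qed
  qed
qed

text \<open>The bridge from the model to the likelihood ratios: every event gets its probability as
  an integral over one fixed noise law, the same for all alternatives.\<close>

lemma emeasure_var_law:
  assumes \<Sigma>: "pos_def_mat p \<Sigma>"
    and comm: "\<And>x i. i < p \<Longrightarrow>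
      apply_mat p (sqrt_mat p \<Sigma>) (apply_mat p H x) i = apply_mat p \<Theta> (apply_mat p (sqrt_mat p \<Sigma>) x) i"
    and A: "A \<in> sets (path_space p T)"
  shows "emeasure (var_law p T \<Sigma> \<tau> (0\<^sub>m p p) \<Theta>) A =
    (\<integral>\<^sup>+w. indicator A (coloured p T \<Sigma> w) * ennreal (exp (log_lr p T (transition \<tau> (0\<^sub>m p p) H) w)) \<partial>noise p T)"
proof -
  let ?\<Theta> = "transition \<tau> (0\<^sub>m p p) \<Theta>" and ?H = "transition \<tau> (0\<^sub>m p p) H"
  let ?G = "gaussian p \<Sigma>" and ?N = "\<Pi>\<^sub>M t\<in>{1..T}. gaussian p \<Sigma>"
  let ?X = "\<lambda>w. \<lambda>t\<in>{..T}. trajectory p ?\<Theta> (w 0) w t"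
  interpret G: product_sigma_finite "\<lambda>_::nat. ?G"
    by (simp add: product_sigma_finite_def prob_space_imp_sigma_finite prob_space_gaussian)
  interpret N: sigma_finite_measure ?N
    by (intro prob_space_imp_sigma_finite prob_space_PiM prob_space_gaussian)
  have sG: "sets (?G \<Otimes>\<^sub>M ?N) = sets (vec_measurable p \<Otimes>\<^sub>M (\<Pi>\<^sub>M t\<in>{1..T}. vec_measurable p))"
    by (intro sets_pair_measure_cong sets_PiM_cong sets_gaussian refl)
  have sP: "sets (\<Pi>\<^sub>M t\<in>{..T}. ?G) = sets (path_space p T)"
    unfolding path_space_def by (intro sets_PiM_cong sets_gaussian refl)
  have traj: "(\<lambda>(x, z). \<lambda>t\<in>{..T}. trajectory p ?\<Theta> x z t) \<in> ?G \<Otimes>\<^sub>M ?N \<rightarrow>\<^sub>M path_space p T"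
    unfolding case_prod_unfold path_space_def measurable_cong_sets[OF sG refl]
    by (intro measurable_restrict measurable_trajectory[unfolded case_prod_unfold]) auto
  have X: "?X \<in> path_space p T \<rightarrow>\<^sub>M path_space p T"
    using measurable_shifted[of p T ?\<Theta>] by (simp add: shifted_def[abs_def])
  have indX: "(\<lambda>w. indicator A (?X w) :: ennreal) \<in> borel_measurable (path_space p T)"
    by (rule measurable_compose[OF X]) (use A in simp)
  have indT: "(\<lambda>w. indicator A (case w of (x, z) \<Rightarrow> \<lambda>t\<in>{..T}. trajectory p ?\<Theta> x z t) :: ennreal)
      \<in> borel_measurable (?G \<Otimes>\<^sub>M ?N)"
    by (rule measurable_compose[OF traj]) (use A in simp)
  \<comment> \<open>The recursion reads innovations from index 1 on, so slot 0 is free for the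
    initial state. This merges the pair (x, z) into one path over \<open>{..T}\<close>.\<close>
  have X0: "?X (z(0 := x)) = (\<lambda>t\<in>{..T}. trajectory p ?\<Theta> x z t)" for x z
    by (intro restrict_ext) (simp, rule trajectory_cong, simp)
  have I: "insert 0 {1..T} = {..T}" by auto
  have indX': "(\<lambda>w. indicator A (?X w) :: ennreal) \<in> borel_measurable (\<Pi>\<^sub>M t\<in>insert 0 {1..T}. ?G)"
    unfolding I measurable_cong_sets[OF sP refl] by (rule indX)
  have "emeasure (var_law p T \<Sigma> \<tau> (0\<^sub>m p p) \<Theta>) A =
      (\<integral>\<^sup>+y. indicator A y \<partial>var_law p T \<Sigma> \<tau> (0\<^sub>m p p) \<Theta>)"
    by (rule nn_integral_indicator[symmetric]) (use A in \<open>simp add: var_law_def\<close>)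
  also have "\<dots> = (\<integral>\<^sup>+w. indicator A (case w of (x, z) \<Rightarrow> \<lambda>t\<in>{..T}. trajectory p ?\<Theta> x z t) \<partial>(?G \<Otimes>\<^sub>M ?N))"
    unfolding var_law_def stationary_cov_zero[OF \<Sigma>]
    by (rule nn_integral_distr[OF traj]) (use A in simp)
  also have "\<dots> = (\<integral>\<^sup>+x. \<integral>\<^sup>+z. indicator A (\<lambda>t\<in>{..T}. trajectory p ?\<Theta> x z t) \<partial>?N \<partial>?G)"
    using N.nn_integral_fst[OF indT] by simp
  also have "\<dots> = (\<integral>\<^sup>+x. \<integral>\<^sup>+z. indicator A (?X (z(0 := x))) \<partial>?N \<partial>?G)"
    by (simp only: X0)
  also have "\<dots> = (\<integral>\<^sup>+w. indicator A (?X w) \<partial>(\<Pi>\<^sub>M t\<in>{..T}. ?G))"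
    using G.product_nn_integral_insert_rev[OF _ _ indX'] unfolding I by simp
  also have "\<dots> = (\<integral>\<^sup>+w. indicator A (?X (coloured p T \<Sigma> w)) \<partial>noise p T)"
    unfolding distr_noise_coloured[symmetric]
    by (rule nn_integral_distr)
      (use measurable_coloured indX in \<open>simp_all add: measurable_cong_sets[OF sets_noise refl]\<close>)
  also have "\<dots> = (\<integral>\<^sup>+w. indicator A (coloured p T \<Sigma> (shifted p T ?H w)) \<partial>noise p T)"
  proof -
    have c: "apply_mat p (sqrt_mat p \<Sigma>) (apply_mat p (?H t) x) i = apply_mat p (?\<Theta> t) (apply_mat p (sqrt_mat p \<Sigma>) x) i"
      if "i < p" for t x i
    proof (cases "t \<le> \<tau>")
      case True
      then show ?thesis using that by (simp add: transition_def apply_mat_def)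
    next
      case False
      then show ?thesis using comm[OF that] by (simp add: transition_def)
    qed
    have "?X (coloured p T \<Sigma> w) t = coloured p T \<Sigma> (shifted p T ?H w) t" for w t
    proof (cases "t \<le> T")
      case True
      from trajectory_coloured[OF c True, where w = w] True show ?thesis
        by (simp add: coloured_def compose_def shifted_def)
    next
      case False
      then show ?thesis by (simp add: coloured_def compose_def)
    qed
    then have "?X (coloured p T \<Sigma> w) = coloured p T \<Sigma> (shifted p T ?H w)" for w
      by (rule ext)
    then show ?thesis by (simp only:)
  qed
  also have "\<dots> = (\<integral>\<^sup>+w. indicator A (coloured p T \<Sigma> w) * ennreal (exp (log_lr p T ?H w)) \<partial>noise p T)"
    by (rule nn_integral_shifted) (rule measurable_compose[OF measurable_coloured], use A in simp)
  finally show ?thesis .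
qed

section \<open>The lower bound\<close>

text \<open>Le Cam's argument. If every likelihood ratio gave A more than \<alpha> + \<eta>, so
  would their average m. But m has mean 1 and variance at most \<eta>^2, so the mixture can exceed
  the null probability of A by at most \<eta>.\<close>

lemma (in prob_space) mixture_second_moment:
  fixes L :: "'j \<Rightarrow> 'a \<Rightarrow> real"
  assumes J: "finite J" "J \<noteq> {}"
    and L: "\<And>j. j \<in> J \<Longrightarrow> L j \<in> borel_measurable M" "\<And>j x. 0 \<le> L j x"
    and one: "\<And>j. j \<in> J \<Longrightarrow> (\<integral>\<^sup>+x. ennreal (L j x) \<partial>M) = 1"
    and second: "(\<Sum>j\<in>J. \<Sum>k\<in>J. \<integral>\<^sup>+x. ennreal (L j x * L k x) \<partial>M) \<le> ennreal ((1 + \<eta>\<^sup>2) * (real (card J))\<^sup>2)"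
    and A: "A \<in> events" and \<eta>: "0 < \<eta>" and \<alpha>: "prob A \<le> \<alpha>"
  shows "\<exists>j\<in>J. (\<integral>\<^sup>+x. indicator A x * ennreal (L j x) \<partial>M) \<le> ennreal (\<alpha> + \<eta>)"
proof (rule ccontr)
  assume "\<not> ?thesis"
  then have big: "ennreal (\<alpha> + \<eta>) < (\<integral>\<^sup>+x. indicator A x * ennreal (L j x) \<partial>M)" if "j \<in> J" for j
    using that by (auto simp: not_le)
  define n where "n = real (card J)"
  have n: "0 < n" using J by (simp add: n_def card_gt_0_iff)
  have Li: "has_bochner_integral M (L j) 1" if "j \<in> J" for j
    using that L one by (intro has_bochner_integral_nn_integral) auto
  have LAi: "integrable M (\<lambda>x. indicator A x * L j x)" if "j \<in> J" for j
    using integrable_mult_indicator[OF A, of "L j"] Li[OF that] by (simp add: has_bochner_integral_iff)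
  have LA: "\<alpha> + \<eta> < (\<integral>x. indicator A x * L j x \<partial>M)" if "j \<in> J" for j
  proof -
    have "(\<integral>\<^sup>+x. indicator A x * ennreal (L j x) \<partial>M) = (\<integral>\<^sup>+x. ennreal (indicator A x * L j x) \<partial>M)"
      by (intro nn_integral_cong) (simp split: split_indicator)
    also have "\<dots> = ennreal (\<integral>x. indicator A x * L j x \<partial>M)"
      by (rule nn_integral_eq_integral[OF LAi[OF that]]) (simp add: L(2))
    finally have "ennreal (\<alpha> + \<eta>) < ennreal (\<integral>x. indicator A x * L j x \<partial>M)"
      using big[OF that] by simp
    moreover have "0 \<le> \<alpha> + \<eta>" using \<eta> \<alpha> measure_nonneg[of M A] by linarith
    ultimately show ?thesis by (simp add: ennreal_less_iff)
  qed
  have fin: "(\<integral>\<^sup>+x. ennreal (L j x * L k x) \<partial>M) < \<infinity>" if "j \<in> J" "k \<in> J" for j k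
  proof -
    have "(\<integral>\<^sup>+x. ennreal (L j x * L k x) \<partial>M) \<le> (\<Sum>j\<in>J. \<Sum>k\<in>J. \<integral>\<^sup>+x. ennreal (L j x * L k x) \<partial>M)"
      using that J by (intro order_trans[OF _ member_le_sum[of j]] member_le_sum[of k]) auto
    also note second
    finally show ?thesis by (rule le_less_trans) simp
  qed
  have LLi: "integrable M (\<lambda>x. L j x * L k x)" if "j \<in> J" "k \<in> J" for j k
    using fin[OF that] that L by (intro integrableI_nonneg) auto
  have LL: "(\<Sum>j\<in>J. \<Sum>k\<in>J. \<integral>x. L j x * L k x \<partial>M) \<le> (1 + \<eta>\<^sup>2) * n\<^sup>2"
  proof -
    have "ennreal (\<Sum>j\<in>J. \<Sum>k\<in>J. \<integral>x. L j x * L k x \<partial>M) = (\<Sum>j\<in>J. \<Sum>k\<in>J. ennreal (\<integral>x. L j x * L k x \<partial>M))"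
      by (simp add: sum_ennreal sum_nonneg L(2))
    also have "\<dots> = (\<Sum>j\<in>J. \<Sum>k\<in>J. \<integral>\<^sup>+x. ennreal (L j x * L k x) \<partial>M)"
      using LLi L(2) by (intro sum.cong refl nn_integral_eq_integral[symmetric]) auto
    also note second
    finally show ?thesis by (subst (asm) ennreal_le_iff) (auto simp: n_def)
  qed
  define m where "m x = (\<Sum>j\<in>J. L j x) / n" for x
  have m1: "has_bochner_integral M m 1"
  proof -
    have "has_bochner_integral M (\<lambda>x. (\<Sum>j\<in>J. L j x) / n) ((\<Sum>j\<in>J. 1) / n)"
      by (intro has_bochner_integral_divide_zero has_bochner_integral_sum Li)
    then show ?thesis using n by (simp add: m_def[abs_def] n_def)
  qed
  have m2: "has_bochner_integral M (\<lambda>x. (m x)\<^sup>2) ((\<Sum>j\<in>J. \<Sum>k\<in>J. \<integral>x. L j x * L k x \<partial>M) / n\<^sup>2)"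
  proof -
    have "has_bochner_integral M (\<lambda>x. (\<Sum>j\<in>J. \<Sum>k\<in>J. L j x * L k x) / n\<^sup>2)
        ((\<Sum>j\<in>J. \<Sum>k\<in>J. \<integral>x. L j x * L k x \<partial>M) / n\<^sup>2)"
      using LLi by (intro has_bochner_integral_divide_zero has_bochner_integral_sum has_bochner_integral_integrable)
    then show ?thesis by (simp add: m_def[abs_def] power_divide power2_eq_square sum_product)
  qed
  have m2_le: "(\<integral>x. (m x)\<^sup>2 \<partial>M) \<le> 1 + \<eta>\<^sup>2"
  proof -
    have "(\<integral>x. (m x)\<^sup>2 \<partial>M) = (\<Sum>j\<in>J. \<Sum>k\<in>J. \<integral>x. L j x * L k x \<partial>M) / n\<^sup>2"
      using m2 by (simp add: has_bochner_integral_iff)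
    also have "\<dots> \<le> 1 + \<eta>\<^sup>2" using LL n by (simp add: divide_le_eq)
    finally show ?thesis .
  qed
  have mA: "(\<integral>x. indicator A x * m x \<partial>M) = (\<Sum>j\<in>J. \<integral>x. indicator A x * L j x \<partial>M) / n"
  proof -
    have "(\<integral>x. indicator A x * m x \<partial>M) = (\<integral>x. (\<Sum>j\<in>J. indicator A x * L j x) / n \<partial>M)"
      by (simp add: m_def sum_distrib_left)
    then show ?thesis using LAi by simp
  qed
  have "\<alpha> + \<eta> < (\<integral>x. indicator A x * m x \<partial>M)"
  proof -
    have "(\<Sum>j\<in>J. \<alpha> + \<eta>) < (\<Sum>j\<in>J. \<integral>x. indicator A x * L j x \<partial>M)"
      using LA J by (intro sum_strict_mono) auto
    then show ?thesis unfolding mA using n by (simp add: n_def less_divide_eq mult.commute)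
  qed
  also have "(\<integral>x. indicator A x * m x \<partial>M) \<le>
      (\<integral>x. indicator A x + (((m x)\<^sup>2 - 2 * m x + 1) / \<eta> + \<eta>) / 2 \<partial>M)"
  proof (rule integral_mono)
    show "integrable M (\<lambda>x. indicator A x * m x)"
      unfolding m_def sum_distrib_left times_divide_eq_right
      using LAi by (intro integrable_divide_zero integrable_sum) auto
    show "integrable M (\<lambda>x. indicator A x + (((m x)\<^sup>2 - 2 * m x + 1) / \<eta> + \<eta>) / 2)"
      using m1 m2 A by (auto simp: has_bochner_integral_iff emeasure_eq_measure)
    fix x
    \<comment> \<open>A pointwise replacement for Cauchy-Schwarz: with weight \<eta> both halves of
      the bound have mean at most \<eta> / 2.\<close>
    have "m x - 1 \<le> ((m x - 1)\<^sup>2 / \<eta> + \<eta>) / 2"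
    proof -
      have "0 \<le> ((m x - 1) - \<eta>)\<^sup>2 / \<eta>" using \<eta> by simp
      also have "\<dots> = (m x - 1)\<^sup>2 / \<eta> - 2 * (m x - 1) + \<eta>"
        using \<eta> by (simp add: power2_eq_square field_simps)
      finally show ?thesis by simp
    qed
    moreover have "0 \<le> ((m x - 1)\<^sup>2 / \<eta> + \<eta>) / 2" using \<eta> by simp
    moreover have "(m x - 1)\<^sup>2 = (m x)\<^sup>2 - 2 * m x + 1" by (simp add: power2_eq_square algebra_simps)
    moreover have "indicator A x * t \<le> indicator A x + S" if "t - 1 \<le> S" "0 \<le> S" for t S :: real
      using that by (simp split: split_indicator)
    ultimately show "indicator A x * m x \<le> indicator A x + (((m x)\<^sup>2 - 2 * m x + 1) / \<eta> + \<eta>) / 2"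
      by metis
  qed
  also have "\<dots> = prob A + (((\<integral>x. (m x)\<^sup>2 \<partial>M) - 1) / \<eta> + \<eta>) / 2"
  proof -
    have ind: "has_bochner_integral M (indicator A) (prob A)"
      using A by (simp add: has_bochner_integral_iff emeasure_eq_measure)
    have "has_bochner_integral M (\<lambda>x. indicator A x + (((m x)\<^sup>2 - 2 * m x + 1) / \<eta> + \<eta>) / 2)
        (prob A + (((\<integral>x. (m x)\<^sup>2 \<partial>M) - 2 * 1 + 1) / \<eta> + \<eta>) / 2)"
    proof -
      have c: "has_bochner_integral M (\<lambda>_. c :: real) c" for c
        by (simp add: has_bochner_integral_iff prob_space)
      have sq: "has_bochner_integral M (\<lambda>x. (m x)\<^sup>2) (\<integral>x. (m x)\<^sup>2 \<partial>M)"
        using m2 by (simp add: has_bochner_integral_iff)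
      show ?thesis
        by (intro has_bochner_integral_add has_bochner_integral_divide_zero has_bochner_integral_diff
            has_bochner_integral_mult_right ind sq m1 c)
    qed
    then show ?thesis by (simp add: has_bochner_integral_iff)
  qed
  also have "\<dots> \<le> \<alpha> + \<eta>"
  proof -
    have "((\<integral>x. (m x)\<^sup>2 \<partial>M) - 1) / \<eta> \<le> \<eta>"
      using m2_le \<eta> by (simp add: divide_le_eq power2_eq_square)
    moreover have "prob A + (V + \<eta>) / 2 \<le> \<alpha> + \<eta>" if "V \<le> \<eta>" for V
      using that \<alpha> by (simp add: field_simps)
    ultimately show ?thesis by blast
  qed
  finally show False by simp
qed

text \<open>Operator and Frobenius norm coincide in rank one, so a single \<epsilon> governs both
  the constraint by \<gamma> and the energy.\<close>

lemma outer_param_mats: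
  assumes "dotp p u u = 1" "dotp p v v = 1" "0 \<le> \<epsilon>" "\<epsilon> \<le> \<gamma>" "1 \<le> R"
  defines "\<Theta> \<equiv> outer p (\<lambda>i. \<epsilon> * u i) v"
  shows "\<Theta> \<in> param_mats p R \<gamma>" "frob_norm (0\<^sub>m p p - \<Theta>) = \<epsilon>"
proof -
  have c: "\<Theta> \<in> carrier_mat p p" unfolding \<Theta>_def by (rule outer_carrier)
  have "vec_space.rank p \<Theta> \<le> 1"
    by (rule vec_space.rank_le_1_product_entries[OF c, where f = "\<lambda>i. \<epsilon> * u i" and g = v])
      (simp add: \<Theta>_def outer_def)
  moreover have "op_norm \<Theta> \<le> \<gamma>"
    unfolding op_norm_def
  proof (rule cSUP_least)
    have "eucl_norm (0\<^sub>v p) \<le> 1" by (simp add: eucl_norm_def)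
    then show "{v \<in> carrier_vec (dim_col \<Theta>). eucl_norm v \<le> 1} \<noteq> {}"
      using c by (intro ex_in_conv[THEN iffD1] exI[of _ "0\<^sub>v p"]) auto
    fix x assume "x \<in> {v \<in> carrier_vec (dim_col \<Theta>). eucl_norm v \<le> 1}"
    then have x: "x \<in> carrier_vec p" "eucl_norm x \<le> 1" using c by auto
    have dx: "dotp p (vec_index x) (vec_index x) \<le> 1"
      using x by (simp add: eucl_norm_def dotp_def power2_eq_square)
    have "(dotp p v (vec_index x))\<^sup>2 \<le> dotp p v v * dotp p (vec_index x) (vec_index x)"
      unfolding dotp_def power2_eq_square[symmetric] by (rule Cauchy_Schwarz_ineq_sum)
    then have le: "(dotp p v (vec_index x))\<^sup>2 \<le> 1" using assms(2) dx by simp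
    have i: "vec_index (\<Theta> *\<^sub>v x) i = \<epsilon> * u i * dotp p v (vec_index x)" if "i < p" for i
      using that x(1) by (simp add: \<Theta>_def outer_def scalar_prod_def dotp_def atLeast0LessThan
          sum_distrib_left mult.assoc)
    have "(eucl_norm (\<Theta> *\<^sub>v x))\<^sup>2 = (\<Sum>i<p. (\<epsilon> * u i * dotp p v (vec_index x))\<^sup>2)"
      unfolding eucl_norm_def using c i by (simp add: sum_nonneg)
    also have "\<dots> = \<epsilon>\<^sup>2 * (dotp p v (vec_index x))\<^sup>2 * dotp p u u"
      by (simp add: dotp_def[of p u] sum_distrib_left power_mult_distrib power2_eq_square ac_simps)
    also have "\<dots> \<le> \<epsilon>\<^sup>2 * 1 * 1"
      using le assms(1) by (intro mult_mono) auto
    finally have "(eucl_norm (\<Theta> *\<^sub>v x))\<^sup>2 \<le> \<epsilon>\<^sup>2" by simp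
    then have "eucl_norm (\<Theta> *\<^sub>v x) \<le> \<epsilon>" using assms(3) by (rule power2_le_imp_le)
    then show "eucl_norm (\<Theta> *\<^sub>v x) \<le> \<gamma>" using assms(4) by simp
  qed
  ultimately show "\<Theta> \<in> param_mats p R \<gamma>" using c assms(5) by (auto simp: param_mats_def)
  have "(\<Sum>i<p. \<Sum>j<p. ((0\<^sub>m p p - \<Theta>) $$ (i, j))\<^sup>2) = (\<Sum>i<p. \<Sum>j<p. \<epsilon>\<^sup>2 * (u i * u i) * (v j * v j))"
    by (intro sum.cong refl) (simp add: \<Theta>_def outer_def power2_eq_square)
  also have "\<dots> = \<epsilon>\<^sup>2 * dotp p u u * dotp p v v"
    by (simp add: dotp_def sum_distrib_left sum_distrib_right mult.assoc, subst sum.swap, rule refl)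
  finally show "frob_norm (0\<^sub>m p p - \<Theta>) = \<epsilon>"
    unfolding frob_norm_def using c assms(1-3) by (simp add: real_sqrt_abs)
qed

lemma zero_param_mats:
  assumes "0 \<le> \<gamma>"
  shows "0\<^sub>m p p \<in> param_mats p R \<gamma>"
proof -
  have "op_norm (0\<^sub>m p p) \<le> \<gamma>"
    unfolding op_norm_def
  proof (rule cSUP_least)
    have "eucl_norm (0\<^sub>v p) \<le> 1" by (simp add: eucl_norm_def)
    then show "{v \<in> carrier_vec (dim_col (0\<^sub>m p p)). eucl_norm v \<le> 1} \<noteq> {}"
      by (intro ex_in_conv[THEN iffD1] exI[of _ "0\<^sub>v p"]) auto
    fix x assume "x \<in> {v \<in> carrier_vec (dim_col (0\<^sub>m p p)). eucl_norm v \<le> 1}"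
    then have "0\<^sub>m p p *\<^sub>v x = 0\<^sub>v p" by (intro eq_vecI) auto
    then show "eucl_norm (0\<^sub>m p p *\<^sub>v x) \<le> \<gamma>" using assms by (simp add: eucl_norm_def)
  qed
  then show ?thesis by (simp add: param_mats_def vec_space.rank_0I)
qed

section \<open>Sign combinations of orthonormal frames\<close>

definition lin_comb :: "nat \<Rightarrow> (nat \<Rightarrow> real) \<Rightarrow> (nat \<Rightarrow> nat \<Rightarrow> real) \<Rightarrow> nat \<Rightarrow> real" where
  "lin_comb m f E x = (\<Sum>i<m. f i * E i x)"

lemma dotp_lin_comb_left: "dotp p (lin_comb m f E) y = (\<Sum>i<m. f i * dotp p (E i) y)"
  unfolding dotp_def lin_comb_def sum_distrib_right sum_distrib_left
  by (subst sum.swap) (simp add: mult.assoc)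

text \<open>Used with \<open>c = 1\<close> inside one orthonormal family and with
  \<open>c = 0\<close> for families from the two halves of the spectrum.\<close>

lemma dotp_lin_comb:
  assumes "\<And>i j. i < m \<Longrightarrow> j < m \<Longrightarrow> dotp p (E i) (E' j) = (if i = j then c else 0)"
  shows "dotp p (lin_comb m f E) (lin_comb m g E') = c * (\<Sum>i<m. f i * g i)"
proof -
  have "dotp p (E i) (lin_comb m g E') = c * g i" if "i < m" for i
  proof -
    have "dotp p (E i) (lin_comb m g E') = (\<Sum>j<m. g j * dotp p (E i) (E' j))"
      by (subst dotp_commute) (simp add: dotp_lin_comb_left dotp_commute[of p "E' _"])
    also have "\<dots> = (\<Sum>j<m. if i = j then c * g i else 0)"
      using assms that by (intro sum.cong refl) auto
    finally show ?thesis using that by simp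
  qed
  then show ?thesis by (simp add: dotp_lin_comb_left sum_distrib_left ac_simps)
qed

lemma app_lin_comb: "app p S (lin_comb m f E) a = (\<Sum>i<m. f i * app p S (E i) a)"
  unfolding app_def lin_comb_def sum_distrib_left
  by (subst sum.swap) (simp add: ac_simps)

lemma apply_mat_app: "i < p \<Longrightarrow> apply_mat p A x i = app p (\<lambda>i j. A $$ (i, j)) x i"
  by (simp add: apply_mat_def app_def)

text \<open>Both sides are multiples of u: on the left B maps a to u, on the right pairing v with B
  x gives the pairing of b with x.\<close>

lemma apply_mat_outer_intertwine:
  fixes p :: nat and B :: "real mat"
  defines "B' \<equiv> app p (\<lambda>i j. B $$ (i, j))"
  assumes a: "\<And>i. i < p \<Longrightarrow> B' a i = u i" and b: "\<And>x. dotp p v (B' x) = dotp p b x" and i: "i < p"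
  shows "apply_mat p B (apply_mat p (outer p a b) x) i = apply_mat p (outer p u v) (apply_mat p B x) i"
proof -
  have "B' (apply_mat p (outer p a b) x) = B' (\<lambda>i. dotp p b x * a i)"
    unfolding B'_def by (rule app_cong) (simp add: apply_mat_outer)
  then have "apply_mat p B (apply_mat p (outer p a b) x) i = dotp p b x * u i"
    using i a by (simp add: apply_mat_app B'_def[symmetric]) (simp add: B'_def app_scale)
  moreover have "dotp p v (apply_mat p B x) = dotp p v (B' x)"
    unfolding B'_def by (intro dotp_cong) (auto simp: apply_mat_app)
  ultimately show ?thesis using i b by (simp add: apply_mat_outer)
qed

text \<open>The left singular vectors live on the eigenspaces of the large eigenvalues of \<open>\<Sigma>\<close>, the right
  ones on those of the small eigenvalues. Hence all ratios of eigenvalues in the interaction terms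
  are at most 1, whatever the condition number of \<open>\<Sigma>\<close>, and the alternatives are nilpotent.\<close>

lemma least_favourable_family:
  fixes p m :: nat and \<Sigma> :: "real mat" and \<epsilon> :: real
  defines "J \<equiv> signs m \<times> signs m"
  assumes \<Sigma>: "pos_def_mat p \<Sigma>" and m: "0 < m" "2 * m \<le> p" and \<epsilon>: "0 \<le> \<epsilon>"
  obtains \<Theta> a b \<mu> c d where
    "0 < \<mu>" "\<And>i. i < m \<Longrightarrow> \<bar>c i\<bar> \<le> (1 :: real)" "\<And>i. i < m \<Longrightarrow> \<bar>d i\<bar> \<le> (1 :: real)"
    "\<And>j. j \<in> J \<Longrightarrow> \<exists>u v. dotp p u u = 1 \<and> dotp p v v = 1 \<and> \<Theta> j = outer p (\<lambda>i. \<epsilon> * u i) v"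
    "\<And>j x i. j \<in> J \<Longrightarrow> i < p \<Longrightarrow> apply_mat p (sqrt_mat p \<Sigma>) (apply_mat p (outer p (a j) (b j)) x) i =
        apply_mat p (\<Theta> j) (apply_mat p (sqrt_mat p \<Sigma>) x) i"
    "\<And>j k. dotp p (b j) (a k) = 0"
    "\<And>j. j \<in> J \<Longrightarrow> dotp p (b j) (b j) \<le> \<mu>"
    "\<And>j k. j \<in> J \<Longrightarrow> k \<in> J \<Longrightarrow> \<bar>dotp p (a j) (a k)\<bar> * \<mu> \<le> \<epsilon>\<^sup>2"
    "\<And>j k. dotp p (a j) (a k) * dotp p (b j) (b k) = \<epsilon>\<^sup>2 / (real m)\<^sup>2 *
        ((\<Sum>i<m. c i * fst j i * fst k i) * (\<Sum>i<m. d i * snd j i * snd k i))"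
proof -
  let ?B = "app p (\<lambda>i j. sqrt_mat p \<Sigma> $$ (i, j))"
  obtain q e l where q: "\<And>i j. i < p \<Longrightarrow> j < p \<Longrightarrow> dotp p (q i) (q j) = (if i = j then 1 else 0)"
    and e: "\<And>i j. i < p \<Longrightarrow> j < p \<Longrightarrow> dotp p (e i) (e j) = (if i = j then 1 else 0)"
    and l: "\<And>i. i < p \<Longrightarrow> 0 < l i" and sorted: "\<And>i j. i \<le> j \<Longrightarrow> j < p \<Longrightarrow> l j \<le> l i"
    and Be: "\<And>i a. i < p \<Longrightarrow> a < p \<Longrightarrow> ?B (e i) a = sqrt (l i) * q i a"
    and qB: "\<And>i x. i < p \<Longrightarrow> dotp p (q i) (?B x) = sqrt (l i) * dotp p (e i) x"
    using whitening_frame[OF \<Sigma>] by blast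
  define r where "r = 1 / sqrt (real m)"
  have r: "r * r * real m = 1" "r\<^sup>2 = 1 / real m" using m(1) by (auto simp: r_def power_divide)
  define q' where "q' i = q (m + i)" for i
  define e' where "e' i = e (m + i)" for i
  define u where "u s = lin_comb m (\<lambda>i. r * s i) q" for s
  define v where "v s = lin_comb m (\<lambda>i. r * s i) q'" for s
  \<comment> \<open>In whitened coordinates the left vector \<epsilon> u is pulled back through the
    square root, which divides by sqrt (l i), and the right vector is pushed through it, which
    multiplies by sqrt (l (m + i)).\<close>
  define a where "a j = lin_comb m (\<lambda>i. \<epsilon> * r * fst j i / sqrt (l i)) e" for j :: "(nat \<Rightarrow> real) \<times> (nat \<Rightarrow> real)"
  define b where "b j = lin_comb m (\<lambda>i. r * snd j i * sqrt (l (m + i))) e'" for j :: "(nat \<Rightarrow> real) \<times> (nat \<Rightarrow> real)"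
  \<comment> \<open>The eigenvalue at the cut: l i \<ge> \<mu> for i < m and l (m + i) \<le> \<mu>.
    It enters the products of the \<open>a\<close> inversely and those of the \<open>b\<close>
    directly, and cancels in the interaction.\<close>
  define \<mu> where "\<mu> = l m"
  define c where "c i = \<mu> / l i" for i
  define d where "d i = l (m + i) / \<mu>" for i
  have \<mu>: "0 < \<mu>" using l m by (simp add: \<mu>_def)
  have l1: "0 < l i" "0 < l (m + i)" if "i < m" for i using l that m by auto
  have c: "0 \<le> c i" "c i \<le> 1" if "i < m" for i
    using l1[OF that] \<mu> sorted[of i m] that m by (auto simp: c_def \<mu>_def)
  have d: "0 \<le> d i" "d i \<le> 1" if "i < m" for i
    using l1[OF that] \<mu> sorted[of m "m + i"] that m by (auto simp: d_def \<mu>_def)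
  have sq: "s i * s i = 1" if "s \<in> signs m" "i < m" for s i
    using signs_square[OF that] by (simp add: power2_eq_square)
  have uu: "dotp p (u s) (u s) = 1" and vv: "dotp p (v s) (v s) = 1" if "s \<in> signs m" for s
  proof -
    have "(\<Sum>i<m. (r * s i) * (r * s i)) = (\<Sum>i<m. r * r)"
      using sq[OF that] by (intro sum.cong) (auto simp: mult.assoc mult.left_commute[of _ r])
    then have S: "(\<Sum>i<m. (r * s i) * (r * s i)) = 1" using r(1) by (simp add: mult.commute)
    show "dotp p (u s) (u s) = 1"
      unfolding u_def by (subst dotp_lin_comb[where c = 1]) (use q m S in auto)
    show "dotp p (v s) (v s) = 1"
      unfolding v_def by (subst dotp_lin_comb[where c = 1]) (use q m S in \<open>auto simp: q'_def\<close>)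
  qed
  have aa: "dotp p (a j) (a k) = \<epsilon>\<^sup>2 / (real m * \<mu>) * (\<Sum>i<m. c i * fst j i * fst k i)" for j k
  proof -
    have "dotp p (a j) (a k) = (\<Sum>i<m. (\<epsilon> * r * fst j i / sqrt (l i)) * (\<epsilon> * r * fst k i / sqrt (l i)))"
      unfolding a_def by (subst dotp_lin_comb[where c = 1]) (use e m in auto)
    also have "\<dots> = (\<Sum>i<m. \<epsilon>\<^sup>2 / (real m * \<mu>) * (c i * fst j i * fst k i))"
    proof (rule sum.cong[OF refl])
      fix i assume "i \<in> {..<m}"
      then have "sqrt (l i) * sqrt (l i) = l i" using l1[of i] by simp
      then have "(\<epsilon> * r * fst j i / sqrt (l i)) * (\<epsilon> * r * fst k i / sqrt (l i)) = \<epsilon>\<^sup>2 * r\<^sup>2 * (fst j i * fst k i) / l i"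
        by (simp add: power2_eq_square)
      then show "(\<epsilon> * r * fst j i / sqrt (l i)) * (\<epsilon> * r * fst k i / sqrt (l i)) =
          \<epsilon>\<^sup>2 / (real m * \<mu>) * (c i * fst j i * fst k i)"
        using \<mu> by (simp add: r(2) c_def)
    qed
    finally show ?thesis by (simp add: sum_distrib_left)
  qed
  have bb: "dotp p (b j) (b k) = \<mu> / real m * (\<Sum>i<m. d i * snd j i * snd k i)" for j k
  proof -
    have "dotp p (b j) (b k) = (\<Sum>i<m. (r * snd j i * sqrt (l (m + i))) * (r * snd k i * sqrt (l (m + i))))"
      unfolding b_def by (subst dotp_lin_comb[where c = 1]) (use e m in \<open>auto simp: e'_def\<close>)
    also have "\<dots> = (\<Sum>i<m. \<mu> / real m * (d i * snd j i * snd k i))"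
    proof (rule sum.cong[OF refl])
      fix i assume "i \<in> {..<m}"
      then have "sqrt (l (m + i)) * sqrt (l (m + i)) = l (m + i)" using l1[of i] by simp
      then have "(r * snd j i * sqrt (l (m + i))) * (r * snd k i * sqrt (l (m + i))) = r\<^sup>2 * (snd j i * snd k i) * l (m + i)"
        by (simp add: power2_eq_square ac_simps)
      then show "(r * snd j i * sqrt (l (m + i))) * (r * snd k i * sqrt (l (m + i))) = \<mu> / real m * (d i * snd j i * snd k i)"
        using \<mu> by (simp add: r(2) d_def)
    qed
    finally show ?thesis by (simp add: sum_distrib_left)
  qed
  have abs1: "\<bar>\<Sum>i<m. f i * s i * t i\<bar> \<le> real m"
    if "\<And>i. i < m \<Longrightarrow> \<bar>f i\<bar> \<le> 1" "s \<in> signs m" "t \<in> signs m" for f s t :: "nat \<Rightarrow> real"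
  proof -
    have one: "\<bar>s i\<bar> = 1" "\<bar>t i\<bar> = 1" if "i < m" for i
      using signs_square[OF \<open>s \<in> signs m\<close> that] signs_square[OF \<open>t \<in> signs m\<close> that]
      by (auto simp: power2_eq_1_iff)
    have "\<bar>\<Sum>i<m. f i * s i * t i\<bar> \<le> (\<Sum>i<m. \<bar>f i * s i * t i\<bar>)" by (rule sum_abs)
    also have "\<dots> \<le> (\<Sum>i<m. 1)" using that(1) one by (intro sum_mono) (auto simp: abs_mult)
    finally show ?thesis by simp
  qed
  show thesis
  proof
    show "0 < \<mu>" by fact
    show "\<bar>c i\<bar> \<le> 1" if "i < m" for i using c[OF that] by simp
    show "\<bar>d i\<bar> \<le> 1" if "i < m" for i using d[OF that] by simp
    show "\<exists>u' v'. dotp p u' u' = 1 \<and> dotp p v' v' = 1 \<and>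
        outer p (\<lambda>i. \<epsilon> * u (fst j) i) (v (snd j)) = outer p (\<lambda>i. \<epsilon> * u' i) v'" if "j \<in> J" for j
      using uu[of "fst j"] vv[of "snd j"] that by (intro exI[of _ "u (fst j)"] exI[of _ "v (snd j)"]) (auto simp: J_def)
    show "apply_mat p (sqrt_mat p \<Sigma>) (apply_mat p (outer p (a j) (b j)) x) i =
        apply_mat p (outer p (\<lambda>i. \<epsilon> * u (fst j) i) (v (snd j))) (apply_mat p (sqrt_mat p \<Sigma>) x) i"
      if "i < p" for j x i
    proof (rule apply_mat_outer_intertwine[OF _ _ that])
      fix x
      show "dotp p (v (snd j)) (?B x) = dotp p (b j) x"
        unfolding v_def b_def dotp_lin_comb_left
        using qB m by (intro sum.cong) (auto simp: q'_def e'_def)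
    next
      fix i assume "i < p"
      then show "?B (a j) i = \<epsilon> * u (fst j) i"
        unfolding a_def u_def app_lin_comb lin_comb_def sum_distrib_left
        using Be m l1 by (intro sum.cong) (auto simp: less_imp_neq[THEN not_sym])
    qed
    show "dotp p (b j) (a k) = 0" for j k
      unfolding a_def b_def by (subst dotp_lin_comb[where c = 0]) (use e m in \<open>auto simp: e'_def\<close>)
    show "dotp p (b j) (b j) \<le> \<mu>" if "j \<in> J" for j
    proof -
      have "(\<Sum>i<m. d i * snd j i * snd j i) \<le> real m"
        using abs1[of d "snd j" "snd j"] d that by (auto simp: J_def)
      then have "\<mu> / real m * (\<Sum>i<m. d i * snd j i * snd j i) \<le> \<mu> / real m * real m"
        using \<mu> by (intro mult_left_mono) auto
      then show ?thesis using m(1) by (simp add: bb)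
    qed
    show "\<bar>dotp p (a j) (a k)\<bar> * \<mu> \<le> \<epsilon>\<^sup>2" if "j \<in> J" "k \<in> J" for j k
    proof -
      have "\<bar>\<Sum>i<m. c i * fst j i * fst k i\<bar> \<le> real m"
        using abs1[of c "fst j" "fst k"] c that by (auto simp: J_def)
      then have "\<epsilon>\<^sup>2 / real m * \<bar>\<Sum>i<m. c i * fst j i * fst k i\<bar> \<le> \<epsilon>\<^sup>2 / real m * real m"
        by (intro mult_left_mono) auto
      then show ?thesis using m(1) \<mu> by (simp add: aa abs_mult)
    qed
    show "dotp p (a j) (a k) * dotp p (b j) (b k) = \<epsilon>\<^sup>2 / (real m)\<^sup>2 *
        ((\<Sum>i<m. c i * fst j i * fst k i) * (\<Sum>i<m. d i * snd j i * snd k i))" for j k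
      using \<mu> by (simp add: aa bb power2_eq_square)
  qed
qed

text \<open>The non-asymptotic core; the rates enter only through \<open>small\<close>. The bound 1
  / 8 on \<epsilon>^2 is what the bilinear Gaussian estimate needs, since the overlaps times \<mu>
  are at most \<epsilon>^2.\<close>

lemma type_II_lower_bound:
  fixes p T \<tau> m :: nat and \<epsilon> \<eta> :: real
  defines "N \<equiv> real (card {\<tau><..<T})"
  assumes \<Sigma>: "pos_def_mat p \<Sigma>" and m: "0 < m" "2 * m \<le> p"
    and \<epsilon>: "0 \<le> \<epsilon>" "\<epsilon> \<le> \<gamma>" "\<epsilon>\<^sup>2 \<le> 1 / 8" and R: "1 \<le> R" and \<alpha>: "0 \<le> \<alpha>" and \<eta>: "0 < \<eta>"
    and energy: "r \<le> q_weight (real \<tau> / real T) * \<epsilon>"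
    and level: "level_test p T R \<gamma> \<Sigma> \<tau> \<alpha> \<psi>"
    and small: "(N * \<epsilon>\<^sup>2 / real m)\<^sup>2 < 1"
      "exp (128 * N * \<epsilon> ^ 4) / sqrt (1 - (N * \<epsilon>\<^sup>2 / real m)\<^sup>2) \<le> 1 + \<eta>\<^sup>2"
  shows "ennreal (1 - \<alpha> - \<eta>) \<le> type_II_error p T R \<gamma> \<Sigma> \<tau> \<psi> r"
proof -
  let ?P = "noise p T"
  interpret P: prob_space ?P by (rule prob_space_noise)
  define J where "J = signs m \<times> signs m"
  have J: "finite J" "J \<noteq> {}"
    using finite_signs[of m] card_signs[of m] by (auto simp: J_def)
  show ?thesis
  proof (rule least_favourable_family[OF \<Sigma> m \<epsilon>(1), folded J_def])
    fix \<Theta> a b \<mu> and c d :: "nat \<Rightarrow> real"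
    assume \<mu>: "0 < \<mu>"
    and cd: "\<And>i. i < m \<Longrightarrow> \<bar>c i\<bar> \<le> (1 :: real)" "\<And>i. i < m \<Longrightarrow> \<bar>d i\<bar> \<le> (1 :: real)"
    and \<Theta>: "\<And>j. j \<in> J \<Longrightarrow> \<exists>u v. dotp p u u = 1 \<and> dotp p v v = 1 \<and> \<Theta> j = outer p (\<lambda>i. \<epsilon> * u i) v"
    and comm: "\<And>j x i. j \<in> J \<Longrightarrow> i < p \<Longrightarrow> apply_mat p (sqrt_mat p \<Sigma>) (apply_mat p (outer p (a j) (b j)) x) i =
        apply_mat p (\<Theta> j) (apply_mat p (sqrt_mat p \<Sigma>) x) i"
    and orth: "\<And>j k. dotp p (b j) (a k) = 0"
    and b: "\<And>j. j \<in> J \<Longrightarrow> dotp p (b j) (b j) \<le> \<mu>"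
    and aa: "\<And>j k. j \<in> J \<Longrightarrow> k \<in> J \<Longrightarrow> \<bar>dotp p (a j) (a k)\<bar> * \<mu> \<le> \<epsilon>\<^sup>2"
    and ab: "\<And>j k. dotp p (a j) (a k) * dotp p (b j) (b k) = \<epsilon>\<^sup>2 / (real m)\<^sup>2 *
        ((\<Sum>i<m. c i * fst j i * fst k i) * (\<Sum>i<m. d i * snd j i * snd k i))"
    define L where "L j w = exp (log_lr p T (transition \<tau> (0\<^sub>m p p) (outer p (a j) (b j))) w)" for j w
    \<comment> \<open>Chosen so that \<open>G j k\<close> is the sum over N steps of the mean
      interaction; the sign average then sees k0 m = N \<epsilon>^2 / m.\<close>
    define k0 where "k0 = N * \<epsilon>\<^sup>2 / (real m)\<^sup>2"
    have k0m: "k0 * real m = N * \<epsilon>\<^sup>2 / real m" using m(1) by (simp add: k0_def power2_eq_square)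
    define G where "G j k = k0 * ((\<Sum>i<m. c i * fst j i * fst k i) * (\<Sum>i<m. d i * snd j i * snd k i))" for j k
    have LM: "L j \<in> borel_measurable ?P" for j
      unfolding L_def[abs_def] measurable_cong_sets[OF sets_noise refl] by measurable
    have one: "(\<integral>\<^sup>+w. ennreal (L j w) \<partial>?P) = 1" for j
      using nn_integral_shifted[of "\<lambda>_. 1" p T] P.emeasure_space_1 by (simp add: L_def)
    have LL: "(\<integral>\<^sup>+w. ennreal (L j w * L k w) \<partial>?P) \<le> ennreal (exp (128 * N * \<epsilon> ^ 4) * exp (G j k))"
      if jk: "j \<in> J" "k \<in> J" for j k
    proof -
      let ?\<theta> = "dotp p (a j) (a k)"
      have "(\<integral>\<^sup>+w. ennreal (L j w * L k w) \<partial>?P) =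
          (\<integral>\<^sup>+z. ennreal (exp (?\<theta> * (dotp p (b j) z * dotp p (b k) z))) \<partial>std_gaussian p) ^ card {\<tau><..<T}"
        unfolding L_def by (rule nn_integral_lr_product) (rule orth)+
      also have "\<dots> \<le> ennreal (exp (?\<theta> * dotp p (b j) (b k) + 128 * (?\<theta> * \<mu>)\<^sup>2)) ^ card {\<tau><..<T}"
        using aa[OF jk] \<epsilon>(3) b jk \<mu> by (intro power_mono nn_integral_std_gaussian_exp_bilinear) auto
      also have "\<dots> = ennreal (exp (N * (?\<theta> * dotp p (b j) (b k) + 128 * (?\<theta> * \<mu>)\<^sup>2)))"
        by (simp add: ennreal_power exp_of_nat_mult N_def)
      also have "\<dots> \<le> ennreal (exp (128 * N * \<epsilon> ^ 4 + G j k))"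
      proof (intro ennreal_leI exp_le_cancel_iff[THEN iffD2])
        have "(?\<theta> * \<mu>)\<^sup>2 = (\<bar>?\<theta>\<bar> * \<mu>)\<^sup>2" by (simp add: power_mult_distrib)
        also have "\<dots> \<le> (\<epsilon>\<^sup>2)\<^sup>2" using aa[OF jk] \<mu> by (intro power_mono) auto
        also have "\<dots> = \<epsilon> ^ 4" by (simp flip: power_mult)
        finally have "N * (?\<theta> * \<mu>)\<^sup>2 \<le> N * \<epsilon> ^ 4" by (intro mult_left_mono) (simp_all add: N_def)
        moreover have "N * (?\<theta> * dotp p (b j) (b k)) = G j k"
          unfolding ab by (simp add: G_def k0_def)
        ultimately show "N * (?\<theta> * dotp p (b j) (b k) + 128 * (?\<theta> * \<mu>)\<^sup>2) \<le> 128 * N * \<epsilon> ^ 4 + G j k"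
          by (simp add: distrib_left)
      qed
      finally show ?thesis by (simp add: exp_add)
    qed
    have second: "(\<Sum>j\<in>J. \<Sum>k\<in>J. \<integral>\<^sup>+w. ennreal (L j w * L k w) \<partial>?P) \<le> ennreal ((1 + \<eta>\<^sup>2) * (real (card J))\<^sup>2)"
    proof -
      have "(\<Sum>j\<in>J. \<Sum>k\<in>J. \<integral>\<^sup>+w. ennreal (L j w * L k w) \<partial>?P) \<le>
          (\<Sum>j\<in>J. \<Sum>k\<in>J. ennreal (exp (128 * N * \<epsilon> ^ 4) * exp (G j k)))"
        by (intro sum_mono LL)
      also have "\<dots> = ennreal (exp (128 * N * \<epsilon> ^ 4) * (\<Sum>j\<in>J. \<Sum>k\<in>J. exp (G j k)))"
        by (simp add: sum_ennreal sum_nonneg sum_distrib_left)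
      also have "\<dots> \<le> ennreal ((1 + \<eta>\<^sup>2) * (real (card J))\<^sup>2)"
      proof (rule ennreal_leI)
        have "(\<Sum>j\<in>J. \<Sum>k\<in>J. exp (G j k)) \<le> (real (card J))\<^sup>2 / sqrt (1 - (k0 * real m)\<^sup>2)"
          using sum_sign_pairs_exp_bilinear_le[of m c d k0] cd small(1)
          by (simp add: G_def J_def k0m case_prod_unfold)
        then have "exp (128 * N * \<epsilon> ^ 4) * (\<Sum>j\<in>J. \<Sum>k\<in>J. exp (G j k)) \<le>
            exp (128 * N * \<epsilon> ^ 4) * ((real (card J))\<^sup>2 / sqrt (1 - (k0 * real m)\<^sup>2))"
          by (intro mult_left_mono) auto
        also have "\<dots> = exp (128 * N * \<epsilon> ^ 4) / sqrt (1 - (N * \<epsilon>\<^sup>2 / real m)\<^sup>2) * (real (card J))\<^sup>2"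
          by (simp add: k0m)
        also have "\<dots> \<le> (1 + \<eta>\<^sup>2) * (real (card J))\<^sup>2"
          using small(2) by (intro mult_right_mono) auto
        finally show "exp (128 * N * \<epsilon> ^ 4) * (\<Sum>j\<in>J. \<Sum>k\<in>J. exp (G j k)) \<le> (1 + \<eta>\<^sup>2) * (real (card J))\<^sup>2" .
      qed
      finally show ?thesis .
    qed
    define A0 where "A0 = {x \<in> space (path_space p T). \<psi> x = 0}"
    define A1 where "A1 = {x \<in> space (path_space p T). \<psi> x = 1}"
    have \<psi>: "\<psi> \<in> path_space p T \<rightarrow>\<^sub>M count_space {0, 1}"
      using level by (simp add: level_test_def is_test_def)
    have A1: "A1 \<in> sets (path_space p T)"
      using measurable_sets[OF \<psi>, of "{1}"] by (simp add: A1_def vimage_def Int_def conj_commute)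
    have A0: "A0 = space (path_space p T) - A1"
      using measurable_space[OF \<psi>] by (auto simp: A0_def A1_def)
    \<comment> \<open>The rejection region seen from the noise. One set serves the null law and all
      alternatives, which differ only in their densities.\<close>
    define A where "A = coloured p T \<Sigma> -` A1 \<inter> space ?P"
    have A: "A \<in> P.events"
      unfolding A_def sets_noise space_noise using measurable_coloured A1 by (rule measurable_sets)
    have ind: "indicator A1 (coloured p T \<Sigma> w) = (indicator A w :: ennreal)" if "w \<in> space ?P" for w
      using that by (simp add: A_def split: split_indicator)
    have z: "0\<^sub>m p p \<in> param_mats p R \<gamma>" using \<epsilon> by (intro zero_param_mats) auto
    have PA: "P.prob A \<le> \<alpha>"
    proof -
      have "emeasure (var_law p T \<Sigma> \<tau> (0\<^sub>m p p) (0\<^sub>m p p)) A1 =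
          (\<integral>\<^sup>+w. indicator A1 (coloured p T \<Sigma> w) * ennreal (exp (log_lr p T (transition \<tau> (0\<^sub>m p p) (0\<^sub>m p p)) w)) \<partial>?P)"
        by (rule emeasure_var_law[OF \<Sigma> _ A1]) (simp add: apply_mat_def)
      also have "\<dots> = (\<integral>\<^sup>+w. indicator A w \<partial>?P)"
      proof (rule nn_integral_cong)
        fix w assume w: "w \<in> space ?P"
        have "dotp p (apply_mat p (0\<^sub>m p p) x) y = 0" for x y
          by (simp add: dotp_def apply_mat_zero)
        then show "indicator A1 (coloured p T \<Sigma> w) *
            ennreal (exp (log_lr p T (transition \<tau> (0\<^sub>m p p) (0\<^sub>m p p)) w)) = indicator A w"
          using ind[OF w] by (simp add: log_lr_transition)
      qed
      also have "\<dots> = emeasure ?P A" using A by simp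
      finally have "emeasure ?P A = emeasure (var_law p T \<Sigma> \<tau> (0\<^sub>m p p) (0\<^sub>m p p)) A1" ..
      also have "\<dots> \<le> type_I_error p T R \<gamma> \<Sigma> \<tau> \<psi>"
        unfolding type_I_error_def A1_def
        by (rule SUP_upper2[of "(0\<^sub>m p p, 0\<^sub>m p p)"]) (use z in \<open>auto simp: null_params_def\<close>)
      also have "\<dots> \<le> ennreal \<alpha>" using level by (simp add: level_test_def)
      finally show ?thesis using \<alpha> by (simp add: P.emeasure_eq_measure)
    qed
    have "\<exists>j\<in>J. (\<integral>\<^sup>+w. indicator A w * ennreal (L j w) \<partial>?P) \<le> ennreal (\<alpha> + \<eta>)"
      by (rule P.mixture_second_moment[OF J LM _ one second A \<eta> PA]) (simp add: L_def)
    then obtain j where j: "j \<in> J" "(\<integral>\<^sup>+w. indicator A w * ennreal (L j w) \<partial>?P) \<le> ennreal (\<alpha> + \<eta>)"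
      by blast
    let ?Q = "var_law p T \<Sigma> \<tau> (0\<^sub>m p p) (\<Theta> j)"
    interpret Q: prob_space ?Q by (rule prob_space_var_law)
    have sQ: "sets ?Q = sets (path_space p T)" by (simp add: var_law_def)
    have "emeasure ?Q A1 = (\<integral>\<^sup>+w. indicator A1 (coloured p T \<Sigma> w) * ennreal (L j w) \<partial>?P)"
      unfolding L_def by (rule emeasure_var_law[OF \<Sigma> comm[OF j(1)] A1])
    also have "\<dots> = (\<integral>\<^sup>+w. indicator A w * ennreal (L j w) \<partial>?P)"
      by (intro nn_integral_cong) (simp add: ind)
    also note j(2)
    finally have "Q.prob A1 \<le> \<alpha> + \<eta>" using \<alpha> \<eta> by (simp add: Q.emeasure_eq_measure del: ennreal_plus)
    moreover have "Q.prob A0 = 1 - Q.prob A1"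
      unfolding A0 using Q.prob_compl[of A1] A1 sQ sets_eq_imp_space_eq[OF sQ] by simp
    ultimately have "ennreal (1 - \<alpha> - \<eta>) \<le> emeasure ?Q A0"
      by (simp add: Q.emeasure_eq_measure ennreal_leI)
    also have "\<dots> \<le> type_II_error p T R \<gamma> \<Sigma> \<tau> \<psi> r"
    proof -
      obtain u v where uv: "dotp p u u = 1" "dotp p v v = 1" "\<Theta> j = outer p (\<lambda>i. \<epsilon> * u i) v"
        using \<Theta>[OF j(1)] by blast
      have "\<Theta> j \<in> param_mats p R \<gamma>" "frob_norm (0\<^sub>m p p - \<Theta> j) = \<epsilon>"
        unfolding uv(3) using outer_param_mats[OF uv(1,2) \<epsilon>(1,2) R] by auto
      then have "(0\<^sub>m p p, \<Theta> j) \<in> alt_params p R \<gamma> T \<tau> r"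
        using z energy by (simp add: alt_params_def energy_def)
      then show ?thesis
        unfolding type_II_error_def A0_def by (rule SUP_upper2) simp
    qed
    finally show "ennreal (1 - \<alpha> - \<eta>) \<le> type_II_error p T R \<gamma> \<Sigma> \<tau> \<psi> r" .
  qed
qed

text \<open>Each regime controls one of the two quantities directly. Their ratio is p / sqrt T,
  which the regime bounds on the side that is needed, so the other quantity follows up to the factor
  C or 1 / C.\<close>

lemma signal_rates:
  fixes r :: "nat \<Rightarrow> real" and p T :: "nat \<Rightarrow> nat" and C D :: real
  assumes "0 < C" "0 < D"
    and p: "filterlim p at_top sequentially" and T: "filterlim T at_top sequentially"
    and a: "((\<lambda>n. r n * (real (T n) / real (p n)) powr (1/2)) \<longlongrightarrow> 0)
              (inf sequentially (principal {n. real (p n) \<le> C * sqrt (real (T n))}))"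
    and b: "((\<lambda>n. r n * real (T n) powr (1/4)) \<longlongrightarrow> 0)
              (inf sequentially (principal {n. real (p n) \<ge> C * sqrt (real (T n))}))"
  shows "eventually (\<lambda>n. (r n)\<^sup>2 * sqrt (real (T n)) < D \<and> (r n)\<^sup>2 * real (T n) / real (p n) < D) sequentially"
proof -
  \<comment> \<open>Small enough to survive both conversions, multiplication and division by
    C.\<close>
  define D' where "D' = min D (min (D / C) (C * D))"
  have D': "0 < D'" "D' \<le> D" "C * D' \<le> D" "D' / C \<le> D"
  proof -
    show "0 < D'" "D' \<le> D" using assms(1,2) by (auto simp: D'_def)
    have "D' \<le> D / C" "D' \<le> C * D" by (auto simp: D'_def)
    then show "C * D' \<le> D" "D' / C \<le> D" using assms(1) by (auto simp: field_simps)
  qed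
  have sq: "0 < sqrt D'" using D' by simp
  have "eventually (\<lambda>n. real (p n) \<le> C * sqrt (real (T n)) \<longrightarrow>
      \<bar>r n * (real (T n) / real (p n)) powr (1/2)\<bar> < sqrt D') sequentially"
    using tendstoD[OF a sq] by (simp add: eventually_inf_principal)
  moreover have "eventually (\<lambda>n. C * sqrt (real (T n)) \<le> real (p n) \<longrightarrow>
      \<bar>r n * real (T n) powr (1/4)\<bar> < sqrt D') sequentially"
    using tendstoD[OF b sq] by (simp add: eventually_inf_principal)
  moreover have "eventually (\<lambda>n. 1 \<le> p n) sequentially" "eventually (\<lambda>n. 1 \<le> T n) sequentially"
    using p T by (simp_all add: filterlim_at_top)
  ultimately show ?thesis
  proof eventually_elim
    case (elim n)
    let ?X = "(r n)\<^sup>2 * sqrt (real (T n))" and ?Y = "(r n)\<^sup>2 * real (T n) / real (p n)"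
    have p: "0 < real (p n)" and T: "0 < sqrt (real (T n))" using elim by auto
    have TT: "real (T n) = sqrt (real (T n)) * sqrt (real (T n))" by simp
    have sqD: "x\<^sup>2 < D'" if "\<bar>x\<bar> < sqrt D'" for x
    proof -
      have "\<bar>x\<bar>\<^sup>2 < (sqrt D')\<^sup>2" using that by (intro power_strict_mono) auto
      then show ?thesis using D' by simp
    qed
    consider "real (p n) \<le> C * sqrt (real (T n))" | "C * sqrt (real (T n)) \<le> real (p n)" by linarith
    then show ?case
    proof cases
      case 1
      have "(r n * (real (T n) / real (p n)) powr (1/2))\<^sup>2 = ?Y"
        by (simp add: powr_half_sqrt power_mult_distrib)
      then have Y: "?Y < D'" using sqD elim(1) 1 by metis
      have "?X = ?Y * (real (p n) / sqrt (real (T n)))"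
        using p T TT by (simp add: field_simps)
      also have "\<dots> \<le> ?Y * C" using 1 p T by (intro mult_left_mono) (auto simp: divide_le_eq)
      also have "\<dots> < D' * C" using Y assms(1) by (rule mult_strict_right_mono)
      finally show ?thesis using D' Y by (simp add: mult.commute)
    next
      case 2
      have "(r n * real (T n) powr (1/4))\<^sup>2 = (r n)\<^sup>2 * (real (T n) powr (1/4) * real (T n) powr (1/4))"
        by (simp add: power2_eq_square)
      also have "\<dots> = ?X" by (simp add: powr_add[symmetric] powr_half_sqrt)
      finally have X: "?X < D'" using sqD elim(2) 2 by metis
      have "?Y \<le> (r n)\<^sup>2 * real (T n) / (C * sqrt (real (T n)))"
        using 2 p T assms(1) by (intro divide_left_mono mult_pos_pos) auto
      also have "\<dots> = ?X / C"
        using T TT assms(1) by (simp add: field_simps)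
      also have "\<dots> < D' / C" using X assms(1) by (rule divide_strict_right_mono)
      finally show ?thesis using D' X by simp
    qed
  qed
qed

text \<open>Continuity at 0, where the value is 1; the one-sided filter supplies a positive
  \<delta>.\<close>

lemma chi_square_bound_tends_to_one:
  fixes \<eta> :: real
  assumes "0 < \<eta>"
  obtains \<delta> where "0 < \<delta>" "\<delta> < 1" "exp (128 * \<delta>) / sqrt (1 - \<delta>\<^sup>2) \<le> 1 + \<eta>\<^sup>2"
proof -
  have "((\<lambda>\<delta>. exp (128 * \<delta>) / sqrt (1 - \<delta>\<^sup>2)) \<longlongrightarrow> exp (128 * 0) / sqrt (1 - 0\<^sup>2)) (at_right 0)"
    by (intro tendsto_intros) auto
  moreover have "exp (128 * 0) / sqrt (1 - 0\<^sup>2) < 1 + \<eta>\<^sup>2" using assms by simp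
  ultimately have "eventually (\<lambda>\<delta>. exp (128 * \<delta>) / sqrt (1 - \<delta>\<^sup>2) < 1 + \<eta>\<^sup>2) (at_right 0)"
    by (rule order_tendstoD(2))
  moreover have "eventually (\<lambda>\<delta>. \<delta> \<in> {0<..<1::real}) (at_right 0)"
    by (rule eventually_at_right_real) simp
  ultimately have "eventually (\<lambda>\<delta>. \<delta> \<in> {0<..<1} \<and> exp (128 * \<delta>) / sqrt (1 - \<delta>\<^sup>2) < 1 + \<eta>\<^sup>2) (at_right (0::real))"
    by eventually_elim simp
  then obtain \<delta> where "\<delta> \<in> {0<..<1}" "exp (128 * \<delta>) / sqrt (1 - \<delta>\<^sup>2) < 1 + \<eta>\<^sup>2"
    using eventually_happens'[OF trivial_limit_at_right_real] by blast
  then show thesis by (intro that[of \<delta>]) auto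
qed

text \<open>The double limit is taken along arbitrary sequences of dimensions and sample sizes. C is
  the implicit constant that separates the regimes; each rate is required along the indices of its
  own regime, and it is void if these are finite in number.\<close>

theorem theorem2:
  fixes \<alpha> \<gamma> h C :: real
    and p T \<tau> R :: "nat \<Rightarrow> nat"
    and \<Sigma>Z :: "nat \<Rightarrow> real mat"
    and r :: "nat \<Rightarrow> real"
    and \<psi> :: "nat \<Rightarrow> (nat \<Rightarrow> nat \<Rightarrow> real) \<Rightarrow> nat"
  assumes "0 < \<alpha>" "\<alpha> < 1"
    and "0 < \<gamma>" "\<gamma> < 1"
    and "0 < h"
    and "0 < C"
    and "filterlim p at_top sequentially"
    and "filterlim T at_top sequentially"
    and "\<And>n. 1 \<le> R n"
    and "\<And>n. pos_def_mat (p n) (\<Sigma>Z n)"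
    and "\<And>n. \<tau> n \<in> {1..T n - 1}"
    and "\<And>n. h \<le> min (real (\<tau> n) / real (T n)) (1 - real (\<tau> n) / real (T n))"
    and "\<And>n. 0 < r n"
    and a: "((\<lambda>n. r n * (real (T n) / real (p n)) powr (1/2)) \<longlongrightarrow> 0)
              (inf sequentially (principal {n. real (p n) \<le> C * sqrt (real (T n))}))"
    and b: "((\<lambda>n. r n * real (T n) powr (1/4)) \<longlongrightarrow> 0)
              (inf sequentially (principal {n. real (p n) \<ge> C * sqrt (real (T n))}))"
    and "\<And>n. level_test (p n) (T n) (R n) \<gamma> (\<Sigma>Z n) (\<tau> n) \<alpha> (\<psi> n)"
  shows "liminf (\<lambda>n. type_II_error (p n) (T n) (R n) \<gamma> (\<Sigma>Z n) (\<tau> n) (\<psi> n) (r n))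
           \<ge> ennreal (1 - \<alpha>)"
proof -
  let ?\<beta> = "\<lambda>n. type_II_error (p n) (T n) (R n) \<gamma> (\<Sigma>Z n) (\<tau> n) (\<psi> n) (r n)"
  have bound: "eventually (\<lambda>n. ennreal (1 - \<alpha> - \<eta>) \<le> ?\<beta> n) sequentially" if \<eta>: "0 < \<eta>" for \<eta>
  proof -
    obtain \<delta> where \<delta>: "0 < \<delta>" "\<delta> < 1" "exp (128 * \<delta>) / sqrt (1 - \<delta>\<^sup>2) \<le> 1 + \<eta>\<^sup>2"
      using chi_square_bound_tends_to_one[OF \<eta>] by blast
    \<comment> \<open>With \<epsilon>^2 \<le> 2 r^2 / h the three entries give, in this order,
      \<epsilon> \<le> \<gamma>, \<epsilon>^2 \<le> 1 / 8 and \<epsilon>^2 T / p \<le> \<delta> / 4.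
      The last 4 is used up by p \<le> 4 m.\<close>
    define D where "D = min (h * \<gamma>\<^sup>2 / 2) (min (h / 16) (h * \<delta> / 8))"
    have D: "0 < D" "D \<le> h * \<gamma>\<^sup>2 / 2" "D \<le> h / 16" "D \<le> h * \<delta> / 8"
      using \<open>0 < h\<close> \<open>0 < \<gamma>\<close> \<delta> by (auto simp: D_def)
    have "eventually (\<lambda>n. 2 \<le> p n) sequentially" "eventually (\<lambda>n. 1 \<le> T n) sequentially"
      using assms(7,8) by (simp_all add: filterlim_at_top)
    then show ?thesis
      using signal_rates[OF \<open>0 < C\<close> D(1) assms(7,8) a b]
    proof eventually_elim
      case (elim n)
      define s where "s = real (\<tau> n) / real (T n)"
      define \<epsilon> where "\<epsilon> = r n / q_weight s"
      define m where "m = p n div 2"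
      let ?N = "real (card {\<tau> n<..<T n})"
      have T: "1 \<le> sqrt (real (T n))" using elim by simp
      have s: "h \<le> s" "h \<le> 1 - s" using assms(12)[of n] by (auto simp: s_def)
      \<comment> \<open>One of the factors s and 1 - s is at least 1 / 2, and the other is at least
        h.\<close>
      have "h / 2 \<le> s * (1 - s)"
      proof (cases "s \<le> 1 / 2")
        case True
        then have "h * (1 / 2) \<le> s * (1 - s)" using s \<open>0 < h\<close> by (intro mult_mono) auto
        then show ?thesis by simp
      next
        case False
        then have "(1 / 2) * h \<le> s * (1 - s)" using s \<open>0 < h\<close> by (intro mult_mono) auto
        then show ?thesis by simp
      qed
      then have q: "h / 2 \<le> (q_weight s)\<^sup>2" "0 < q_weight s"
        using \<open>0 < h\<close> by (auto simp: q_weight_def)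
      have \<epsilon>0: "0 \<le> \<epsilon>" using assms(13)[of n] q by (simp add: \<epsilon>_def)
      have "\<epsilon>\<^sup>2 = (r n)\<^sup>2 / (q_weight s)\<^sup>2" by (simp add: \<epsilon>_def power_divide)
      also have "\<dots> \<le> (r n)\<^sup>2 / (h / 2)" using q \<open>0 < h\<close> by (intro divide_left_mono) auto
      finally have \<epsilon>2: "\<epsilon>\<^sup>2 \<le> 2 / h * (r n)\<^sup>2" by (simp add: mult.commute)
      have hD: "2 / h * D \<le> \<gamma>\<^sup>2" "2 / h * D \<le> 1 / 8" "2 / h * D \<le> \<delta> / 4"
        using D \<open>0 < h\<close> by (auto simp: field_simps)
      have X: "\<epsilon>\<^sup>2 * sqrt (real (T n)) \<le> 2 / h * D"
      proof -
        have "\<epsilon>\<^sup>2 * sqrt (real (T n)) \<le> 2 / h * (r n)\<^sup>2 * sqrt (real (T n))"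
          using \<epsilon>2 T by (intro mult_right_mono) auto
        also have "\<dots> \<le> 2 / h * D"
          unfolding mult.assoc using elim(3) \<open>0 < h\<close> by (intro mult_left_mono) auto
        finally show ?thesis .
      qed
      have Y: "\<epsilon>\<^sup>2 * real (T n) / real (p n) \<le> 2 / h * D"
      proof -
        have "\<epsilon>\<^sup>2 * (real (T n) / real (p n)) \<le> 2 / h * (r n)\<^sup>2 * (real (T n) / real (p n))"
          using \<epsilon>2 by (intro mult_right_mono) auto
        also have "\<dots> \<le> 2 / h * D"
          unfolding mult.assoc using elim(3) \<open>0 < h\<close> by (intro mult_left_mono) auto
        finally show ?thesis by simp
      qed
      have e: "\<epsilon>\<^sup>2 \<le> 2 / h * D"
      proof -
        have "\<epsilon>\<^sup>2 * 1 \<le> \<epsilon>\<^sup>2 * sqrt (real (T n))" using T by (intro mult_left_mono) auto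
        with X show ?thesis by simp
      qed
      have N: "0 \<le> ?N" "?N \<le> real (T n)" by auto
      \<comment> \<open>For p \<ge> 2 rounding down in m = p div 2 costs at most another factor
        2.\<close>
      have m: "0 < m" "2 * m \<le> p n" "real (p n) \<le> 4 * real m" using elim(1) by (auto simp: m_def)
      have N4: "?N * \<epsilon> ^ 4 \<le> \<delta>"
      proof -
        have "?N * \<epsilon> ^ 4 \<le> real (T n) * \<epsilon> ^ 4" using N by (intro mult_right_mono) auto
        also have "\<dots> = (\<epsilon>\<^sup>2 * sqrt (real (T n)))\<^sup>2" by (simp add: power_mult_distrib mult.commute)
        also have "\<dots> \<le> (2 / h * D)\<^sup>2" using X T by (intro power_mono) auto
        also have "\<dots> \<le> (\<delta> / 4) * (1 / 8)"
          unfolding power2_eq_square using hD D(1) \<open>0 < h\<close> \<delta>(1) by (intro mult_mono) auto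
        also have "\<dots> \<le> \<delta>" using \<delta>(1) by simp
        finally show ?thesis .
      qed
      have Nm: "0 \<le> ?N * \<epsilon>\<^sup>2 / real m" "?N * \<epsilon>\<^sup>2 / real m \<le> \<delta>"
      proof -
        have "?N * \<epsilon>\<^sup>2 / real m \<le> real (T n) * \<epsilon>\<^sup>2 / (real (p n) / 4)"
          using N m elim(1) by (intro frac_le mult_right_mono) auto
        also have "\<dots> = 4 * (\<epsilon>\<^sup>2 * real (T n) / real (p n))" by simp
        also have "\<dots> \<le> \<delta>" using Y hD(3) by linarith
        finally show "?N * \<epsilon>\<^sup>2 / real m \<le> \<delta>" .
      qed simp
      have sq: "(?N * \<epsilon>\<^sup>2 / real m)\<^sup>2 \<le> \<delta>\<^sup>2" using Nm by (intro power_mono) auto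
      have \<delta>2: "\<delta>\<^sup>2 < 1" using \<delta> by (simp add: power_less_one_iff)
      show "ennreal (1 - \<alpha> - \<eta>) \<le> ?\<beta> n"
      proof (rule type_II_lower_bound[where m = m and \<epsilon> = \<epsilon>])
        show "pos_def_mat (p n) (\<Sigma>Z n)" by fact
        show "0 < m" "2 * m \<le> p n" by fact+
        show "0 \<le> \<epsilon>" by fact
        show "\<epsilon> \<le> \<gamma>" using e hD(1) \<open>0 < \<gamma>\<close> by (intro power2_le_imp_le[of \<epsilon> \<gamma>]) auto
        show "\<epsilon>\<^sup>2 \<le> 1 / 8" using e hD(2) by linarith
        show "1 \<le> R n" by fact
        show "0 \<le> \<alpha>" "0 < \<eta>" using assms(1) \<eta> by auto
        show "r n \<le> q_weight (real (\<tau> n) / real (T n)) * \<epsilon>" using q by (simp add: \<epsilon>_def s_def)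
        show "level_test (p n) (T n) (R n) \<gamma> (\<Sigma>Z n) (\<tau> n) \<alpha> (\<psi> n)" by fact
        show "(?N * \<epsilon>\<^sup>2 / real m)\<^sup>2 < 1" using sq \<delta>2 by linarith
        have "exp (128 * ?N * \<epsilon> ^ 4) / sqrt (1 - (?N * \<epsilon>\<^sup>2 / real m)\<^sup>2) \<le> exp (128 * \<delta>) / sqrt (1 - \<delta>\<^sup>2)"
          using N4 sq \<delta>2 by (intro frac_le) auto
        then show "exp (128 * ?N * \<epsilon> ^ 4) / sqrt (1 - (?N * \<epsilon>\<^sup>2 / real m)\<^sup>2) \<le> 1 + \<eta>\<^sup>2"
          using \<delta>(3) by linarith
      qed
    qed
  qed
  show ?thesis
    unfolding le_Liminf_iff
  proof (intro allI impI)
    fix y assume y: "y < ennreal (1 - \<alpha>)"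
    then obtain y' where y': "y = ennreal y'" "0 \<le> y'" "y' < 1 - \<alpha>"
      by (cases y) (auto simp: ennreal_less_iff)
    \<comment> \<open>Here \<eta> is taken as half the gap between y' and 1 - \<alpha>.\<close>
    then have "y < ennreal (1 - \<alpha> - (1 - \<alpha> - y') / 2)" by (simp add: ennreal_less_iff field_simps)
    moreover have "0 < (1 - \<alpha> - y') / 2" using y' by simp
    ultimately show "eventually (\<lambda>n. y < ?\<beta> n) sequentially"
      using bound[of "(1 - \<alpha> - y') / 2"] by (auto elim!: eventually_mono intro: less_le_trans)
  qed
qed

end
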